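(* Let $A$ be a densely defined operator on a complex Banach space $X$ such that $\sigma(A)\subset\{\Re z\ge0\}$ and $\sup_{\alpha>0}\alpha\int_{\mathbb{R}}|\langle(\alpha+i\beta+A)^{-2}x,x^*\rangle|\,d\beta<\infty$ for all $x\in X$, $x^*\in X^*$. Let $f\in\mathcal{B}$ and $\lambda\in\mathbb{C}$. Then: (1) if $x\in D(A)$ and $Ax=\lambda x$, then $f(A)x=f(\lambda)x$; (2) if $x^*\in D(A^* )$ and $A^*x^*=\lambda x^*$, then $f(A)^*x^*=f(\lambda)x^*$; (3) if $\lambda\in\sigma(A)$ then $f(\lambda)\in\sigma(f(A))$; (4) if $A\in\mathrm{Sect}(\pi/2-)$, then $\sigma(f(A))\cup\{f(\infty)\}=f(\sigma(A))\cup\{f(\infty)\}$.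
   Context: $\mathbb{C}_+=\{z:\Re z>0\}$. $\mathcal{B}$ is the space of holomorphic $f:\mathbb{C}_+\to\mathbb{C}$ with $\int_0^\infty\sup_{y\in\mathbb{R}}|f'(x+iy)|\,dx<\infty$; every $f\in\mathcal{B}$ extends continuously to $\{\Re z\ge0\}$ (so $f(\lambda)$ makes sense for $\Re\lambda\ge0$) and $f(\infty):=\lim_{\Re z\to\infty}f(z)$ exists. For $f\in\mathcal{B}$, the bounded operator $f(A)$ is defined by $\langle f(A)x,x^*\rangle=f(\infty)\langle x,x^*\rangle-\frac{2}{\pi}\int_0^\infty\alpha\int_{\mathbb{R}}\langle(\alpha-i\beta+A)^{-2}x,x^*\rangle f'(\alpha+i\beta)\,d\beta\,d\alpha$. For $\theta\in(0,\pi)$, $\Sigma_\theta=\{z\ne0:|\arg z|<\theta\}$, $\Sigma_0=(0,\infty)$. A densely defined operator $A$ is sectorial of angle $\theta\in[0,\pi/2)$ if $\sigma(A)\subset\overline{\Sigma_\theta}$ and for each $\theta'\in(\theta,\pi]$ there is $C_{\theta'}$ with $\|z(z+A)^{-1}\|\le C_{\theta'}$ for $z\in\Sigma_{\pi-\theta'}$; $\mathrm{Sect}(\pi/2-)$ is the union of these classes over $\theta\in[0,\pi/2)$. *)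

theory Defs
  imports "HOL-Analysis.Analysis"
begin

class complex_banach = banach +
  fixes scaleC :: "complex \<Rightarrow> 'a \<Rightarrow> 'a"
  assumes scaleC_add_right: "scaleC a (x + y) = scaleC a x + scaleC a y"
    and scaleC_add_left: "scaleC (a + b) x = scaleC a x + scaleC b x"
    and scaleC_scaleC: "scaleC a (scaleC b x) = scaleC (a * b) x"
    and scaleC_one: "scaleC 1 x = x"
    and scaleC_of_real: "scaleC (complex_of_real r) x = scaleR r x"
    and norm_scaleC: "norm (scaleC a x) = cmod a * norm x"

definition cbounded_op :: "('a::complex_banach \<Rightarrow> 'a) \<Rightarrow> bool" where
  "cbounded_op T \<longleftrightarrow> bounded_linear T \<and> (\<forall>c x. T (scaleC c x) = scaleC c (T x))"

definition dual_elem :: "('a::complex_banach \<Rightarrow> complex) \<Rightarrow> bool" where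
  "dual_elem \<phi> \<longleftrightarrow> bounded_linear \<phi> \<and> (\<forall>c x. \<phi> (scaleC c x) = c * \<phi> x)"

definition lin_op :: "'a::complex_banach set \<Rightarrow> ('a \<Rightarrow> 'a) \<Rightarrow> bool" where
  "lin_op D A \<longleftrightarrow> 0 \<in> D \<and> (\<forall>x\<in>D. \<forall>y\<in>D. x + y \<in> D \<and> A (x + y) = A x + A y)
     \<and> (\<forall>c. \<forall>x\<in>D. scaleC c x \<in> D \<and> A (scaleC c x) = scaleC c (A x))"

definition densely_defined :: "'a::complex_banach set \<Rightarrow> ('a \<Rightarrow> 'a) \<Rightarrow> bool" where
  "densely_defined D A \<longleftrightarrow> lin_op D A \<and> closure D = UNIV"

definition bounded_inverse_of :: "'a::complex_banach set \<Rightarrow> ('a \<Rightarrow> 'a) \<Rightarrow> ('a \<Rightarrow> 'a) \<Rightarrow> bool" where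
  "bounded_inverse_of D B R \<longleftrightarrow> cbounded_op R \<and> (\<forall>y. R y \<in> D \<and> B (R y) = y) \<and> (\<forall>x\<in>D. R (B x) = x)"

definition op_spectrum :: "'a::complex_banach set \<Rightarrow> ('a \<Rightarrow> 'a) \<Rightarrow> complex set" where
  "op_spectrum D A = {l. \<not> (\<exists>R. bounded_inverse_of D (\<lambda>x. scaleC l x - A x) R)}"

definition shifted_inv :: "'a::complex_banach set \<Rightarrow> ('a \<Rightarrow> 'a) \<Rightarrow> complex \<Rightarrow> 'a \<Rightarrow> 'a" where
  "shifted_inv D A w = (THE R. bounded_inverse_of D (\<lambda>x. scaleC w x + A x) R)"

definition shifted_inv2 :: "'a::complex_banach set \<Rightarrow> ('a \<Rightarrow> 'a) \<Rightarrow> complex \<Rightarrow> 'a \<Rightarrow> 'a" where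
  "shifted_inv2 D A w = shifted_inv D A w \<circ> shifted_inv D A w"

text \<open>x^* belongs to D(A^*) and A^* x^* = y^*.\<close>

definition adjoint_rel :: "'a::complex_banach set \<Rightarrow> ('a \<Rightarrow> 'a) \<Rightarrow> ('a \<Rightarrow> complex) \<Rightarrow> ('a \<Rightarrow> complex) \<Rightarrow> bool" where
  "adjoint_rel D A \<phi> \<psi> \<longleftrightarrow> dual_elem \<phi> \<and> dual_elem \<psi> \<and> (\<forall>x\<in>D. \<phi> (A x) = \<psi> x)"

definition rhp :: "complex set" where
  "rhp = {z. 0 < Re z}"

definition class_B :: "(complex \<Rightarrow> complex) \<Rightarrow> bool" where
  "class_B f \<longleftrightarrow> f holomorphic_on rhp \<and>
     (\<integral>\<^sup>+ x\<in>{0<..}. (SUP y. ennreal (cmod (deriv f (Complex x y)))) \<partial>lborel) < \<infinity>"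

text \<open>Value of (the continuous extension to the closed half-plane of) f at z, Re z \<ge> 0.\<close>

definition B_val :: "(complex \<Rightarrow> complex) \<Rightarrow> complex \<Rightarrow> complex" where
  "B_val f z = Lim (at z within rhp) f"

definition B_inf :: "(complex \<Rightarrow> complex) \<Rightarrow> complex" where
  "B_inf f = Lim (filtercomap Re at_top) f"

definition B_calc :: "'a::complex_banach set \<Rightarrow> ('a \<Rightarrow> 'a) \<Rightarrow> (complex \<Rightarrow> complex) \<Rightarrow> 'a \<Rightarrow> 'a" where
  "B_calc D A f = (THE T. cbounded_op T \<and> (\<forall>x \<phi>. dual_elem \<phi> \<longrightarrow>
      \<phi> (T x) = B_inf f * \<phi> x - complex_of_real (2 / pi) *
        (LINT \<alpha>:{0<..}|lborel. complex_of_real \<alpha> *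
           (LINT \<beta>|lborel. \<phi> (shifted_inv2 D A (Complex \<alpha> (- \<beta>)) x) * deriv f (Complex \<alpha> \<beta>)))))"

definition sector :: "real \<Rightarrow> complex set" where
  "sector \<theta> = (if \<theta> = 0 then {z. Im z = 0 \<and> 0 < Re z} else {z. z \<noteq> 0 \<and> \<bar>Arg z\<bar> < \<theta>})"

definition sectorial :: "real \<Rightarrow> 'a::complex_banach set \<Rightarrow> ('a \<Rightarrow> 'a) \<Rightarrow> bool" where
  "sectorial \<theta> D A \<longleftrightarrow> densely_defined D A \<and> op_spectrum D A \<subseteq> closure (sector \<theta>) \<and>
     (\<forall>\<theta>'. \<theta> < \<theta>' \<and> \<theta>' \<le> pi \<longrightarrow>
        (\<exists>C. \<forall>z\<in>sector (pi - \<theta>'). onorm (\<lambda>x. scaleC z (shifted_inv D A z x)) \<le> C))"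

definition sect_half_pi_minus :: "'a::complex_banach set \<Rightarrow> ('a \<Rightarrow> 'a) \<Rightarrow> bool" where
  "sect_half_pi_minus D A \<longleftrightarrow> (\<exists>\<theta>. 0 \<le> \<theta> \<and> \<theta> < pi / 2 \<and> sectorial \<theta> D A)"

end

theory Submission
  imports Defs "HOL-Probability.Sinc_Integral" "HOL-Complex_Analysis.Complex_Analysis" "HOL-Real_Asymp.Real_Asymp"
begin

text \<open>
  Cauchy's formula on the line \<open>Re z = \<alpha>\<close> turns the inner integral for the scalar \<open>A = \<lambda>\<close> into
  \<open>-2\<pi> f''(2\<alpha> + \<lambda>)\<close>, and integration by parts yields the reproducing formula
  \<open>f(\<lambda>) = f(\<infinity>) - (2/\<pi>) \<integral> \<alpha> \<integral> (\<alpha> - i\<beta> + \<lambda>)\<^sup>-\<^sup>2 f'(\<alpha> + i\<beta>) d\<beta> d\<alpha>\<close>; this is (1) and (2).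
  If \<open>\<lambda> - A\<close> does not have dense range, (3) follows from (2). Otherwise \<open>\<lambda>\<close> is an approximate eigenvalue
  of \<open>A\<close>, and the reproducing formula makes the same approximate eigenvectors work for \<open>f(A)\<close> at
  \<open>f(\<lambda>)\<close>, the contribution of small \<open>\<alpha>\<close> being uniformly small.
  For (4), sectoriality makes the integral defining \<open>f(A)\<close> converge in operator norm. If \<open>f(A) - \<nu>\<close> is
  not invertible, a Gelfand--Mazur argument gives a functional on operators that vanishes on the
  ideal generated by \<open>f(A) - \<nu>\<close> and \<open>(1 + A)\<^sup>-\<^sup>1 - r\<close> for some \<open>r\<close>. Applied to \<open>f(A)\<close> it gives
  \<open>\<nu> = f(\<infinity>)\<close> if \<open>r = 0\<close>, and \<open>\<nu> = f(\<lambda>)\<close> with \<open>\<lambda> = 1/r - 1 \<in> \<sigma>(A)\<close> otherwise.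
\<close>

section \<open>Complex Banach spaces\<close>

text \<open>The hypothesis controls one pair of vector and functional at a time, and the formula for
  \<open>f(A)\<close> is only weak: even after uniform boundedness has produced a single constant
  \<gamma>, the integral defines merely an element of the bidual. It is brought back into the space
  on the range of \<open>(1 + A)^-2\<close>, where the squared resolvent decays in norm like
  \<open>|w|^-2\<close> on vertical lines, and from there by density. Since \<lambda> may be purely
  imaginary, \<open>1 / (w + \<lambda>)\<close> can blow up as \<open>Re w\<close> tends to 0. What
  stays bounded, by pi, is \<alpha> times the integral of its squared modulus over
  \<open>Re w = \<alpha>\<close>, and \<open>sup |f'|\<close> is integrable in \<alpha>. In (4) the
  functional on operators need not be multiplicative; turning composition with
  \<open>(1 + A)^-1\<close> into multiplication by \<open>r\<close> is enough to make it act like a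
  character on resolvents. As it is not built from a vector and a functional on the space, moving it
  under the integral requires a bound on the resolvents in operator norm, and sectoriality supplies
  it.\<close>

lemma scaleC_0_left [simp]: "scaleC 0 x = 0"
  using scaleC_of_real[of 0 x] by simp

lemma scaleC_0_right [simp]: "scaleC c 0 = 0"
  by (metis norm_eq_zero norm_scaleC mult_zero_right norm_zero)

lemma scaleC_minus_left: "scaleC (- c) x = - scaleC c x"
  by (metis add_eq_0_iff scaleC_0_left scaleC_add_left add.right_inverse)

lemma scaleC_minus_right: "scaleC c (- x) = - scaleC c x"
  by (metis add_eq_0_iff scaleC_0_right scaleC_add_right add.right_inverse)

lemma scaleC_diff_right: "scaleC c (x - y) = scaleC c x - scaleC c y"
  using scaleC_add_right[of c x "- y"] by (simp add: scaleC_minus_right)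

lemma scaleC_diff_left: "scaleC (c - d) x = scaleC c x - scaleC d x"
  using scaleC_add_left[of c "- d" x] by (simp add: scaleC_minus_left)

lemma scaleC_scaleR: "scaleC c (r *\<^sub>R x) = r *\<^sub>R scaleC c x"
  by (metis scaleC_of_real scaleC_scaleC mult.commute)

declare scaleC_one [simp]

lemma bounded_linear_scaleC: "bounded_linear (scaleC c)"
  by (rule bounded_linear_intro[where K = "cmod c"])
     (auto simp: scaleC_add_right scaleC_scaleR norm_scaleC mult.commute)

lemma tendsto_scaleC:
  fixes b :: "'a::complex_banach"
  assumes "(f \<longlongrightarrow> a) F" "(g \<longlongrightarrow> b) F"
  shows "((\<lambda>x. scaleC (f x) (g x)) \<longlongrightarrow> scaleC a b) F"
proof -
  have "bounded_bilinear (scaleC :: complex \<Rightarrow> 'a \<Rightarrow> 'a)"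
  proof
    show "scaleC (a + a') b = scaleC a b + scaleC a' b" for a a' and b :: 'a
      by (rule scaleC_add_left)
    show "scaleC a (b + b') = scaleC a b + scaleC a b'" for a and b b' :: 'a
      by (rule scaleC_add_right)
    show "scaleC (r *\<^sub>R a) b = r *\<^sub>R scaleC a b" for r a and b :: 'a
      by (metis scaleC_of_real scaleC_scaleC scaleR_conv_of_real)
    show "scaleC a (r *\<^sub>R b) = r *\<^sub>R scaleC a b" for r a and b :: 'a
      by (rule scaleC_scaleR)
    show "\<exists>K. \<forall>a (b::'a). norm (scaleC a b) \<le> norm a * norm b * K"
      by (rule exI[of _ 1]) (simp add: norm_scaleC)
  qed
  then show ?thesis by (rule bounded_bilinear.tendsto[OF _ assms])
qed

lemma continuous_on_scaleC:
  assumes "continuous_on S f" "continuous_on S g"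
  shows "continuous_on S (\<lambda>x. scaleC (f x) (g x))"
  using assms unfolding continuous_on_def by (auto intro: tendsto_scaleC)

lemma cbounded_opD:
  assumes "cbounded_op T"
  shows "bounded_linear T" "T (scaleC c x) = scaleC c (T x)" "T (x + y) = T x + T y"
    "T (x - y) = T x - T y" "T 0 = 0" "T (- x) = - T x"
  using assms bounded_linear.linear[of T]
  by (auto simp: cbounded_op_def linear_add linear_diff linear_0 linear_neg)

lemma dual_elemD:
  assumes "dual_elem \<phi>"
  shows "bounded_linear \<phi>" "\<phi> (scaleC c x) = c * \<phi> x" "\<phi> (x + y) = \<phi> x + \<phi> y"
    "\<phi> (x - y) = \<phi> x - \<phi> y" "\<phi> 0 = 0" "\<phi> (- x) = - \<phi> x" "cmod (\<phi> x) \<le> onorm \<phi> * norm x"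
    "0 \<le> onorm \<phi>"
  using assms bounded_linear.linear[of \<phi>]
  by (auto simp: dual_elem_def linear_add linear_diff linear_0 linear_neg onorm onorm_pos_le)

lemma dual_elem_comp:
  assumes "dual_elem \<phi>" "cbounded_op T"
  shows "dual_elem (\<lambda>x. \<phi> (T x))"
  using assms bounded_linear_compose[of \<phi> T] by (auto simp: dual_elem_def cbounded_op_def)

text \<open>Functionals on operators are needed in (4), so operators must again form a complex
  Banach space. Elements of \<open>blinfun\<close> are only real-linear; complex linearity is
  carried by \<open>commutant\<close> where it matters.\<close>

instantiation blinfun :: (real_normed_vector, complex_banach) complex_banach
begin

lift_definition scaleC_blinfun :: "complex \<Rightarrow> ('a \<Rightarrow>\<^sub>L 'b) \<Rightarrow> 'a \<Rightarrow>\<^sub>L 'b"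
  is "\<lambda>c T x. scaleC c (T x)"
  using bounded_linear_compose[OF bounded_linear_scaleC] by (auto simp: o_def)

lemma norm_scaleC_blinfun_le: "norm (scaleC a (T :: 'a \<Rightarrow>\<^sub>L 'b)) \<le> cmod a * norm T"
proof (rule norm_blinfun_bound)
  show "norm (blinfun_apply (scaleC a T) x) \<le> cmod a * norm T * norm x" for x
    using norm_blinfun[of T x]
    by (simp add: scaleC_blinfun.rep_eq norm_scaleC mult_left_mono mult.assoc)
qed simp

instance
proof
  fix a b :: complex and r :: real and x y :: "'a \<Rightarrow>\<^sub>L 'b"
  show s: "scaleC a (scaleC b x) = scaleC (a * b) x" for a b and x :: "'a \<Rightarrow>\<^sub>L 'b"
    by (rule blinfun_eqI) (simp add: scaleC_blinfun.rep_eq scaleC_scaleC)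
  show o: "scaleC 1 x = x" for x :: "'a \<Rightarrow>\<^sub>L 'b"
    by (rule blinfun_eqI) (simp add: scaleC_blinfun.rep_eq)
  show "scaleC a (x + y) = scaleC a x + scaleC a y"
    by (rule blinfun_eqI) (simp add: scaleC_blinfun.rep_eq plus_blinfun.rep_eq scaleC_add_right)
  show "scaleC (a + b) x = scaleC a x + scaleC b x"
    by (rule blinfun_eqI) (simp add: scaleC_blinfun.rep_eq plus_blinfun.rep_eq scaleC_add_left)
  show "scaleC (complex_of_real r) x = scaleR r x"
    by (rule blinfun_eqI) (simp add: scaleC_blinfun.rep_eq scaleR_blinfun.rep_eq scaleC_of_real)
  have z: "norm (scaleC 0 x) = 0"
    using norm_scaleC_blinfun_le[of 0 x] by simp
  show "norm (scaleC a x) = cmod a * norm x"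
  proof (cases "a = 0")
    case False
    \<comment> \<open>The upper estimate applied to \<open>inverse a\<close> is the missing lower
      estimate.\<close>
    have "norm x = norm (scaleC (inverse a) (scaleC a x))"
      using False by (simp only: s o) (simp add: o)
    also have "\<dots> \<le> norm (scaleC a x) / cmod a"
      using norm_scaleC_blinfun_le[of "inverse a" "scaleC a x"]
      by (simp add: norm_inverse divide_inverse mult.commute)
    finally show ?thesis
      using False norm_scaleC_blinfun_le[of a x] by (simp add: field_simps)
  qed (use z in simp)
qed

end

section \<open>The Hahn--Banach theorem\<close>

definition sublinear :: "('a::real_vector \<Rightarrow> real) \<Rightarrow> bool" where
  "sublinear p \<longleftrightarrow> (\<forall>x y. p (x + y) \<le> p x + p y) \<and> (\<forall>r\<ge>0. \<forall>x. p (r *\<^sub>R x) = r * p x)"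

text \<open>Taking \<open>t = 1\<close> at \<open>- a\<close> gives a value at most
  \<open>- p a\<close>, so a linear functional below \<open>tilt p a\<close> cannot be smaller than
  \<open>p a\<close> at \<open>a\<close>. This encodes a prescribed value without extending from a
  subspace.\<close>

definition tilt :: "('a::real_vector \<Rightarrow> real) \<Rightarrow> 'a \<Rightarrow> 'a \<Rightarrow> real" where
  "tilt p a x = (INF t\<in>{0..}. p (x + t *\<^sub>R a) - t * p a)"

lemma sublinear_0: "sublinear p \<Longrightarrow> p 0 = 0"
  unfolding sublinear_def by (metis mult_zero_left order_refl scaleR_zero_left)

lemma sublinear_minus: "sublinear p \<Longrightarrow> - p (- x) \<le> p x"
  using sublinear_0[of p] unfolding sublinear_def
  by (metis ab_group_add_class.ab_left_minus add.commute minus_le_iff le_minus_iff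
      neg_le_iff_le add_le_cancel_right diff_0 diff_le_eq)

lemma sublinearI:
  assumes add: "\<And>x y. p (x + y) \<le> p x + p y"
    and scale: "\<And>r x. r > 0 \<Longrightarrow> p (r *\<^sub>R x) \<le> r * p x" and "p 0 = 0"
  shows "sublinear p"
  unfolding sublinear_def
proof (intro conjI allI impI)
  fix r :: real and x assume "0 \<le> r"
  show "p (r *\<^sub>R x) = r * p x"
  proof (cases "r = 0")
    case False
    with \<open>0 \<le> r\<close> have "r > 0" by simp
    have "p x = p (inverse r *\<^sub>R (r *\<^sub>R x))" using False by simp
    also have "\<dots> \<le> inverse r * p (r *\<^sub>R x)" using \<open>r > 0\<close> by (intro scale) simp
    finally show ?thesis using scale[OF \<open>r > 0\<close>, of x] \<open>r > 0\<close> by (simp add: field_simps)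
  qed (simp add: \<open>p 0 = 0\<close>)
qed (rule add)

text \<open>A lower bound independent of \<open>t\<close> keeps the infimum in \<open>tilt\<close>
  finite.\<close>

lemma tilt_bound:
  assumes "sublinear p" "0 \<le> t"
  shows "- p (- x) \<le> p (x + t *\<^sub>R a) - t * p a"
proof -
  have "t * p a = p ((x + t *\<^sub>R a) + (- x))" using assms by (simp add: sublinear_def)
  also have "\<dots> \<le> p (x + t *\<^sub>R a) + p (- x)" using assms unfolding sublinear_def by blast
  finally show ?thesis by simp
qed

lemma tilt_le:
  assumes "sublinear p" "0 \<le> t"
  shows "tilt p a x \<le> p (x + t *\<^sub>R a) - t * p a"
  unfolding tilt_def using assms tilt_bound[OF assms(1)]
  by (intro cINF_lower) (auto intro!: bdd_belowI[of _ "- p (- x)"])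

lemma tilt_greatest:
  assumes "\<And>t. 0 \<le> t \<Longrightarrow> c \<le> p (x + t *\<^sub>R a) - t * p a"
  shows "c \<le> tilt p a x"
  unfolding tilt_def using assms by (intro cINF_greatest) auto

text \<open>Parameters combine as \<open>s + t\<close> for sums and as \<open>r * t\<close> for
  multiples, so the infimum inherits both properties of \<open>p\<close>.\<close>

lemma sublinear_tilt:
  assumes p: "sublinear p"
  shows "sublinear (tilt p a)"
proof (rule sublinearI)
  have padd: "p (x + y) \<le> p x + p y" and pscale: "r \<ge> 0 \<Longrightarrow> p (r *\<^sub>R x) = r * p x" for x y r
    using p by (auto simp: sublinear_def)
  show "tilt p a (x + y) \<le> tilt p a x + tilt p a y" for x y
  proof -
    have "tilt p a (x + y) - (p (y + t *\<^sub>R a) - t * p a) \<le> tilt p a x" if t: "0 \<le> t" for t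
    proof (rule tilt_greatest)
      fix s :: real assume s: "0 \<le> s"
      have "tilt p a (x + y) \<le> p ((x + y) + (s + t) *\<^sub>R a) - (s + t) * p a"
        using s t by (intro tilt_le p) auto
      also have "(x + y) + (s + t) *\<^sub>R a = (x + s *\<^sub>R a) + (y + t *\<^sub>R a)"
        by (simp add: algebra_simps)
      also have "p \<dots> \<le> p (x + s *\<^sub>R a) + p (y + t *\<^sub>R a)" by (rule padd)
      finally show "tilt p a (x + y) - (p (y + t *\<^sub>R a) - t * p a) \<le> p (x + s *\<^sub>R a) - s * p a"
        by (simp add: algebra_simps)
    qed
    then have "tilt p a (x + y) - tilt p a x \<le> tilt p a y"
      by (intro tilt_greatest) (smt (verit))
    then show ?thesis by simp
  qed
  show "tilt p a (r *\<^sub>R x) \<le> r * tilt p a x" if r: "r > 0" for r x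
  proof -
    have "inverse r * tilt p a (r *\<^sub>R x) \<le> tilt p a x"
    proof (rule tilt_greatest)
      fix t :: real assume t: "0 \<le> t"
      have "tilt p a (r *\<^sub>R x) \<le> p (r *\<^sub>R x + (r * t) *\<^sub>R a) - (r * t) * p a"
        using r t by (intro tilt_le p) auto
      also have "r *\<^sub>R x + (r * t) *\<^sub>R a = r *\<^sub>R (x + t *\<^sub>R a)" by (simp add: algebra_simps)
      also have "p \<dots> = r * p (x + t *\<^sub>R a)" using r by (intro pscale) simp
      finally show "inverse r * tilt p a (r *\<^sub>R x) \<le> p (x + t *\<^sub>R a) - t * p a"
        using r by (simp add: field_simps)
    qed
    then show ?thesis using r by (simp add: field_simps)
  qed
  show "tilt p a 0 = 0"
  proof (rule antisym)
    show "tilt p a 0 \<le> 0" using tilt_le[OF p, of 0 a 0] sublinear_0[OF p] by simp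
    show "0 \<le> tilt p a 0"
      using tilt_bound[OF p, of _ 0 a] sublinear_0[OF p] by (intro tilt_greatest) simp
  qed
qed

text \<open>A pointwise minimal sublinear functional coincides with all its tilts, hence is odd.\<close>

lemma minimal_sublinear_linear:
  assumes q: "sublinear q" and min: "\<And>q'. sublinear q' \<Longrightarrow> (\<And>x. q' x \<le> q x) \<Longrightarrow> q' = q"
  shows "linear q"
proof -
  have "tilt q a = q" for a
    using tilt_le[OF q, of 0 a] by (intro min sublinear_tilt q) simp
  then have "q (- a) \<le> - q a" for a
    using tilt_le[OF q, of 1 a "- a"] sublinear_0[OF q] by simp
  then have neg: "q (- a) = - q a" for a
    using sublinear_minus[OF q, of a] by (metis antisym minus_le_iff)
  have add: "q (x + y) = q x + q y" for x y
  proof (rule antisym)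
    show "q (x + y) \<le> q x + q y" using q by (simp add: sublinear_def)
    have "q x = q ((x + y) + (- y))" by simp
    also have "\<dots> \<le> q (x + y) + q (- y)" using q unfolding sublinear_def by blast
    finally show "q x + q y \<le> q (x + y)" by (simp add: neg)
  qed
  have "q (r *\<^sub>R x) = r * q x" for r x
  proof (cases "r \<ge> 0")
    case False
    then have "0 \<le> - r" by simp
    then have "q ((- r) *\<^sub>R x) = (- r) * q x" using q unfolding sublinear_def by blast
    then show ?thesis using neg[of "r *\<^sub>R x"] by simp
  qed (use q in \<open>simp add: sublinear_def\<close>)
  then show ?thesis by (intro linearI add) simp
qed

text \<open>Each member is bounded below by \<open>- p (- x)\<close> at \<open>x\<close>, so the
  infimum is finite. Subadditivity needs one member for two points: of two members of a chain, the
  smaller one serves for both.\<close>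

lemma sublinear_chain_Inf:
  fixes C :: "('a::real_vector \<Rightarrow> real) set"
  assumes ne: "C \<noteq> {}" and sub: "\<And>q. q \<in> C \<Longrightarrow> sublinear q" and le: "\<And>q x. q \<in> C \<Longrightarrow> q x \<le> p x"
    and chain: "\<And>q r. q \<in> C \<Longrightarrow> r \<in> C \<Longrightarrow> (\<forall>x. q x \<le> r x) \<or> (\<forall>x. r x \<le> q x)"
  defines "u \<equiv> \<lambda>x. INF q\<in>C. q x"
  shows "sublinear u" "\<And>q x. q \<in> C \<Longrightarrow> u x \<le> q x"
proof -
  have bdd: "bdd_below ((\<lambda>q. q x) ` C)" for x
  proof (rule bdd_belowI2)
    show "- p (- x) \<le> q x" if "q \<in> C" for q
      using sublinear_minus[OF sub[OF that], of x] le[OF that, of "- x"] by simp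
  qed
  show lower: "u x \<le> q x" if "q \<in> C" for q x
    unfolding u_def using bdd that by (rule cINF_lower)
  have greatest: "c \<le> u x" if "\<And>q. q \<in> C \<Longrightarrow> c \<le> q x" for c x
    unfolding u_def using ne that by (rule cINF_greatest)
  show "sublinear u"
  proof (rule sublinearI)
    show "u (x + y) \<le> u x + u y" for x y
    proof -
      have "u (x + y) - r y \<le> u x" if r: "r \<in> C" for r
      proof (rule greatest)
        fix q assume q: "q \<in> C"
        from chain[OF q r] obtain s where s: "s \<in> C" "s x \<le> q x" "s y \<le> r y"
          using q r by blast
        have "u (x + y) \<le> s x + s y"
          using lower[OF s(1), of "x + y"] sub[OF s(1)] unfolding sublinear_def by (meson order_trans)
        then show "u (x + y) - r y \<le> q x" using s by simp
      qed
      then have "u (x + y) - u x \<le> u y" by (intro greatest) (smt (verit))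
      then show ?thesis by simp
    qed
    show "u (r *\<^sub>R x) \<le> r * u x" if r: "r > 0" for r x
    proof -
      have "u (r *\<^sub>R x) / r \<le> u x"
      proof (rule greatest)
        fix q assume q: "q \<in> C"
        have "u (r *\<^sub>R x) \<le> r * q x"
          using lower[OF q, of "r *\<^sub>R x"] sub[OF q] r by (simp add: sublinear_def)
        then show "u (r *\<^sub>R x) / r \<le> q x" using r by (simp add: field_simps)
      qed
      then show ?thesis using r by (simp add: field_simps)
    qed
    obtain q where "q \<in> C" using ne by blast
    then show "u 0 = 0"
      using lower[of q 0] sublinear_0 sub greatest[of 0 0] by (metis antisym order_refl)
  qed
qed

lemma ex_minimal_sublinear:
  fixes p :: "'a::real_vector \<Rightarrow> real"
  assumes p: "sublinear p"
  obtains q where "sublinear q" "\<And>x. q x \<le> p x"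
    "\<And>q'. sublinear q' \<Longrightarrow> (\<And>x. q' x \<le> q x) \<Longrightarrow> q' = q"
proof -
  let ?A = "{q. sublinear q \<and> (\<forall>x. q x \<le> p x)}"
  \<comment> \<open>The order is reversed, so that a maximal element for Zorn is a pointwise minimal
    functional.\<close>
  let ?P = "\<lambda>f g :: 'a \<Rightarrow> real. \<forall>x. g x \<le> f x"
  have "\<exists>m\<in>?A. \<forall>a\<in>?A. ?P m a \<longrightarrow> a = m"
  proof (rule predicate_Zorn)
    show "partial_order_on ?A (relation_of ?P ?A)"
      by (rule partial_order_on_relation_ofI) (auto simp: fun_eq_iff intro: order_trans antisym)
    fix C assume C: "C \<in> Chains (relation_of ?P ?A)"
    then have CA: "C \<subseteq> ?A" by (auto simp: Chains_def relation_of_def)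
    show "\<exists>u\<in>?A. \<forall>a\<in>C. ?P a u"
    proof (cases "C = {}")
      case False
      have chain: "(\<forall>x. q x \<le> r x) \<or> (\<forall>x. r x \<le> q x)" if "q \<in> C" "r \<in> C" for q r
        using C that by (auto simp: Chains_def relation_of_def)
      have "sublinear (\<lambda>x. INF q\<in>C. q x)" "\<And>q x. q \<in> C \<Longrightarrow> (INF q\<in>C. q x) \<le> q x"
        using sublinear_chain_Inf[OF False, of p] CA chain by blast+
      moreover have "(INF q\<in>C. q x) \<le> p x" for x
      proof -
        obtain q where q: "q \<in> C" using False by blast
        then show ?thesis using calculation(2)[OF q, of x] CA by (auto intro: order_trans)
      qed
      ultimately show ?thesis by (intro bexI[of _ "\<lambda>x. INF q\<in>C. q x"]) auto
    qed (use p in auto)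
  qed
  then obtain m where m: "m \<in> ?A" "\<And>a. a \<in> ?A \<Longrightarrow> ?P m a \<Longrightarrow> a = m" by blast
  show ?thesis
  proof (rule that)
    show "q' = m" if "sublinear q'" "\<And>x. q' x \<le> m x" for q'
      using m that by (smt (verit) mem_Collect_eq)
  qed (use m in auto)
qed

text \<open>A minimal sublinear functional below \<open>tilt p a\<close> is linear, and comparison
  at \<open>- a\<close> pins its value at \<open>a\<close>.\<close>

theorem Hahn_Banach_sublinear:
  assumes p: "sublinear p"
  obtains f where "linear f" "\<And>x. f x \<le> p x" "f a = p a"
proof -
  obtain q where q: "sublinear q" "\<And>x. q x \<le> tilt p a x"
    "\<And>q'. sublinear q' \<Longrightarrow> (\<And>x. q' x \<le> q x) \<Longrightarrow> q' = q"
    using ex_minimal_sublinear[OF sublinear_tilt[OF p]] by metis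
  have lin: "linear q" by (rule minimal_sublinear_linear) (use q in auto)
  have le: "q x \<le> p x" for x using q(2)[of x] tilt_le[OF p, of 0 a x] by simp
  have "- q a = q (- a)" by (simp add: linear_neg[OF lin])
  also have "\<dots> \<le> - p a"
    using q(2)[of "- a"] tilt_le[OF p, of 1 a "- a"] sublinear_0[OF p] by simp
  finally have "q a = p a" using le[of a] by simp
  with lin le show ?thesis by (rule that)
qed

section \<open>From real to complex functionals\<close>

definition complexify :: "('a::complex_banach \<Rightarrow> real) \<Rightarrow> 'a \<Rightarrow> complex" where
  "complexify f x = Complex (f x) (- f (scaleC \<i> x))"

lemma complexify_dual:
  assumes f: "bounded_linear f"
  shows "dual_elem (complexify f)"
proof -
  have lin: "linear f" by (rule bounded_linear.linear[OF f])
  have fi: "bounded_linear (\<lambda>x. f (scaleC \<i> x))"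
    by (rule bounded_linear_compose[OF f bounded_linear_scaleC])
  have "bounded_linear (\<lambda>x. complex_of_real (f x) - \<i> * complex_of_real (f (scaleC \<i> x)))"
    using f fi
    by (intro bounded_linear_sub bounded_linear_const_mult
        bounded_linear_compose[OF bounded_linear_of_real])
  moreover have "complex_of_real (f x) - \<i> * complex_of_real (f (scaleC \<i> x)) = complexify f x" for x
    by (simp add: complexify_def complex_eq_iff)
  ultimately have bl: "bounded_linear (complexify f)" by simp
  have "complexify f (scaleC c x) = c * complexify f x" for c x
  proof -
    have "scaleC c x = Re c *\<^sub>R x + Im c *\<^sub>R scaleC \<i> x"
      by (metis complex_eq scaleC_add_left scaleC_of_real scaleC_scaleC mult.commute)
    moreover then have "scaleC \<i> (scaleC c x) = Re c *\<^sub>R scaleC \<i> x - Im c *\<^sub>R x"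
      by (simp add: scaleC_add_right scaleC_scaleR scaleC_scaleC scaleC_minus_left)
    ultimately show ?thesis
      by (simp add: complexify_def complex_eq_iff linear_add[OF lin] linear_diff[OF lin]
          linear_scale[OF lin])
  qed
  with bl show ?thesis by (simp add: dual_elem_def)
qed

lemma complexify_Re:
  assumes "dual_elem \<phi>"
  shows "complexify (\<lambda>x. Re (\<phi> x)) = \<phi>"
  by (rule ext) (simp add: complexify_def dual_elemD[OF assms] complex_eq_iff)

text \<open>Rotating \<open>x\<close> by a unimodular scalar makes the value real and nonnegative,
  so it is a value of \<open>f\<close> itself and the constant \<open>K\<close> does not
  deteriorate.\<close>

lemma complexify_bound:
  assumes f: "bounded_linear f" and le: "\<And>x. f x \<le> K * norm x"
  shows "cmod (complexify f x) \<le> K * norm x"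
proof (cases "complexify f x = 0")
  case True
  then have "f x = 0" by (simp add: complexify_def Complex_eq_0)
  with True show ?thesis using le[of x] by simp
next
  case False
  define c where "c = cnj (complexify f x) / cmod (complexify f x)"
  have "complexify f (scaleC c x) = of_real (cmod (complexify f x))"
    unfolding dual_elemD(2)[OF complexify_dual[OF f]] c_def
    using False complex_norm_square[of "complexify f x"]
    by (simp add: field_simps power2_eq_square)
  then have "cmod (complexify f x) = f (scaleC c x)"
    by (simp add: complexify_def complex_eq_iff)
  also have "\<dots> \<le> K * norm (scaleC c x)" by (rule le)
  also have "norm (scaleC c x) = norm x"
    using False by (simp add: norm_scaleC c_def norm_divide)
  finally show ?thesis .
qed

lemma linear_le_norm_bounded:
  assumes "linear f" "\<And>x. f x \<le> norm x"
  shows "bounded_linear f"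
proof (rule bounded_linear_intro[where K = 1])
  show "norm (f x) \<le> norm x * 1" for x
    using assms(2)[of x] assms(2)[of "- x"] linear_neg[OF assms(1), of x] by simp
qed (use assms in \<open>auto simp: linear_add linear_scale\<close>)

theorem norming_functional:
  fixes a :: "'a::complex_banach"
  obtains \<phi> where "dual_elem \<phi>" "onorm \<phi> \<le> 1" "cmod (\<phi> a) \<ge> norm a"
proof -
  have "sublinear (norm :: 'a \<Rightarrow> real)" by (simp add: sublinear_def norm_triangle_ineq)
  then obtain f where f: "linear f" "\<And>x. f x \<le> norm x" "f a = norm a"
    using Hahn_Banach_sublinear by metis
  have bl: "bounded_linear f" by (rule linear_le_norm_bounded[OF f(1,2)])
  show ?thesis
  proof (rule that)
    show "dual_elem (complexify f)" by (rule complexify_dual[OF bl])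
    show "onorm (complexify f) \<le> 1"
      using complexify_bound[OF bl, of 1] f(2) by (intro onorm_bound) auto
    show "norm a \<le> cmod (complexify f a)"
      using abs_Re_le_cmod[of "complexify f a"] f(3) by (simp add: complexify_def)
  qed
qed

lemma norm_le_dual:
  assumes "\<And>\<phi>. dual_elem \<phi> \<Longrightarrow> onorm \<phi> \<le> 1 \<Longrightarrow> cmod (\<phi> a) \<le> K"
  shows "norm a \<le> K"
  using norming_functional[of a] assms by (metis order_trans)

lemma dual_elem_separates:
  assumes "\<And>\<phi>. dual_elem \<phi> \<Longrightarrow> \<phi> a = \<phi> b"
  shows "a = b"
  using norm_le_dual[of "a - b" 0] assms by (simp add: dual_elemD)

text \<open>For a subspace the distance to \<open>M\<close> is sublinear. A linear functional below
  it vanishes on \<open>M\<close>, as both \<open>m\<close> and \<open>- m\<close> have distance 0,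
  and it can be made to attain the positive distance at \<open>a\<close>.\<close>

theorem separating_functional:
  fixes M :: "'a::complex_banach set"
  assumes add: "\<And>x y. x \<in> M \<Longrightarrow> y \<in> M \<Longrightarrow> x + y \<in> M"
    and scale: "\<And>c x. x \<in> M \<Longrightarrow> scaleC c x \<in> M" and ne: "0 \<in> M" and a: "a \<notin> closure M"
  obtains \<phi> where "dual_elem \<phi>" "\<phi> a \<noteq> 0" "\<And>x. x \<in> M \<Longrightarrow> \<phi> x = 0"
proof -
  define p where "p = (\<lambda>x. infdist x M)"
  have M: "M \<noteq> {}" using ne by blast
  have p_le: "p x \<le> norm (x - m)" if "m \<in> M" for x m
    unfolding p_def using infdist_le[OF that, of x] by (simp add: dist_norm)
  have p_ge: "c \<le> p x" if "\<And>m. m \<in> M \<Longrightarrow> c \<le> norm (x - m)" for c x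
    unfolding p_def infdist_notempty[OF M] using that M
    by (intro cINF_greatest) (auto simp: dist_norm)
  have sub: "sublinear p"
  proof (rule sublinearI)
    show "p (x + y) \<le> p x + p y" for x y
    proof -
      have "p (x + y) - norm (y - n) \<le> p x" if n: "n \<in> M" for n
      proof (rule p_ge)
        fix m assume m: "m \<in> M"
        have "p (x + y) \<le> norm ((x + y) - (m + n))" by (intro p_le add m n)
        also have "\<dots> \<le> norm (x - m) + norm (y - n)"
          by (metis add_diff_add norm_triangle_ineq)
        finally show "p (x + y) - norm (y - n) \<le> norm (x - m)" by simp
      qed
      then have "p (x + y) - p x \<le> p y" by (intro p_ge) (smt (verit))
      then show ?thesis by simp
    qed
    show "p (r *\<^sub>R x) \<le> r * p x" if r: "r > 0" for r x
    proof -
      have "p (r *\<^sub>R x) / r \<le> p x"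
      proof (rule p_ge)
        fix m assume "m \<in> M"
        then have "r *\<^sub>R m \<in> M" using scale[of m "complex_of_real r"] by (simp add: scaleC_of_real)
        then have "p (r *\<^sub>R x) \<le> norm (r *\<^sub>R x - r *\<^sub>R m)" by (rule p_le)
        also have "\<dots> = r * norm (x - m)" using r by (simp flip: scaleR_diff_right)
        finally show "p (r *\<^sub>R x) / r \<le> norm (x - m)" using r by (simp add: field_simps)
      qed
      then show ?thesis using r by (simp add: field_simps)
    qed
    show "p 0 = 0" using ne by (simp add: p_def)
  qed
  obtain f where f: "linear f" "\<And>x. f x \<le> p x" "f a = p a"
    using Hahn_Banach_sublinear[OF sub] by metis
  have "f x \<le> norm x" for x using f(2)[of x] p_le[OF ne, of x] by simp
  then have bl: "bounded_linear f" by (rule linear_le_norm_bounded[OF f(1)])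
  have f0: "f m = 0" if "m \<in> M" for m
  proof -
    have "- m \<in> M" using scale[OF that, of "- 1"] by (simp add: scaleC_minus_left)
    then show ?thesis
      using f(2)[of m] f(2)[of "- m"] that linear_neg[OF f(1), of m] by (simp add: p_def)
  qed
  show ?thesis
  proof (rule that)
    show "dual_elem (complexify f)" by (rule complexify_dual[OF bl])
    have "p a \<noteq> 0" using a M by (simp add: p_def in_closure_iff_infdist_zero)
    then show "complexify f a \<noteq> 0" using f(3) by (simp add: complexify_def complex_eq_iff)
    show "complexify f x = 0" if "x \<in> M" for x
      using f0 that scale[OF that] by (simp add: complexify_def complex_eq_iff)
  qed
qed

section \<open>Uniform boundedness\<close>

text \<open>Banach--Steinhaus for the seminorms \<open>x \<mapsto> \<parallel>u i \<cdot> x\<parallel>\<^sub>1\<close>; Fatou makes their sublevel sets closed.\<close>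

lemma uniform_boundedness_L1:
  fixes u :: "'i \<Rightarrow> real \<Rightarrow> 'a::banach \<Rightarrow> complex"
  assumes lin: "\<And>i b. i \<in> I \<Longrightarrow> bounded_linear (u i b)"
    and meas: "\<And>i x. i \<in> I \<Longrightarrow> (\<lambda>b. u i b x) \<in> borel_measurable lborel"
    and fin: "\<And>x. \<exists>C. \<forall>i\<in>I. (\<integral>\<^sup>+b. cmod (u i b x) \<partial>lborel) \<le> ennreal C"
  obtains C where "0 \<le> C" "\<And>i x. i \<in> I \<Longrightarrow> (\<integral>\<^sup>+b. cmod (u i b x) \<partial>lborel) \<le> ennreal (C * norm x)"
proof -
  define p where "p = (\<lambda>i x. \<integral>\<^sup>+b. cmod (u i b x) \<partial>lborel)"
  define V where "V = (\<lambda>n::nat. {x. \<forall>i\<in>I. p i x \<le> of_nat n})"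
  have closed_V: "closed (V n)" for n
    unfolding closed_sequential_limits
  proof (intro allI impI, elim conjE)
    fix X l assume X: "\<forall>k. X k \<in> V n" and l: "X \<longlonglongrightarrow> l"
    have "p i l \<le> of_nat n" if i: "i \<in> I" for i
    proof -
      have "p i l = (\<integral>\<^sup>+b. liminf (\<lambda>k. ennreal (cmod (u i b (X k)))) \<partial>lborel)"
        unfolding p_def
      proof (intro nn_integral_cong)
        fix b
        have "(\<lambda>k. ennreal (cmod (u i b (X k)))) \<longlonglongrightarrow> ennreal (cmod (u i b l))"
          by (intro tendsto_intros tendsto_ennrealI bounded_linear.tendsto[OF lin[OF i] l])
        then show "ennreal (cmod (u i b l)) = liminf (\<lambda>k. ennreal (cmod (u i b (X k))))"
          using lim_imp_Liminf[of sequentially] by fastforce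
      qed
      also have "\<dots> \<le> liminf (\<lambda>k. p i (X k))"
        unfolding p_def by (intro nn_integral_liminf measurable_compose[OF meas[OF i]]) auto
      also have "\<dots> \<le> of_nat n"
        using X i by (intro Liminf_le) (auto simp: V_def)
      finally show ?thesis .
    qed
    then show "l \<in> V n" by (simp add: V_def)
  qed
  have "UNIV = \<Union>(range V)"
  proof (rule UNIV_eq_I)
    fix x
    obtain C where C: "\<forall>i\<in>I. p i x \<le> ennreal C" using fin unfolding p_def by blast
    obtain n where "C \<le> of_nat n" using real_arch_simple by blast
    then have "ennreal C \<le> of_nat n"
      by (metis ennreal_leI ennreal_of_nat_eq_real_of_nat)
    then show "x \<in> \<Union>(range V)" using C by (auto simp: V_def intro!: exI[of _ n] intro: order_trans)
  qed
  moreover have "interior (\<Union>(range V)) = {}" if "\<And>n. interior (V n) = {}"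
    using Met_TC.metric_Baire_category_alt[of "range V"] that closed_V by auto
  ultimately obtain n x0 where "x0 \<in> interior (V n)" by fastforce
  then obtain e where e: "e > 0" "cball x0 e \<subseteq> V n"
    by (metis mem_interior_cball)
  have padd: "p i (x - y) \<le> p i x + p i y" if i: "i \<in> I" for i x y
  proof -
    have "p i (x - y) \<le> (\<integral>\<^sup>+b. ennreal (cmod (u i b x)) + ennreal (cmod (u i b y)) \<partial>lborel)"
      unfolding p_def
      using linear_diff[OF bounded_linear.linear[OF lin[OF i]]]
      by (intro nn_integral_mono) (auto simp flip: ennreal_plus intro!: ennreal_leI norm_triangle_ineq4)
    also have "\<dots> = p i x + p i y"
      unfolding p_def by (intro nn_integral_add measurable_compose[OF meas[OF i]]) auto
    finally show ?thesis .
  qed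
  \<comment> \<open>The ball about \<open>x0\<close> is moved to the origin by
    \<open>y = (x0 + y) - x0\<close>, which doubles the bound \<open>n\<close>.\<close>
  have small: "p i y \<le> ennreal (2 * real n)" if i: "i \<in> I" and y: "norm y \<le> e" for i y
  proof -
    have "p i ((x0 + y) - x0) \<le> p i (x0 + y) + p i x0" by (rule padd[OF i])
    also have "\<dots> \<le> of_nat n + of_nat n"
    proof (rule add_mono)
      show "p i (x0 + y) \<le> of_nat n" using e y i by (auto simp: V_def subset_eq dist_norm)
      show "p i x0 \<le> of_nat n" using e i by (auto simp: V_def subset_eq)
    qed
    also have "\<dots> = ennreal (2 * real n)"
      by (metis ennreal_of_nat_eq_real_of_nat mult_2 of_nat_add)
    finally show ?thesis by simp
  qed
  show ?thesis
  proof (rule that)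
    show "0 \<le> 2 * real n / e" using e by simp
    fix i x assume i: "i \<in> I"
    show "(\<integral>\<^sup>+b. cmod (u i b x) \<partial>lborel) \<le> ennreal (2 * real n / e * norm x)"
    proof (cases "x = 0")
      case True
      then show ?thesis using linear_0[OF bounded_linear.linear[OF lin[OF i]]] by simp
    next
      case False
      define t where "t = norm x / e"
      have t: "t > 0" using False e by (simp add: t_def)
      have "cmod (u i b x) = t * cmod (u i b ((1 / t) *\<^sub>R x))" for b
        using linear_scale[OF bounded_linear.linear[OF lin[OF i]], of b "1 / t" x] t by simp
      then have "(\<integral>\<^sup>+b. cmod (u i b x) \<partial>lborel)
          = (\<integral>\<^sup>+b. ennreal t * ennreal (cmod (u i b ((1 / t) *\<^sub>R x))) \<partial>lborel)"
        using t by (simp add: ennreal_mult)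
      also have "\<dots> = ennreal t * p i ((1 / t) *\<^sub>R x)"
        unfolding p_def by (intro nn_integral_cmult measurable_compose[OF meas[OF i]]) auto
      also have "\<dots> \<le> ennreal t * ennreal (2 * real n)"
        using small[OF i, of "(1 / t) *\<^sub>R x"] t e False by (intro mult_left_mono) (auto simp: t_def)
      also have "\<dots> = ennreal (2 * real n / e * norm x)"
        using t by (simp add: ennreal_mult[symmetric] t_def mult.commute)
      finally show ?thesis .
    qed
  qed
qed

section \<open>Functionals on the dual that are evaluations\<close>

text \<open>The space is complete, hence closed in its bidual: \<open>\<Lambda>\<close> is a norm
  limit of evaluations, and the evaluating vectors form a Cauchy sequence because functionals of
  norm at most 1 determine the norm.\<close>

lemma ex_representing_vector:
  fixes \<Lambda> :: "('a::complex_banach \<Rightarrow> complex) \<Rightarrow> complex"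
  assumes "\<And>\<delta>. \<delta> > 0 \<Longrightarrow> \<exists>v. \<forall>\<phi>. dual_elem \<phi> \<longrightarrow> cmod (\<Lambda> \<phi> - \<phi> v) \<le> \<delta> * onorm \<phi>"
  obtains v where "\<And>\<phi>. dual_elem \<phi> \<Longrightarrow> \<Lambda> \<phi> = \<phi> v"
proof -
  have "\<exists>v. \<forall>n \<phi>. dual_elem \<phi> \<longrightarrow> cmod (\<Lambda> \<phi> - \<phi> (v n)) \<le> inverse (real (Suc n)) * onorm \<phi>"
    using assms[of "inverse (real (Suc n))" for n]
    by (intro choice allI) simp
  then obtain v where v: "\<And>n \<phi>. dual_elem \<phi> \<Longrightarrow>
      cmod (\<Lambda> \<phi> - \<phi> (v n)) \<le> inverse (real (Suc n)) * onorm \<phi>" by blast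
  have dist_v: "norm (v n - v m) \<le> inverse (real (Suc n)) + inverse (real (Suc m))" for n m
  proof (rule norm_le_dual)
    fix \<phi> :: "'a \<Rightarrow> complex" assume \<phi>: "dual_elem \<phi>" "onorm \<phi> \<le> 1"
    have "cmod (\<phi> (v n - v m)) = cmod ((\<Lambda> \<phi> - \<phi> (v m)) - (\<Lambda> \<phi> - \<phi> (v n)))"
      by (simp add: dual_elemD[OF \<phi>(1)])
    also have "\<dots> \<le> cmod (\<Lambda> \<phi> - \<phi> (v m)) + cmod (\<Lambda> \<phi> - \<phi> (v n))" by (rule norm_triangle_ineq4)
    also have "\<dots> \<le> inverse (real (Suc m)) * onorm \<phi> + inverse (real (Suc n)) * onorm \<phi>"
      by (intro add_mono v \<phi>)
    also have "\<dots> \<le> inverse (real (Suc m)) * 1 + inverse (real (Suc n)) * 1"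
      by (intro add_mono mult_left_mono \<phi>) auto
    finally show "cmod (\<phi> (v n - v m)) \<le> inverse (real (Suc n)) + inverse (real (Suc m))" by simp
  qed
  have "Cauchy v"
  proof (rule metric_CauchyI)
    fix e :: real assume e: "e > 0"
    obtain N where N: "inverse (real (Suc N)) < e / 2" using reals_Archimedean[of "e / 2"] e by auto
    have "dist (v n) (v m) < e" if "n \<ge> N" "m \<ge> N" for n m
    proof -
      have "inverse (real (Suc k)) \<le> inverse (real (Suc N))" if "k \<ge> N" for k
        using that by (intro le_imp_inverse_le) auto
      from this[OF that(1)] this[OF that(2)] show ?thesis
        using dist_v[of n m] N unfolding dist_norm by linarith
    qed
    then show "\<exists>M. \<forall>m\<ge>M. \<forall>n\<ge>M. dist (v m) (v n) < e" by blast
  qed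
  then obtain w where w: "v \<longlonglongrightarrow> w" by (auto simp: Cauchy_convergent_iff convergent_def)
  show ?thesis
  proof (rule that)
    fix \<phi> :: "'a \<Rightarrow> complex" assume \<phi>: "dual_elem \<phi>"
    have 1: "(\<lambda>n. \<Lambda> \<phi> - \<phi> (v n)) \<longlonglongrightarrow> \<Lambda> \<phi> - \<phi> w"
      by (intro tendsto_intros bounded_linear.tendsto[OF dual_elemD(1)[OF \<phi>] w])
    have "(\<lambda>n. inverse (real (Suc n)) * onorm \<phi>) \<longlonglongrightarrow> 0"
      by (rule tendsto_mult_left_zero[OF LIMSEQ_inverse_real_of_nat])
    then have "(\<lambda>n. \<Lambda> \<phi> - \<phi> (v n)) \<longlonglongrightarrow> 0"
      by (rule Lim_null_comparison[rotated]) (use v[OF \<phi>] in auto)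
    then have "\<Lambda> \<phi> - \<phi> w = 0" by (rule LIMSEQ_unique[OF 1])
    then show "\<Lambda> \<phi> = \<phi> w" by simp
  qed
qed

section \<open>Commutants\<close>

notation blinfun_compose (infixl "\<odot>" 70)

lemma blinfun_compose_assoc: "(S \<odot> T) \<odot> U = S \<odot> (T \<odot> U)"
  by (rule blinfun_eqI) simp

text \<open>Complex linearity is built in, since \<open>blinfun\<close> gives only real linearity.
  The set need not be commutative; it plays the role of an algebra containing the inverses that
  occur, so that ideals and Neumann series stay inside it.\<close>

definition commutant :: "('a::complex_banach \<Rightarrow>\<^sub>L 'a) \<Rightarrow> ('a \<Rightarrow>\<^sub>L 'a) set" where
  "commutant a = {T. (\<forall>c x. blinfun_apply T (scaleC c x) = scaleC c (blinfun_apply T x)) \<and>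
     (\<forall>x. blinfun_apply T (blinfun_apply a x) = blinfun_apply a (blinfun_apply T x))}"

lemma commutantD:
  assumes "T \<in> commutant a"
  shows "T (scaleC c x) = scaleC c (T x)" "T (a x) = a (T x)"
  using assms by (auto simp: commutant_def)

lemmas blinfun_rep = plus_blinfun.rep_eq minus_blinfun.rep_eq scaleC_blinfun.rep_eq
  scaleR_blinfun.rep_eq uminus_blinfun.rep_eq zero_blinfun.rep_eq

lemma commutant_closed:
  assumes "T \<in> commutant a" "S \<in> commutant a"
  shows "T \<odot> S \<in> commutant a" "T + S \<in> commutant a" "T - S \<in> commutant a"
  using assms
  by (auto simp: commutant_def blinfun_rep scaleC_add_right scaleC_diff_right scaleC_scaleC mult.commute
      blinfun.bilinear_simps)

text \<open>The hypothesis \<open>a \<in> commutant a\<close> amounts to complex linearity of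
  \<open>a\<close>, which lets scalars pass through \<open>a\<close>.\<close>

lemma commutant_scaleC:
  assumes "a \<in> commutant a" "T \<in> commutant a"
  shows "scaleC c T \<in> commutant a"
  using assms by (auto simp: commutant_def scaleC_blinfun.rep_eq scaleC_scaleC mult.commute)

lemma id_in_commutant: "id_blinfun \<in> commutant a"
  by (simp add: commutant_def)

lemma Neumann_inverse:
  assumes S: "S \<in> commutant a" and small: "norm S \<le> 1 / 2"
  obtains N where "N \<in> commutant a" "\<And>x. N x - N (S x) = x" "\<And>x. N x - S (N x) = x" "norm N \<le> 2"
proof -
  define P where "P = rec_nat id_blinfun (\<lambda>_ Q. S \<odot> Q)"
  have P_simps: "P 0 = id_blinfun" "P (Suc n) = S \<odot> P n" for n by (simp_all add: P_def)
  have norm_P: "norm (P n) \<le> (1 / 2) ^ n" for n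
  proof (induction n)
    case (Suc n)
    have "norm (P (Suc n)) \<le> norm S * norm (P n)" unfolding P_simps by (rule norm_blinfun_compose)
    also have "\<dots> \<le> 1 / 2 * (1 / 2) ^ n" using small Suc by (intro mult_mono) auto
    finally show ?case by simp
  qed (simp add: P_simps norm_blinfun_id_le)
  have summ: "summable P"
    by (rule summable_comparison_test'[of "\<lambda>n. (1 / 2) ^ n" 0]) (auto simp: norm_P)
  define N where "N = suminf P"
  have comm: "P n \<odot> S = P (Suc n)" for n
    by (induction n) (auto simp: P_simps blinfun_compose_assoc intro!: blinfun_eqI)
  have split: "N = (\<Sum>n. P (Suc n)) + id_blinfun"
    unfolding N_def using suminf_split_head[OF summ] by (simp add: P_simps)
  have left: "S \<odot> N = (\<Sum>n. P (Suc n))"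
    unfolding N_def P_simps
    by (rule bounded_linear.suminf[OF bounded_bilinear.bounded_linear_right[OF bounded_bilinear_blinfun_compose] summ])
  have right: "N \<odot> S = (\<Sum>n. P (Suc n))"
    unfolding N_def comm[symmetric]
    by (rule bounded_linear.suminf[OF bounded_bilinear.bounded_linear_left[OF bounded_bilinear_blinfun_compose] summ])
  have NS: "N x - N (S x) = x" and SN: "N x - S (N x) = x" for x
    using arg_cong[OF split, of "\<lambda>T. blinfun_apply T x"]
      arg_cong[OF left, of "\<lambda>T. blinfun_apply T x"] arg_cong[OF right, of "\<lambda>T. blinfun_apply T x"]
    by (simp_all add: blinfun_rep)
  \<comment> \<open>\<open>N\<close> is the inverse of \<open>1 - S\<close>, so it commutes with
    whatever commutes with \<open>S\<close>; with \<open>B\<close> a scalar or \<open>B = a\<close>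
    this puts \<open>N\<close> in the commutant.\<close>
  have comm_N: "N (B x) = B (N x)" if "\<And>x. S (B x) = B (S x)" for B :: "'a \<Rightarrow>\<^sub>L 'a" and x
  proof -
    have "N (B x) = N (B (N x - S (N x)))" by (simp only: SN)
    also have "\<dots> = N (B (N x)) - N (S (B (N x)))"
      using that by (simp add: blinfun.bilinear_simps)
    finally show ?thesis by (simp only: NS)
  qed
  show ?thesis
  proof (rule that)
    have "N (scaleC c x) = scaleC c (N x)" for c x
      using comm_N[of "scaleC c id_blinfun" x] commutantD[OF S] by (simp add: blinfun_rep)
    moreover have "N (a x) = a (N x)" for x using comm_N[of a x] commutantD[OF S] by simp
    ultimately show "N \<in> commutant a" by (simp add: commutant_def)
    show "norm N \<le> 2"
    proof -
      have "norm N \<le> norm (S \<odot> N) + norm (id_blinfun :: 'a \<Rightarrow>\<^sub>L 'a)"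
        using split left norm_triangle_ineq[of "S \<odot> N" id_blinfun] by simp
      also have "\<dots> \<le> norm S * norm N + 1"
        by (intro add_mono norm_blinfun_compose norm_blinfun_id_le)
      also have "norm S * norm N \<le> 1 / 2 * norm N" using small by (intro mult_right_mono) auto
      finally show ?thesis by simp
    qed
  qed (use NS SN in auto)
qed

lemma invertible_near_id:
  assumes "j \<in> commutant a" "norm (id_blinfun - j) \<le> 1 / 2"
  obtains N where "N \<in> commutant a" "\<And>x. j (N x) = x"
proof -
  obtain N where N: "N \<in> commutant a" "\<And>x. N x - (id_blinfun - j) (N x) = x"
    using Neumann_inverse[OF commutant_closed(3)[OF id_in_commutant assms(1)] assms(2)] by metis
  show ?thesis using N by (intro that[of N]) (auto simp: blinfun_rep)
qed

text \<open>A proper right ideal contains nothing within 1/2 of the identity, because such an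
  element has a right inverse in the commutant. Hence its closure is still proper, and Hahn-Banach
  separates it from the identity.\<close>

lemma separate_ideal:
  assumes J: "J \<subseteq> commutant a" and add: "\<And>x y. x \<in> J \<Longrightarrow> y \<in> J \<Longrightarrow> x + y \<in> J"
    and scale: "\<And>c x. x \<in> J \<Longrightarrow> scaleC c x \<in> J" and mult: "\<And>x S. x \<in> J \<Longrightarrow> S \<in> commutant a \<Longrightarrow> x \<odot> S \<in> J"
    and zero: "0 \<in> J" and id: "id_blinfun \<notin> J"
  obtains l where "dual_elem l" "l id_blinfun \<noteq> 0" "\<And>x. x \<in> J \<Longrightarrow> l x = 0"
proof -
  have "id_blinfun \<notin> closure J"
  proof
    assume "id_blinfun \<in> closure J"
    then obtain j where j: "j \<in> J" "dist j id_blinfun < 1 / 2"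
      unfolding closure_approachable by (meson half_gt_zero zero_less_one)
    then have "norm (id_blinfun - j) \<le> 1 / 2" by (simp add: dist_norm norm_minus_commute)
    then obtain N where N: "N \<in> commutant a" "\<And>x. j (N x) = x"
      using invertible_near_id j(1) J by (metis subsetD)
    have "j \<odot> N = id_blinfun" by (rule blinfun_eqI) (simp add: N)
    then show False using mult[OF j(1) N(1)] id by simp
  qed
  from separating_functional[OF add scale zero this] show ?thesis using that by metis
qed

lemma blinfun_compose_id: "T \<odot> id_blinfun = T"
  by (rule blinfun_eqI) simp

text \<open>A form of the Gelfand--Mazur theorem: modulo the closed ideal generated by a non-invertible
  central element, the map \<open>r \<mapsto> (a - r)\<^sup>-\<^sup>1\<close> cannot be entire, as it vanishes at infinity.\<close>

theorem Gelfand_Mazur_commutant: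
  fixes a b :: "'a::complex_banach \<Rightarrow>\<^sub>L 'a"
  assumes a: "a \<in> commutant a" and b: "b \<in> commutant a"
    and central: "\<And>S x. S \<in> commutant a \<Longrightarrow> S (b x) = b (S x)"
    and ninv: "\<And>S. S \<in> commutant a \<Longrightarrow> b \<odot> S \<noteq> id_blinfun"
  obtains r l where "dual_elem l" "l id_blinfun \<noteq> 0" "\<And>S. S \<in> commutant a \<Longrightarrow> l (b \<odot> S) = 0"
    "\<And>S. S \<in> commutant a \<Longrightarrow> l (a \<odot> S - scaleC r S) = 0"
proof -
  note cc = commutant_closed and cs = commutant_scaleC[OF a]
  \<comment> \<open>\<open>J r\<close> is the right ideal generated by \<open>b\<close> and
    \<open>a - r\<close>; the claim is that it is proper for some \<open>r\<close>.\<close>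
  define J where "J = (\<lambda>r. {b \<odot> S + (a \<odot> T - scaleC r T) | S T. S \<in> commutant a \<and> T \<in> commutant a})"
  have b0: "b \<odot> S = b \<odot> S + (a \<odot> 0 - scaleC r 0)" for S r
    by (rule blinfun_eqI) (simp add: blinfun_rep blinfun.bilinear_simps)
  have a0: "a \<odot> S - scaleC r S = b \<odot> 0 + (a \<odot> S - scaleC r S)" for S r
    by (rule blinfun_eqI) (simp add: blinfun_rep blinfun.bilinear_simps)
  have zero: "0 \<in> commutant a" by (simp add: commutant_def blinfun_rep)
  have "\<exists>r. id_blinfun \<notin> J r"
  proof (rule ccontr)
    assume "\<not> ?thesis"
    then have "\<forall>r. \<exists>S T. S \<in> commutant a \<and> T \<in> commutant a \<and>
        id_blinfun = b \<odot> S + (a \<odot> T - scaleC r T)" unfolding J_def by blast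
    \<comment> \<open>\<open>c r\<close> inverts \<open>a - r\<close> modulo the ideal of
      \<open>b\<close>. It is an arbitrary choice for each \<open>r\<close>, without any
      continuity.\<close>
    then obtain d c where d: "\<And>r. d r \<in> commutant a" and c: "\<And>r. c r \<in> commutant a"
      and dc: "\<And>r. id_blinfun = b \<odot> d r + (a \<odot> c r - scaleC r (c r))" by metis
    obtain l where l: "dual_elem l" "l id_blinfun \<noteq> 0" "\<And>x. x \<in> (\<lambda>S. b \<odot> S) ` commutant a \<Longrightarrow> l x = 0"
    proof (rule separate_ideal[of "(\<lambda>S. b \<odot> S) ` commutant a" a])
      show "x + y \<in> (\<lambda>S. b \<odot> S) ` commutant a"
        if "x \<in> (\<lambda>S. b \<odot> S) ` commutant a" "y \<in> (\<lambda>S. b \<odot> S) ` commutant a" for x y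
        using that by (auto intro!: imageI cc(2) simp flip: bounded_bilinear.add_right[OF bounded_bilinear_blinfun_compose])
      show "scaleC c x \<in> (\<lambda>S. b \<odot> S) ` commutant a"
        if "x \<in> (\<lambda>S. b \<odot> S) ` commutant a" for c x
      proof -
        from that obtain S where S: "S \<in> commutant a" "x = b \<odot> S" by blast
        then have "scaleC c x = b \<odot> scaleC c S"
          by (intro blinfun_eqI) (simp add: blinfun_rep commutantD[OF b])
        then show ?thesis using cs[OF S(1)] by blast
      qed
      show "x \<odot> S \<in> (\<lambda>S. b \<odot> S) ` commutant a"
        if "x \<in> (\<lambda>S. b \<odot> S) ` commutant a" "S \<in> commutant a" for x S
        using that by (auto intro!: imageI cc(1) simp: blinfun_compose_assoc)
      show "0 \<in> (\<lambda>S. b \<odot> S) ` commutant a"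
        using zero by (intro image_eqI[of _ _ 0]) (auto intro!: blinfun_eqI simp: blinfun_rep blinfun.bilinear_simps)
      show "id_blinfun \<notin> (\<lambda>S. b \<odot> S) ` commutant a" using ninv by (metis imageE)
    qed (use cc(1)[OF b] in auto)
    define h where "h = (\<lambda>r. l (c r))"
    note lD = dual_elemD[OF l(1)]
    \<comment> \<open>Inverses modulo an ideal are unique modulo it: computing
      \<open>c r (a - r) T\<close> in two ways gives \<open>c r - T = b (c r S - d r T)\<close>. So
      \<open>h r\<close> is independent of the choice and may be computed from any convenient
      \<open>T\<close>.\<close>
    have h_eq: "h r = l T" if T: "T \<in> commutant a" and S: "S \<in> commutant a"
      and e: "\<And>x. b (S x) + (a (T x) - scaleC r (T x)) = x" for r S T
    proof -
      have dcr: "b (d r x) + (a (c r x) - scaleC r (c r x)) = x" for x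
        using arg_cong[OF dc[of r], of "\<lambda>T. blinfun_apply T x"] by (simp add: blinfun_rep)
      have "c r - T = b \<odot> (c r \<odot> S - d r \<odot> T)"
      proof (rule blinfun_eqI)
        fix x
        have 1: "c r (a (T x) - scaleC r (T x)) = c r x - b (c r (S x))"
          using e[of x] central[OF c[of r]] by (metis add_diff_cancel_left' blinfun.diff_right)
        have "a (c r (T x)) - scaleC r (c r (T x)) = T x - b (d r (T x))"
          using dcr[of "T x"] by (metis add_diff_cancel_left')
        with 1 have "c r x - b (c r (S x)) = T x - b (d r (T x))"
          by (simp add: blinfun.bilinear_simps commutantD[OF c])
        then show "(c r - T) x = (b \<odot> (c r \<odot> S - d r \<odot> T)) x"
          by (simp add: blinfun_rep blinfun.bilinear_simps algebra_simps)
      qed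
      then have "l (c r - T) = 0"
        using l(3)[of "c r - T"] cc(3)[OF cc(1)[OF c S] cc(1)[OF d T]] by blast
      then show ?thesis by (simp add: h_def lD)
    qed
    have "h field_differentiable at r0" for r0
    proof -
      \<comment> \<open>This is the size of the second-order remainder: three copies of
        \<open>c r0\<close> and one \<open>N\<close> with \<open>norm N \<le> 2\<close>.\<close>
      define K where "K = onorm l * (norm (c r0) ^ 3 * 2)"
      have K0: "K \<ge> 0" unfolding K_def using lD(8) by simp
      have bound: "cmod (h r - h r0 - (r - r0) * l (c r0 \<odot> c r0)) \<le> K * cmod (r - r0) ^ 2"
        if r: "cmod (r - r0) * norm (c r0) \<le> 1 / 2" for r
      proof -
        have "norm (scaleC (r - r0) (c r0)) \<le> 1 / 2" using r by (simp add: norm_scaleC)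
        then obtain N where N: "N \<in> commutant a" "\<And>x. N x - scaleC (r - r0) (c r0 (N x)) = x" "norm N \<le> 2"
          using Neumann_inverse[OF cs[OF c], of "r - r0" r0]
          by (metis scaleC_blinfun.rep_eq)
        have dcr: "b (d r0 x) + (a (c r0 x) - scaleC r0 (c r0 x)) = x" for x
          using arg_cong[OF dc[of r0], of "\<lambda>T. blinfun_apply T x"] by (simp add: blinfun_rep)
        \<comment> \<open>Near \<open>r0\<close> a convenient inverse is
          \<open>c r0 (1 - (r - r0) c r0)^-1\<close>; expanding it to second order identifies the
          derivative of \<open>h\<close> as \<open>l (c r0 \<odot> c r0)\<close>.\<close>
        have "h r = l (c r0 \<odot> N)"
        proof (rule h_eq)
          fix x
          have "b (d r0 (N x)) + (a (c r0 (N x)) - scaleC r (c r0 (N x)))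
            = N x - scaleC (r - r0) (c r0 (N x))"
            using dcr[of "N x"] by (simp add: scaleC_diff_left algebra_simps)
          then show "b ((d r0 \<odot> N) x) + (a ((c r0 \<odot> N) x) - scaleC r ((c r0 \<odot> N) x)) = x"
            using N(2) by simp
        qed (use cc(1)[OF c N(1)] cc(1)[OF d N(1)] in auto)
        moreover have N_expand: "c r0 \<odot> N = c r0 + scaleC (r - r0) (c r0 \<odot> c r0)
            + scaleC ((r - r0)^2) (c r0 \<odot> (c r0 \<odot> (c r0 \<odot> N)))"
        proof (rule blinfun_eqI)
          fix x
          let ?c = "blinfun_apply (c r0)" and ?s = "scaleC (r - r0) :: 'a \<Rightarrow> 'a"
          have Nx: "N x = x + ?s (?c (N x))" using N(2)[of x] by (simp add: algebra_simps)
          have c_lin: "?c (x + ?s y) = ?c x + ?s (?c y)" for x y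
            by (simp add: blinfun.bilinear_simps commutantD[OF c])
          have "?c (N x) = ?c (x + ?s (?c (N x)))" using Nx by simp
          also have "\<dots> = ?c x + ?s (?c (?c (N x)))" by (rule c_lin)
          also have "?c (?c (N x)) = ?c (?c (x + ?s (?c (N x))))" using Nx by simp
          also have "\<dots> = ?c (?c x) + ?s (?c (?c (?c (N x))))" by (simp only: c_lin)
          finally show "(c r0 \<odot> N) x = (c r0 + scaleC (r - r0) (c r0 \<odot> c r0)
            + scaleC ((r - r0)^2) (c r0 \<odot> (c r0 \<odot> (c r0 \<odot> N)))) x"
            by (simp add: blinfun_rep scaleC_add_right scaleC_scaleC power2_eq_square add.assoc)
        qed
        moreover have "l (c r0 \<odot> N) = l (c r0) + (r - r0) * l (c r0 \<odot> c r0)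
            + (r - r0)^2 * l (c r0 \<odot> (c r0 \<odot> (c r0 \<odot> N)))"
          by (subst N_expand) (simp add: lD)
        ultimately have "h r - h r0 - (r - r0) * l (c r0 \<odot> c r0)
            = (r - r0)^2 * l (c r0 \<odot> (c r0 \<odot> (c r0 \<odot> N)))"
          by (simp add: lD h_def)
        moreover have "cmod (l (c r0 \<odot> (c r0 \<odot> (c r0 \<odot> N)))) \<le> K"
        proof -
          have "norm (c r0 \<odot> (c r0 \<odot> (c r0 \<odot> N))) \<le> norm (c r0) * (norm (c r0) * (norm (c r0) * 2))"
            by (intro order_trans[OF norm_blinfun_compose] mult_mono N order_refl) auto
          then show ?thesis
            unfolding K_def using lD(8)
            by (intro order_trans[OF lD(7)] mult_left_mono) (auto simp: power3_eq_cube algebra_simps)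
        qed
        ultimately show ?thesis
          by (simp add: norm_mult norm_power mult_left_mono mult.commute[of K])
      qed
      have "(h has_field_derivative l (c r0 \<odot> c r0)) (at r0)"
        unfolding has_field_derivative_iff
      proof (rule LIM_zero_cancel, rule Lim_null_comparison)
        \<comment> \<open>Chosen so that \<open>cmod (r - r0) * norm (c r0) \<le> 1 / 2\<close>;
          adding 1 avoids division by zero.\<close>
        define \<epsilon> where "\<epsilon> = 1 / (2 * (norm (c r0) + 1))"
        have \<epsilon>: "\<epsilon> > 0" by (simp add: \<epsilon>_def add_nonneg_pos)
        show "\<forall>\<^sub>F r in at r0. cmod ((h r - h r0) / (r - r0) - l (c r0 \<odot> c r0)) \<le> K * cmod (r - r0)"
          unfolding eventually_at
        proof (intro exI[of _ \<epsilon>] conjI ballI impI \<epsilon>)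
          fix r assume "r \<noteq> r0 \<and> dist r r0 < \<epsilon>"
          then have r: "r \<noteq> r0" "cmod (r - r0) < \<epsilon>" by (auto simp: dist_norm)
          have "cmod (r - r0) * norm (c r0) \<le> \<epsilon> * (norm (c r0) + 1)"
            using r \<epsilon> by (intro mult_mono) auto
          also have "\<epsilon> * (norm (c r0) + 1) = 1 / 2"
            using add_nonneg_pos[OF norm_ge_zero[of "c r0"] zero_less_one]
            by (simp add: \<epsilon>_def field_simps)
          finally have "cmod (h r - h r0 - (r - r0) * l (c r0 \<odot> c r0)) \<le> K * cmod (r - r0) ^ 2"
            by (rule bound)
          moreover have "(h r - h r0) / (r - r0) - l (c r0 \<odot> c r0)
            = (h r - h r0 - (r - r0) * l (c r0 \<odot> c r0)) / (r - r0)"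
            using r by (simp add: field_simps)
          ultimately show "cmod ((h r - h r0) / (r - r0) - l (c r0 \<odot> c r0)) \<le> K * cmod (r - r0)"
            using r by (simp add: norm_divide divide_le_eq power2_eq_square mult.assoc)
        qed
        show "((\<lambda>r. K * cmod (r - r0)) \<longlongrightarrow> 0) (at r0)"
          by (auto intro!: tendsto_eq_intros)
      qed
      then show ?thesis by (auto simp: field_differentiable_def)
    qed
    then have holo: "h holomorphic_on UNIV" by (simp add: holomorphic_on_def field_differentiable_at_within)
    \<comment> \<open>For large \<open>r\<close> the element \<open>a - r\<close> is genuinely
      invertible, with inverse \<open>- (1 / r) (1 - a / r)^-1\<close>, and the contribution of
      \<open>b\<close> can be taken to be 0.\<close>
    have far: "\<exists>N. h r = - (1 / r) * l N \<and> norm N \<le> 2 \<and> l N = l id_blinfun + (1 / r) * l (a \<odot> N)"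
      if r: "cmod r \<ge> 2 * norm a + 1" for r
    proof -
      have r0: "r \<noteq> 0" using r by (metis add_nonneg_pos norm_ge_zero norm_zero not_less
            zero_le_mult_iff zero_le_numeral zero_less_one order_less_le_trans less_irrefl)
      have "norm (scaleC (1 / r) a) \<le> 1 / 2"
        using r r0 by (simp add: norm_scaleC norm_divide field_simps)
      then obtain N where N: "N \<in> commutant a" "\<And>x. N x - scaleC (1 / r) (a (N x)) = x" "norm N \<le> 2"
        using Neumann_inverse[OF cs[OF a], of "1 / r"] by (metis scaleC_blinfun.rep_eq)
      have "h r = l (scaleC (- (1 / r)) N)"
      proof (rule h_eq[OF _ zero])
        fix x
        have "a (scaleC (- (1 / r)) (N x)) - scaleC r (scaleC (- (1 / r)) (N x))
          = N x - scaleC (1 / r) (a (N x))"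
          using r0 by (simp add: commutantD(1)[OF a] scaleC_scaleC scaleC_minus_left
              scaleC_minus_right blinfun.minus_right)
        then show "b (blinfun_apply 0 x) + (a ((scaleC (- (1 / r)) N) x) - scaleC r ((scaleC (- (1 / r)) N) x)) = x"
          using N(2) by (simp add: blinfun_rep blinfun.bilinear_simps)
      qed (use cs[OF N(1)] in auto)
      moreover have "N = id_blinfun + scaleC (1 / r) (a \<odot> N)"
        by (rule blinfun_eqI) (use N(2) in \<open>simp add: blinfun_rep algebra_simps\<close>)
      then have "l N = l (id_blinfun + scaleC (1 / r) (a \<odot> N))" by (rule arg_cong)
      ultimately show ?thesis using N(3) by (intro exI[of _ N]) (simp add: lD)
    qed
    have "(h \<longlongrightarrow> 0) at_infinity"
    proof (rule Lim_null_comparison)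
      show "\<forall>\<^sub>F r in at_infinity. cmod (h r) \<le> (onorm l * 2) * inverse (cmod r)"
        unfolding eventually_at_infinity
      proof (intro exI[of _ "2 * norm a + 1"] allI impI)
        fix r :: complex assume "2 * norm a + 1 \<le> cmod r"
        from far[OF this] obtain N where N: "h r = - (1 / r) * l N" "norm N \<le> 2" by blast
        have "cmod (l N) \<le> onorm l * 2"
          using lD(7)[of N] mult_left_mono[OF N(2) lD(8)] by simp
        then show "cmod (h r) \<le> (onorm l * 2) * inverse (cmod r)"
          unfolding N(1) by (simp add: norm_mult norm_divide divide_right_mono field_simps)
      qed
      show "((\<lambda>r::complex. (onorm l * 2) * inverse (cmod r)) \<longlongrightarrow> 0) at_infinity"
        by (intro tendsto_mult_right_zero tendsto_inverse_0_at_top filterlim_at_infinity_imp_norm_at_top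
            filterlim_ident)
    qed
    then have h0: "h r = 0" for r by (rule Liouville_weak_0[OF holo])
    \<comment> \<open>With \<open>h\<close> identically 0, \<open>l\<close> vanishes on every
      \<open>N\<close> from \<open>far\<close>. As \<open>r\<close> grows, \<open>N\<close>
      approaches the identity, which forces \<open>l id_blinfun = 0\<close>; the size of
      \<open>r\<close> is chosen to bring the error \<open>M / cmod r\<close> below
      \<open>K\<close>.\<close>
    have "cmod (l id_blinfun) \<le> K" if K: "K > 0" for K
    proof -
      define M where "M = onorm l * (norm a * 2)"
      have M: "M \<ge> 0" using lD(8) by (simp add: M_def)
      define r where "r = complex_of_real (2 * norm a + 1 + M / K)"
      have cr: "cmod r = 2 * norm a + 1 + M / K"
        unfolding r_def norm_of_real using M K by (simp add: abs_of_nonneg add_nonneg_nonneg)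
      then have "2 * norm a + 1 \<le> cmod r" and r0: "cmod r > 0" using M K by (auto simp: add_nonneg_pos add_pos_nonneg)
      from far[OF this(1)] obtain N where N: "h r = - (1 / r) * l N" "norm N \<le> 2"
        "l N = l id_blinfun + (1 / r) * l (a \<odot> N)" by blast
      have "l N = 0" using N(1) h0[of r] r0 by auto
      then have "l id_blinfun = - ((1 / r) * l (a \<odot> N))" using N(3) by (simp add: eq_neg_iff_add_eq_0)
      then have "cmod (l id_blinfun) = cmod (l (a \<odot> N)) / cmod r"
        by (simp add: norm_divide)
      also have "cmod (l (a \<odot> N)) \<le> onorm l * (norm a * 2)"
      proof (rule order_trans[OF lD(7)] , rule mult_left_mono[OF _ lD(8)])
        show "norm (a \<odot> N) \<le> norm a * 2"
          by (intro order_trans[OF norm_blinfun_compose] mult_left_mono N) auto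
      qed
      then have "cmod (l (a \<odot> N)) / cmod r \<le> M / cmod r" using r0 by (simp add: M_def divide_right_mono)
      also have "M / cmod r \<le> K"
      proof -
        have "M = K * (M / K)" using K by simp
        also have "\<dots> \<le> K * cmod r" using K cr by (intro mult_left_mono) auto
        finally show ?thesis using r0 by (simp add: divide_le_eq)
      qed
      finally show ?thesis .
    qed
    then have "cmod (l id_blinfun) \<le> 0" by (meson field_le_epsilon add.left_neutral le_add_same_cancel2 dense_ge)
    then show False using l(2) by simp
  qed
  then obtain r where r: "id_blinfun \<notin> J r" by blast
  obtain l where l: "dual_elem l" "l id_blinfun \<noteq> 0" "\<And>x. x \<in> J r \<Longrightarrow> l x = 0"
  proof (rule separate_ideal[of "J r" a])
    show "J r \<subseteq> commutant a" unfolding J_def by (auto intro!: cc cs a b)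
    show "x + y \<in> J r" if xy: "x \<in> J r" "y \<in> J r" for x y
    proof -
      obtain S T S' T' where "S \<in> commutant a" "T \<in> commutant a" "x = b \<odot> S + (a \<odot> T - scaleC r T)"
        "S' \<in> commutant a" "T' \<in> commutant a" "y = b \<odot> S' + (a \<odot> T' - scaleC r T')"
        using xy by (auto simp: J_def)
      moreover then have "x + y = b \<odot> (S + S') + (a \<odot> (T + T') - scaleC r (T + T'))"
        by (intro blinfun_eqI) (simp add: blinfun_rep blinfun.bilinear_simps scaleC_add_right)
      ultimately show ?thesis using cc(2) unfolding J_def by blast
    qed
    show "scaleC c x \<in> J r" if x: "x \<in> J r" for c x
    proof -
      obtain S T where "S \<in> commutant a" "T \<in> commutant a" "x = b \<odot> S + (a \<odot> T - scaleC r T)"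
        using x by (auto simp: J_def)
      moreover then have "scaleC c x = b \<odot> (scaleC c S) + (a \<odot> (scaleC c T) - scaleC r (scaleC c T))"
        by (intro blinfun_eqI) (simp add: blinfun_rep blinfun.bilinear_simps scaleC_add_right
            scaleC_diff_right scaleC_scaleC commutantD[OF a] commutantD[OF b] mult.commute)
      ultimately show ?thesis using cs unfolding J_def by blast
    qed
    show "x \<odot> U \<in> J r" if x: "x \<in> J r" and U: "U \<in> commutant a" for x U
    proof -
      obtain S T where "S \<in> commutant a" "T \<in> commutant a" "x = b \<odot> S + (a \<odot> T - scaleC r T)"
        using x by (auto simp: J_def)
      moreover then have "x \<odot> U = b \<odot> (S \<odot> U) + (a \<odot> (T \<odot> U) - scaleC r (T \<odot> U))"
        by (intro blinfun_eqI) (simp add: blinfun_rep blinfun.bilinear_simps)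
      ultimately show ?thesis using cc(1)[OF _ U] unfolding J_def by blast
    qed
    show "0 \<in> J r" unfolding J_def using zero by (auto intro!: exI[of _ 0] blinfun_eqI simp: blinfun_rep blinfun.bilinear_simps)
  qed (use r in auto)
  show ?thesis
  proof (rule that[OF l(1,2)])
    show "l (b \<odot> S) = 0" if "S \<in> commutant a" for S
      using that zero b0[of S r] unfolding J_def by (intro l(3)[unfolded J_def]) blast
    show "l (a \<odot> S - scaleC r S) = 0" if "S \<in> commutant a" for S
      using that zero a0[of S r] by (intro l(3)[unfolded J_def]) blast
  qed
qed

section \<open>Line integrals in a half-plane\<close>

lemma Cauchy_kernel_integral:
  fixes c d :: real
  assumes c: "c > 0"
  shows "has_bochner_integral lborel (\<lambda>b. 1 / (c\<^sup>2 + (b - d)\<^sup>2)) (pi / c)"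
proof -
  have "has_bochner_integral lborel (\<lambda>x::real. inverse (1 + x\<^sup>2)) pi"
    using integrable_inverse_1_plus_square LBINT_inverse_1_plus_square
    by (simp add: has_bochner_integral_iff set_integrable_def interval_lebesgue_integral_def
        set_lebesgue_integral_def)
  then have "has_bochner_integral lborel (\<lambda>b. inverse (1 + (- d / c + 1 / c * b)\<^sup>2)) (pi /\<^sub>R \<bar>1 / c\<bar>)"
    using lborel_has_bochner_integral_real_affine_iff[of "1 / c" "\<lambda>x::real. inverse (1 + x\<^sup>2)" pi "- d / c"] c
    by simp
  then have "has_bochner_integral lborel (\<lambda>b. inverse (1 + (- d / c + 1 / c * b)\<^sup>2) * (1 / c\<^sup>2))
      (pi /\<^sub>R \<bar>1 / c\<bar> * (1 / c\<^sup>2))"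
    by (rule has_bochner_integral_mult_left)
  also have "pi /\<^sub>R \<bar>1 / c\<bar> * (1 / c\<^sup>2) = pi / c"
    using c by (simp add: power2_eq_square field_simps)
  also have "(\<lambda>b. inverse (1 + (- d / c + 1 / c * b)\<^sup>2) * (1 / c\<^sup>2)) = (\<lambda>b. 1 / (c\<^sup>2 + (b - d)\<^sup>2))"
  proof
    fix b
    have "c\<^sup>2 + (b - d)\<^sup>2 = c\<^sup>2 * (1 + (- d / c + 1 / c * b)\<^sup>2)"
      using c by (simp add: power2_eq_square field_simps)
    then show "inverse (1 + (- d / c + 1 / c * b)\<^sup>2) * (1 / c\<^sup>2) = 1 / (c\<^sup>2 + (b - d)\<^sup>2)"
      by (simp add: field_simps)
  qed
  finally show ?thesis .
qed

lemma cmod_Complex_minus: "cmod (Complex x y - p) ^ 2 = (Re p - x)\<^sup>2 + (y - Im p)\<^sup>2"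
  by (simp add: cmod_power2 power2_commute)

lemma tendsto_symmetric_integral:
  fixes g :: "real \<Rightarrow> 'a::euclidean_space"
  assumes g: "integrable lborel g"
  shows "(\<lambda>n. integral {- real n..real n} g) \<longlonglongrightarrow> (LINT x|lborel. g x)"
proof -
  have "(\<lambda>n. LINT x|lborel. indicator {- real n..real n} x *\<^sub>R g x) \<longlonglongrightarrow> (LINT x|lborel. g x)"
  proof (rule integral_dominated_convergence[where w = "\<lambda>x. norm (g x)"])
    show "AE x in lborel. (\<lambda>n. indicator {- real n..real n} x *\<^sub>R g x) \<longlonglongrightarrow> g x"
    proof (intro AE_I2 tendsto_eventually)
      fix x :: real
      obtain N where "\<bar>x\<bar> \<le> real N" using real_arch_simple by blast
      then show "\<forall>\<^sub>F n in sequentially. indicator {- real n..real n} x *\<^sub>R g x = g x"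
        by (intro eventually_sequentiallyI[of N]) (auto simp: indicator_def)
    qed
  qed (use g in \<open>auto split: split_indicator\<close>)
  moreover have "(LINT x|lborel. indicator {- real n..real n} x *\<^sub>R g x) = integral {- real n..real n} g" for n
  proof -
    have "set_integrable lborel {- real n..real n} g"
      unfolding set_integrable_def using g by (intro integrable_mult_indicator) auto
    from set_borel_integral_eq_integral(2)[OF this] show ?thesis
      by (simp add: set_lebesgue_integral_def)
  qed
  ultimately show ?thesis by simp
qed

lemma convex_rhp: "convex rhp" and open_rhp: "open rhp"
  using convex_halfspace_Re_gt[of 0] open_halfspace_Re_gt[of 0] by (simp_all add: rhp_def)

text \<open>Close the line to the right by large rectangles; the double pole at \<open>p\<close> contributes \<open>u' p\<close>.\<close>

lemma Cauchy_line_integral: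
  fixes u :: "complex \<Rightarrow> complex"
  assumes holo: "u holomorphic_on rhp" and \<alpha>: "0 < \<alpha>" and p: "\<alpha> < Re p"
    and M: "\<And>z. \<alpha> \<le> Re z \<Longrightarrow> cmod (u z) \<le> M"
  shows "integrable lborel (\<lambda>\<beta>. u (Complex \<alpha> \<beta>) / (Complex \<alpha> \<beta> - p)\<^sup>2)"
    "(LINT \<beta>|lborel. u (Complex \<alpha> \<beta>) / (Complex \<alpha> \<beta> - p)\<^sup>2) = - 2 * pi * deriv u p"
proof -
  define g where "g = (\<lambda>z. u z / (z - p)\<^sup>2)"
  have M0: "0 \<le> M" using M[of p] p by (meson norm_ge_zero order_trans less_imp_le)
  have cont_u: "continuous_on rhp u" by (rule holomorphic_on_imp_continuous_on[OF holo])
  have g_bound: "cmod (g z) \<le> M / e\<^sup>2" if "\<alpha> \<le> Re z" "e \<le> cmod (z - p)" "0 < e" for z e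
    unfolding g_def norm_divide norm_power
    using that M[OF that(1)] M0 by (intro frac_le power_mono) auto
  have cont_line: "continuous_on UNIV (\<lambda>\<beta>. g (Complex \<alpha> \<beta>))"
  proof -
    have "continuous_on UNIV (\<lambda>\<beta>. u (Complex \<alpha> \<beta>))"
      by (rule continuous_on_compose2[OF cont_u])
         (use \<alpha> in \<open>auto intro!: continuous_intros simp: rhp_def Complex_eq\<close>)
    moreover have "continuous_on UNIV (\<lambda>\<beta>. Complex \<alpha> \<beta> - p)"
      unfolding Complex_eq by (intro continuous_intros)
    moreover have "Complex \<alpha> \<beta> - p \<noteq> 0" for \<beta> using p by auto
    ultimately show ?thesis unfolding g_def by (intro continuous_on_divide continuous_on_power) auto
  qed
  show int: "integrable lborel (\<lambda>\<beta>. u (Complex \<alpha> \<beta>) / (Complex \<alpha> \<beta> - p)\<^sup>2)"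
  proof (rule Bochner_Integration.integrable_bound)
    show "integrable lborel (\<lambda>\<beta>. M * (1 / ((Re p - \<alpha>)\<^sup>2 + (\<beta> - Im p)\<^sup>2)))"
      using Cauchy_kernel_integral[of "Re p - \<alpha>" "Im p"] p
      by (intro integrable_mult_right) (auto simp: has_bochner_integral_iff)
    show "(\<lambda>\<beta>. u (Complex \<alpha> \<beta>) / (Complex \<alpha> \<beta> - p)\<^sup>2) \<in> borel_measurable lborel"
      using borel_measurable_continuous_onI[OF cont_line] by (simp add: g_def)
    show "AE \<beta> in lborel. norm (u (Complex \<alpha> \<beta>) / (Complex \<alpha> \<beta> - p)\<^sup>2)
        \<le> norm (M * (1 / ((Re p - \<alpha>)\<^sup>2 + (\<beta> - Im p)\<^sup>2)))"
      using M[of "Complex \<alpha> _"] M0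
      by (intro AE_I2) (simp add: norm_divide norm_power cmod_Complex_minus divide_right_mono)
  qed
  have "(\<lambda>n. integral {- real n..real n} (\<lambda>\<beta>. g (Complex \<alpha> \<beta>))) \<longlonglongrightarrow> - 2 * pi * deriv u p"
  proof (rule LIM_zero_cancel, rule Lim_null_comparison)
    show "\<forall>\<^sub>F n in sequentially. cmod (integral {- real n..real n} (\<lambda>\<beta>. g (Complex \<alpha> \<beta>)) - (- 2 * pi * deriv u p))
      \<le> 4 * M * real n / (real n - cmod p)\<^sup>2"
    proof (rule eventually_sequentiallyI)
      fix n assume n: "nat \<lceil>cmod p + \<alpha>\<rceil> + 1 \<le> n"
      then have np: "cmod p + \<alpha> < real n" by linarith
      define N where "N = real n"
      have N: "N > 0" "cmod p < N" unfolding N_def using np \<alpha> norm_ge_zero[of p] by linarith+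
      define a b c d where "a = Complex \<alpha> (- N)" and "b = Complex (\<alpha> + N) (- N)"
        and "c = Complex (\<alpha> + N) N" and "d = Complex \<alpha> N"
      have rp: "rectpath a c = linepath a b +++ linepath b c +++ linepath c d +++ linepath d a"
        by (simp add: rectpath_def a_def b_def c_def d_def Let_def)
      have pabs: "\<bar>Re p\<bar> < N" "\<bar>Im p\<bar> < N"
        using abs_Re_le_cmod[of p] abs_Im_le_cmod[of p] N by linarith+
      have p_in: "p \<in> box a c" using p pabs N \<alpha> by (auto simp: in_box_complex_iff a_def c_def)
      have img: "path_image (rectpath a c) = {z. Re z \<in> {\<alpha>, \<alpha> + N} \<and> Im z \<in> {- N..N}} \<union>
           {z. Im z \<in> {- N, N} \<and> Re z \<in> {\<alpha>..\<alpha> + N}}"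
        using N by (subst path_image_rectpath) (auto simp: a_def c_def)
      have ab: "closed_segment a b \<subseteq> {z. Im z = - N \<and> \<alpha> \<le> Re z}"
        and bc: "closed_segment b c \<subseteq> {z. Re z = \<alpha> + N}"
        and cd: "closed_segment c d \<subseteq> {z. Im z = N \<and> \<alpha> \<le> Re z}"
        and da: "closed_segment d a \<subseteq> {z. Re z = \<alpha>}"
        using N by (auto simp: a_def b_def c_def d_def closed_segment_same_Re closed_segment_same_Im
            closed_segment_eq_real_ivl)
      have cont_g: "continuous_on (rhp - {p}) g"
        unfolding g_def by (intro continuous_intros continuous_on_subset[OF cont_u]) auto
      have segs: "closed_segment a b \<subseteq> rhp - {p}" "closed_segment b c \<subseteq> rhp - {p}"
        "closed_segment c d \<subseteq> rhp - {p}" "closed_segment d a \<subseteq> rhp - {p}"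
        using ab bc cd da \<alpha> N p pabs by (fastforce simp: rhp_def)+
      have ci: "g contour_integrable_on linepath a b" "g contour_integrable_on linepath b c"
        "g contour_integrable_on linepath c d" "g contour_integrable_on linepath d a"
        using segs by (auto intro!: contour_integrable_continuous_linepath continuous_on_subset[OF cont_g])
      have "contour_integral (rectpath a c) g
          = 2 * pi * \<i> * (\<Sum>q\<in>{p}. winding_number (rectpath a c) q * residue g q)"
      proof (rule Residue_theorem)
        show "g holomorphic_on rhp - {p}"
          unfolding g_def by (intro holomorphic_intros holomorphic_on_subset[OF holo]) auto
        show "path_image (rectpath a c) \<subseteq> rhp - {p}"
          unfolding img using \<alpha> p pabs N by (auto simp: rhp_def)
        show "\<forall>z. z \<notin> rhp \<longrightarrow> winding_number (rectpath a c) z = 0"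
        proof (intro allI impI)
          fix z assume "z \<notin> rhp"
          then have "z \<notin> cbox a c" using \<alpha> by (auto simp: rhp_def in_cbox_complex_iff a_def)
          then show "winding_number (rectpath a c) z = 0"
            using N by (intro winding_number_rectpath_outside) (auto simp: a_def c_def)
        qed
      qed (use open_rhp convex_connected[OF convex_rhp] in auto)
      also have "\<dots> = 2 * pi * \<i> * deriv u p"
        using winding_number_rectpath[OF p_in]
          residue_holomorphic_over_power[of rhp p u 1] open_rhp holo p \<alpha>
        by (simp add: rhp_def g_def power2_eq_square)
      finally have eq: "contour_integral (linepath a b) g + (contour_integral (linepath b c) g
          + (contour_integral (linepath c d) g + contour_integral (linepath d a) g))
          = 2 * pi * \<i> * deriv u p"
        unfolding rp using ci by simp
      \<comment> \<open>The positively oriented rectangle descends along its left side; this is the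
        origin of the sign in \<open>- 2 * pi * deriv u p\<close>.\<close>
      have "contour_integral (linepath d a) g = - contour_integral (linepath a d) g"
        using ci by (metis contour_integral_reverse_linepath continuous_on_subset[OF cont_g segs(4)]
            closed_segment_commute)
      also have "contour_integral (linepath a d) g = \<i> * integral {- N..N} (\<lambda>x. g (Complex \<alpha> x))"
        using N by (intro contour_integral_linepath_same_Re) (auto simp: a_def d_def)
      finally have eq': "\<i> * (integral {- N..N} (\<lambda>x. g (Complex \<alpha> x)) - (- 2 * pi * deriv u p))
          = contour_integral (linepath a b) g + contour_integral (linepath b c) g
          + contour_integral (linepath c d) g"
        using eq by (simp add: algebra_simps)
      \<comment> \<open>On the three remote sides, of total length \<open>4 * N\<close>, the
        distance to \<open>p\<close> is at least \<open>N - cmod p\<close>.\<close>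
      define B where "B = M / (N - cmod p)\<^sup>2"
      have B0: "B \<ge> 0" using M0 by (simp add: B_def)
      have le: "cmod (g z) \<le> B" if "\<alpha> \<le> Re z" "\<bar>Im z\<bar> = N \<or> Re z \<ge> N" for z
        unfolding B_def
      proof (rule g_bound[OF that(1)])
        show "N - cmod p \<le> cmod (z - p)"
          using that(2) abs_Re_le_cmod[of z] abs_Im_le_cmod[of z] norm_triangle_ineq2[of z p] by linarith
      qed (use N in simp)
      have 1: "cmod (contour_integral (linepath a b) g) \<le> B * cmod (b - a)"
        using ab N by (intro contour_integral_bound_linepath ci B0 le) auto
      have 2: "cmod (contour_integral (linepath b c) g) \<le> B * cmod (c - b)"
        using bc \<alpha> N by (intro contour_integral_bound_linepath ci B0 le) auto
      have 3: "cmod (contour_integral (linepath c d) g) \<le> B * cmod (d - c)"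
        using cd N by (intro contour_integral_bound_linepath ci B0 le) auto
      have "b - a = of_real N" "c - b = \<i> * of_real (2 * N)" "d - c = of_real (- N)"
        by (simp_all add: a_def b_def c_def d_def complex_eq_iff)
      then have "cmod (b - a) = N" "cmod (c - b) = 2 * N" "cmod (d - c) = N"
        using N by (simp_all add: norm_mult)
      with 1 2 3 have "cmod (contour_integral (linepath a b) g + contour_integral (linepath b c) g
          + contour_integral (linepath c d) g) \<le> B * N + B * (2 * N) + B * N"
        by (intro order_trans[OF norm_triangle_ineq] add_mono) auto
      then show "cmod (integral {- real n..real n} (\<lambda>\<beta>. g (Complex \<alpha> \<beta>)) - (- 2 * pi * deriv u p))
          \<le> 4 * M * real n / (real n - cmod p)\<^sup>2"
        unfolding eq'[symmetric] norm_mult by (simp add: B_def N_def field_simps)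
    qed
    show "(\<lambda>n. 4 * M * real n / (real n - cmod p)\<^sup>2) \<longlonglongrightarrow> 0" by real_asymp
  qed
  with tendsto_symmetric_integral[OF int]
  show "(LINT \<beta>|lborel. u (Complex \<alpha> \<beta>) / (Complex \<alpha> \<beta> - p)\<^sup>2) = - 2 * pi * deriv u p"
    unfolding g_def by (rule LIMSEQ_unique)
qed

section \<open>Functions with an integrable majorant of the derivative\<close>

lemma continuous_on_Complex [continuous_intros]:
  assumes "continuous_on S f" "continuous_on S g"
  shows "continuous_on S (\<lambda>x. Complex (f x) (g x))"
  unfolding Complex_eq by (intro continuous_intros assms)

text \<open>Dominated convergence for sets that eventually leave every point. It covers both ends of
  the half-line: sets shrinking towards 0 and sets escaping to infinity.\<close>

lemma tail_integral_zero:
  fixes X :: "nat \<Rightarrow> real set" and F :: "real \<Rightarrow> real"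
  assumes F_nonneg: "\<And>x. 0 \<le> F x" and F_integrable: "integrable lborel F" and X: "\<And>n. X n \<in> sets borel" and ev: "\<And>t. 0 < t \<Longrightarrow> \<forall>\<^sub>F n in sequentially. t \<notin> X n"
    and pos: "\<And>n. X n \<subseteq> {0<..}"
  shows "(\<lambda>n. LINT t:X n|lborel. F t) \<longlonglongrightarrow> 0"
proof -
  have "(\<lambda>n. LINT t|lborel. indicator (X n) t *\<^sub>R F t) \<longlonglongrightarrow> (LINT t|(lborel :: real measure). (0::real))"
  proof (rule integral_dominated_convergence[where f = "\<lambda>_. 0" and w = F and s = "\<lambda>n t. indicator (X n) t *\<^sub>R F t"])
    show "AE t in lborel. (\<lambda>n. indicator (X n) t *\<^sub>R F t) \<longlonglongrightarrow> 0"
    proof (intro AE_I2 tendsto_eventually)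
      fix t :: real
      show "\<forall>\<^sub>F n in sequentially. indicator (X n) t *\<^sub>R F t = 0"
      proof (cases "t > 0")
        case True
        from ev[OF this] show ?thesis by eventually_elim auto
      next
        case False
        then have "t \<notin> X n" for n using pos[of n] by auto
        then show ?thesis by simp
      qed
    qed
    show "AE t in lborel. norm (indicator (X n) t *\<^sub>R F t) \<le> F t" for n
      using F_nonneg by (auto split: split_indicator)
  qed (use F_integrable X in \<open>auto intro!: borel_measurable_scaleR borel_measurable_indicator\<close>)
  then show ?thesis by (simp add: set_lebesgue_integral_def)
qed

lemma horizontal_FTC:
  assumes holo: "f holomorphic_on rhp" and ab: "0 < a" "a \<le> b"
  shows "set_integrable lborel {a..b} (\<lambda>t. deriv f (Complex t y))"
    "f (Complex b y) - f (Complex a y) = (LINT t:{a..b}|lborel. deriv f (Complex t y))"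
proof -
  have "((\<lambda>t. deriv f (Complex t y)) has_integral f (Complex b y) - f (Complex a y)) {a..b}"
  proof (rule fundamental_theorem_of_calculus[OF ab(2)])
    fix t assume t: "t \<in> {a..b}"
    have "((f \<circ> (\<lambda>t. Complex t y)) has_vector_derivative 1 * deriv f (Complex t y)) (at t)"
    proof (rule field_vector_diff_chain_at)
      show "((\<lambda>t. Complex t y) has_vector_derivative 1) (at t)"
        unfolding Complex_eq by (auto intro!: derivative_eq_intros)
      show "(f has_field_derivative deriv f (Complex t y)) (at (Complex t y))"
        using t ab holo open_rhp by (intro holomorphic_derivI) (auto simp: rhp_def)
    qed
    then show "((\<lambda>t. f (Complex t y)) has_vector_derivative deriv f (Complex t y)) (at t within {a..b})"
      by (simp add: o_def has_vector_derivative_at_within)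
  qed
  moreover have cd: "continuous_on rhp (deriv f)"
    by (rule holomorphic_on_imp_continuous_on[OF holomorphic_deriv[OF holo open_rhp]])
  show int: "set_integrable lborel {a..b} (\<lambda>t. deriv f (Complex t y))"
    using ab
    by (intro borel_integrable_atLeastAtMost' continuous_on_compose2[OF cd])
       (auto intro!: continuous_intros simp: rhp_def)
  ultimately show "f (Complex b y) - f (Complex a y) = (LINT t:{a..b}|lborel. deriv f (Complex t y))"
    using set_borel_integral_eq_integral(2)[OF int] by (simp add: integral_unique)
qed

text \<open>\<open>F\<close> replaces \<open>sup |f'|\<close> on vertical lines. The limits of
  \<open>x * F x\<close> at both ends kill the boundary terms of an integration by parts, and
  \<open>F_inverse\<close> makes \<open>f'\<close> bounded on each half-plane away from the
  imaginary axis.\<close>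

locale B_majorant =
  fixes f :: "complex \<Rightarrow> complex" and F :: "real \<Rightarrow> real"
  assumes holo: "f holomorphic_on rhp"
    and F_nonneg: "\<And>x. 0 \<le> F x"
    and F_integrable: "integrable lborel F"
    and F_bound: "\<And>x y. 0 < x \<Longrightarrow> cmod (deriv f (Complex x y)) \<le> F x"
    and F_zero: "((\<lambda>x. x * F x) \<longlongrightarrow> 0) (at_right 0)"
    and F_infinity: "((\<lambda>x. x * F x) \<longlongrightarrow> 0) at_top"
    and F_inverse: "\<exists>K. \<forall>x>0. x * F x \<le> K"
begin

lemma F_bound': "0 < Re z \<Longrightarrow> cmod (deriv f z) \<le> F (Re z)"
  using F_bound[of "Re z" "Im z"] by simp

lemma holo_deriv: "deriv f holomorphic_on rhp"
  by (rule holomorphic_deriv[OF holo open_rhp])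

lemma continuous_deriv: "continuous_on rhp (deriv f)"
  by (rule holomorphic_on_imp_continuous_on[OF holo_deriv])

lemma has_deriv: "0 < Re z \<Longrightarrow> (f has_field_derivative deriv f z) (at z)"
  using holo open_rhp by (intro holomorphic_derivI) (auto simp: rhp_def)

lemma F_set_integrable: "X \<in> sets borel \<Longrightarrow> set_integrable lborel X F"
  unfolding set_integrable_def using F_integrable by (intro integrable_mult_indicator) auto

lemma F_integral_mono:
  assumes "X \<subseteq> Y" "X \<in> sets borel" "Y \<in> sets borel"
  shows "(LINT t:X|lborel. F t) \<le> (LINT t:Y|lborel. F t)"
  unfolding set_lebesgue_integral_def
  using F_set_integrable assms F_nonneg
  by (intro integral_mono) (auto simp: set_integrable_def split: split_indicator)

lemma horizontal_increment:
  assumes "0 < a" "a \<le> b"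
  shows "cmod (f (Complex b y) - f (Complex a y)) \<le> (LINT t:{a..b}|lborel. F t)"
proof -
  note ftc = horizontal_FTC[OF holo assms, of y]
  have "cmod (f (Complex b y) - f (Complex a y)) \<le> (LINT t:{a..b}|lborel. cmod (deriv f (Complex t y)))"
    unfolding ftc(2) using ftc(1) set_integral_norm_bound by blast
  also have "\<dots> \<le> (LINT t:{a..b}|lborel. F t)"
    using assms F_bound set_integrable_norm[OF ftc(1)] F_set_integrable by (intro set_integral_mono) auto
  finally show ?thesis .
qed

text \<open>\<open>\<Omega> x\<close> bounds the horizontal oscillation of \<open>f\<close> on the
  strip \<open>0 < Re z \<le> x\<close>, and \<open>\<Psi> x\<close> that on
  \<open>Re z \<ge> x\<close>. Both are tails of a convergent integral; boundary values and the
  limit at infinity rest on this.\<close>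

definition \<Omega> :: "real \<Rightarrow> real" where "\<Omega> x = (LINT t:{0<..x}|lborel. F t)"
definition \<Psi> :: "real \<Rightarrow> real" where "\<Psi> x = (LINT t:{x..}|lborel. F t)"

lemma \<Omega>_tendsto: "(\<Omega> \<longlongrightarrow> 0) (at_right 0)"
  unfolding tendsto_at_iff_sequentially
proof (intro allI impI)
  fix X :: "nat \<Rightarrow> real" assume X: "\<forall>i. X i \<in> {0<..} - {0}" "X \<longlonglongrightarrow> 0"
  have "(\<lambda>n. LINT t:{0<..X n}|lborel. F t) \<longlonglongrightarrow> 0"
  proof (rule tail_integral_zero[OF F_nonneg F_integrable])
    fix t :: real assume "0 < t"
    from order_tendstoD(2)[OF X(2) this] show "\<forall>\<^sub>F n in sequentially. t \<notin> {0<..X n}"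
      by eventually_elim auto
  qed auto
  then show "(\<Omega> \<circ> X) \<longlonglongrightarrow> 0" by (simp add: \<Omega>_def o_def)
qed

lemma \<Psi>_tendsto: "(\<Psi> \<longlongrightarrow> 0) at_top"
proof (rule tendsto_at_topI_sequentially)
  fix X :: "nat \<Rightarrow> real" assume X: "filterlim X at_top sequentially"
  have "(\<lambda>n. LINT t:{max 1 (X n)..}|lborel. F t) \<longlonglongrightarrow> 0"
  proof (rule tail_integral_zero[OF F_nonneg F_integrable])
    fix t :: real assume "0 < t"
    from X have "\<forall>\<^sub>F n in sequentially. t < X n" by (simp add: filterlim_at_top_dense)
    then show "\<forall>\<^sub>F n in sequentially. t \<notin> {max 1 (X n)..}" by eventually_elim auto
  qed auto
  moreover have "\<forall>\<^sub>F n in sequentially. 1 < X n" using X by (simp add: filterlim_at_top_dense)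
  then have "\<forall>\<^sub>F n in sequentially. (LINT t:{max 1 (X n)..}|lborel. F t) = \<Psi> (X n)"
    by eventually_elim (simp add: \<Psi>_def)
  ultimately show "(\<lambda>n. \<Psi> (X n)) \<longlonglongrightarrow> 0" by (blast intro: Lim_transform_eventually)
qed

lemma \<Omega>_increment:
  assumes "0 < a" "a \<le> x" "0 < b" "b \<le> x"
  shows "cmod (f (Complex b y) - f (Complex a y)) \<le> \<Omega> x"
proof (cases "a \<le> b")
  case True
  then show ?thesis unfolding \<Omega>_def
    using assms by (intro order_trans[OF horizontal_increment] F_integral_mono) auto
next
  case False
  then show ?thesis unfolding \<Omega>_def
    using assms by (subst norm_minus_commute) (intro order_trans[OF horizontal_increment] F_integral_mono, auto)
qed

lemma \<Psi>_increment:
  assumes "0 < x" "x \<le> a" "x \<le> b"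
  shows "cmod (f (Complex b y) - f (Complex a y)) \<le> \<Psi> x"
proof (cases "a \<le> b")
  case True
  then show ?thesis unfolding \<Psi>_def
    using assms by (intro order_trans[OF horizontal_increment] F_integral_mono) auto
next
  case False
  then show ?thesis unfolding \<Psi>_def
    using assms by (subst norm_minus_commute) (intro order_trans[OF horizontal_increment] F_integral_mono, auto)
qed

lemma vertical_increment:
  assumes "0 < x"
  shows "cmod (f (Complex x y) - f (Complex x y')) \<le> F x * \<bar>y - y'\<bar>"
proof -
  have "cmod (f (Complex x y) - f (Complex x y')) \<le> F x * cmod (Complex x y - Complex x y')"
  proof (rule field_differentiable_bound[where S = "{z. Re z = x}" and f' = "deriv f"])
    show "convex {z. Re z = x}" using convex_hyperplane[of "1::complex" x] by (simp add: inner_complex_def)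
    show "(f has_field_derivative deriv f z) (at z within {z. Re z = x})" if "z \<in> {z. Re z = x}" for z
      using that assms has_deriv[of z] by (auto intro: has_field_derivative_at_within)
    show "cmod (deriv f z) \<le> F x" if "z \<in> {z. Re z = x}" for z
      using that assms F_bound'[of z] by auto
  qed auto
  also have "Complex x y - Complex x y' = \<i> * of_real (y - y')" by (simp add: complex_eq_iff)
  finally show ?thesis by (simp add: norm_mult flip: of_real_diff)
qed

lemma Cauchy_limit:
  fixes u :: "nat \<Rightarrow> complex" and w :: "nat \<Rightarrow> real"
  assumes "\<And>n m. n \<le> m \<Longrightarrow> cmod (u m - u n) \<le> w n" "w \<longlonglongrightarrow> 0"
  obtains L where "u \<longlonglongrightarrow> L"
proof -
  have "Cauchy u"
  proof (rule CauchyI')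
    fix e :: real assume "e > 0"
    from order_tendstoD(2)[OF assms(2) this] obtain N where "w n < e" if "n \<ge> N" for n
      by (auto simp: eventually_sequentially)
    then show "\<exists>M. \<forall>m\<ge>M. \<forall>n>m. dist (u m) (u n) < e"
      using assms(1) by (metis norm_minus_commute less_imp_le order_le_less_trans dist_norm)
  qed
  then show ?thesis using that by (auto simp: Cauchy_convergent_iff convergent_def)
qed

lemma Re_at_top_neq_bot: "filtercomap Re at_top \<noteq> bot"
proof (rule filtercomap_neq_bot_surj)
  show "surj Re" by (rule surjI[of _ of_real]) simp
qed simp

text \<open>Along each horizontal line \<open>f\<close> is Cauchy by \<open>\<Psi>\<close>.
  Different heights share the limit, since the vertical increment at \<open>Re z = n\<close> is at
  most \<open>F n * |Im z|\<close>, which is of order \<open>1 / n\<close>.\<close>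

lemma B_inf_bound:
  assumes "0 < Re z"
  shows "cmod (f z - B_inf f) \<le> \<Psi> (Re z)"
proof -
  have "(\<lambda>n. \<Psi> (real (Suc n))) \<longlonglongrightarrow> 0"
    by (rule filterlim_compose[OF \<Psi>_tendsto]) (intro filterlim_compose[OF filterlim_real_sequentially] filterlim_Suc)
  then obtain L where L: "(\<lambda>n. f (Complex (real (Suc n)) 0)) \<longlonglongrightarrow> L"
    by (rule Cauchy_limit[rotated, of _ "\<lambda>n. f (Complex (real (Suc n)) 0)"]) (auto intro!: \<Psi>_increment)
  have bound: "cmod (f z - L) \<le> \<Psi> (Re z)" if z: "0 < Re z" for z
  proof (rule LIMSEQ_le_const2)
    define K where "K = (SOME K. \<forall>x>0. x * F x \<le> K)"
    have K: "x * F x \<le> K" if "x > 0" for x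
      using someI_ex[OF F_inverse] that unfolding K_def by blast
    have "(\<lambda>n. f (Complex (real (Suc n)) (Im z)) - f (Complex (real (Suc n)) 0)) \<longlonglongrightarrow> 0"
    proof (rule Lim_null_comparison)
      show "\<forall>\<^sub>F n in sequentially. cmod (f (Complex (real (Suc n)) (Im z)) - f (Complex (real (Suc n)) 0))
          \<le> K * \<bar>Im z\<bar> * inverse (real (Suc n))"
      proof (intro always_eventually allI)
        fix n
        have "F (real (Suc n)) \<le> K * inverse (real (Suc n))"
          using K[of "real (Suc n)"] by (simp add: field_simps)
        then have "F (real (Suc n)) * \<bar>Im z\<bar> \<le> K * inverse (real (Suc n)) * \<bar>Im z\<bar>"
          by (rule mult_right_mono) simp
        then show "cmod (f (Complex (real (Suc n)) (Im z)) - f (Complex (real (Suc n)) 0))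
          \<le> K * \<bar>Im z\<bar> * inverse (real (Suc n))"
          using vertical_increment[of "real (Suc n)" "Im z" 0] by (simp add: mult_ac)
      qed
      show "(\<lambda>n. K * \<bar>Im z\<bar> * inverse (real (Suc n))) \<longlonglongrightarrow> 0"
        by (intro tendsto_mult_right_zero LIMSEQ_inverse_real_of_nat)
    qed
    from tendsto_add[OF this L]
    have "(\<lambda>n. f (Complex (real (Suc n)) (Im z))) \<longlonglongrightarrow> L" by simp
    then show "(\<lambda>n. cmod (f z - f (Complex (real (Suc n)) (Im z)))) \<longlonglongrightarrow> cmod (f z - L)"
      by (intro tendsto_intros)
    have "cmod (f z - f (Complex (real (Suc n)) (Im z))) \<le> \<Psi> (Re z)" if "n \<ge> nat \<lceil>Re z\<rceil>" for n
    proof -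
      have "Re z \<le> real (Suc n)" using that by linarith
      then show ?thesis using \<Psi>_increment[OF z, of "real (Suc n)" "Re z" "Im z"] by simp
    qed
    then show "\<exists>N. \<forall>n\<ge>N. cmod (f z - f (Complex (real (Suc n)) (Im z))) \<le> \<Psi> (Re z)" by blast
  qed
  have "(f \<longlongrightarrow> L) (filtercomap Re at_top)"
  proof (rule LIM_zero_cancel, rule Lim_null_comparison)
    show "\<forall>\<^sub>F z in filtercomap Re at_top. cmod (f z - L) \<le> \<Psi> (Re z)"
      by (rule eventually_mono[OF eventually_filtercomapI[OF eventually_gt_at_top[of 0]]]) (rule bound)
    show "((\<lambda>z. \<Psi> (Re z)) \<longlongrightarrow> 0) (filtercomap Re at_top)"
      by (rule filterlim_compose[OF \<Psi>_tendsto filterlim_filtercomap])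
  qed
  then have "B_inf f = L" unfolding B_inf_def by (rule tendsto_Lim[OF Re_at_top_neq_bot])
  with bound[OF assms] show ?thesis by simp
qed

section \<open>Boundary values on the imaginary axis\<close>

lemma rhp_nontrivial:
  assumes "0 \<le> Re z"
  shows "at z within rhp \<noteq> bot"
proof -
  have "z islimpt rhp"
    unfolding islimpt_sequential
  proof (intro exI[of _ "\<lambda>n. z + of_real (inverse (real (Suc n)))"] conjI allI)
    show "(\<lambda>n. z + of_real (inverse (real (Suc n)))) \<longlonglongrightarrow> z"
      using tendsto_add[OF tendsto_const[of z] tendsto_of_real[OF LIMSEQ_inverse_real_of_nat]] by simp
    show "z + of_real (inverse (real (Suc n))) \<in> rhp - {z}" for n
      using assms of_nat_neq_0[of n, where 'a = complex] by (simp add: rhp_def add_nonneg_pos)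
  qed
  then show ?thesis by (simp add: trivial_limit_within)
qed

lemma B_val_tendsto:
  assumes z0: "0 \<le> Re z0"
  shows "(f \<longlongrightarrow> B_val f z0) (at z0 within rhp)"
proof -
  have "\<exists>L. (f \<longlongrightarrow> L) (at z0 within rhp)"
  proof (cases "Re z0 > 0")
    case True
    then have "(f \<longlongrightarrow> f z0) (at z0 within rhp)"
      using holomorphic_on_imp_continuous_on[OF holo] by (simp add: continuous_on_def rhp_def)
    then show ?thesis by blast
  next
    case False
    define y0 where "y0 = Im z0"
    have inv0: "filterlim (\<lambda>n. inverse (real (Suc n))) (at_right 0) sequentially"
      using LIMSEQ_inverse_real_of_nat by (auto simp: filterlim_at intro!: always_eventually)
    have "(\<lambda>n. \<Omega> (inverse (real (Suc n)))) \<longlonglongrightarrow> 0"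
      by (rule filterlim_compose[OF \<Omega>_tendsto inv0])
    then obtain L where L: "(\<lambda>n. f (Complex (inverse (real (Suc n))) y0)) \<longlonglongrightarrow> L"
      by (rule Cauchy_limit[rotated, of _ "\<lambda>n. f (Complex (inverse (real (Suc n))) y0)"])
         (auto intro!: \<Omega>_increment le_imp_inverse_le)
    have L_bound: "cmod (f (Complex x y0) - L) \<le> \<Omega> x" if x: "0 < x" for x
    proof (rule LIMSEQ_le_const2)
      show "(\<lambda>n. cmod (f (Complex x y0) - f (Complex (inverse (real (Suc n))) y0))) \<longlonglongrightarrow> cmod (f (Complex x y0) - L)"
        by (intro tendsto_intros L)
      obtain N where N: "inverse (real (Suc N)) < x" using reals_Archimedean[OF x] by auto
      have "cmod (f (Complex x y0) - f (Complex (inverse (real (Suc n))) y0)) \<le> \<Omega> x" if "n \<ge> N" for n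
      proof -
        have "inverse (real (Suc n)) \<le> inverse (real (Suc N))" using that by (intro le_imp_inverse_le) auto
        from order.trans[OF this less_imp_le[OF N]] show ?thesis using x by (intro \<Omega>_increment) auto
      qed
      then show "\<exists>N. \<forall>n\<ge>N. cmod (f (Complex x y0) - f (Complex (inverse (real (Suc n))) y0)) \<le> \<Omega> x" by blast
    qed
    have "(f \<longlongrightarrow> L) (at z0 within rhp)"
    proof (rule tendstoI)
      fix e :: real assume e: "e > 0"
      have "\<forall>\<^sub>F x in at_right 0. \<Omega> x < e / 4 \<and> 0 < x"
        using order_tendstoD(2)[OF \<Omega>_tendsto, of "e / 4"] e
        by (auto intro: eventually_conj eventually_at_right_less)
      then obtain d where d: "\<Omega> d < e / 4" "0 < d"
        using eventually_happens'[OF trivial_limit_at_right_real] by blast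
      \<comment> \<open>The path from \<open>z\<close> to the base height goes right to depth
        \<open>d\<close>, vertically there, and back towards the axis. The outer moves cost at most
        \<open>\<Omega> d < e / 4\<close> each, and the second bound in \<open>r\<close> makes the
        vertical one cost at most \<open>e / 4\<close>.\<close>
      define r where "r = min d (e / (4 * (F d + 1)))"
      have r: "r > 0" using d e F_nonneg[of d] by (simp add: r_def add_nonneg_pos)
      have "dist (f z) L < e" if z: "z \<in> rhp" "dist z z0 < r" for z
      proof -
        have zr: "\<bar>Re z - Re z0\<bar> < r" "\<bar>Im z - y0\<bar> < r"
          using abs_Re_le_cmod[of "z - z0"] abs_Im_le_cmod[of "z - z0"] z(2)
          by (auto simp: dist_norm y0_def)
        then have zd: "0 < Re z" "Re z \<le> d" using z z0 False by (auto simp: rhp_def r_def)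
        have "cmod (f (Complex d (Im z)) - f (Complex d y0)) \<le> F d * \<bar>Im z - y0\<bar>"
          by (rule vertical_increment[OF d(2)])
        also have "\<dots> \<le> F d * (e / (4 * (F d + 1)))"
          using zr F_nonneg by (intro mult_left_mono) (auto simp: r_def)
        also have "\<dots> \<le> e / 4"
          using e F_nonneg[of d] by (simp add: field_simps add_nonneg_pos)
        finally have v: "cmod (f (Complex d (Im z)) - f (Complex d y0)) \<le> e / 4" .
        have h: "cmod (f z - f (Complex d (Im z))) \<le> \<Omega> d"
          using \<Omega>_increment[of d d "Re z" "Im z"] zd d by simp
        have "cmod (f z - L) \<le> cmod (f z - f (Complex d (Im z)))
            + cmod (f (Complex d (Im z)) - f (Complex d y0)) + cmod (f (Complex d y0) - L)"
          by (smt (verit) norm_diff_triangle_ineq norm_triangle_ineq diff_add_cancel add_diff_eq)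
        then show ?thesis using v h L_bound[OF d(2)] d(1) e unfolding dist_norm by linarith
      qed
      then show "\<forall>\<^sub>F z in at z0 within rhp. dist (f z) L < e"
        using r by (auto simp: eventually_at)
    qed
    then show ?thesis by blast
  qed
  then show ?thesis
    unfolding B_val_def using tendsto_Lim[OF rhp_nontrivial[OF z0]] by metis
qed

lemma B_inf_tendsto: "(f \<longlongrightarrow> B_inf f) (filtercomap Re at_top)"
proof (rule LIM_zero_cancel, rule Lim_null_comparison)
  show "\<forall>\<^sub>F z in filtercomap Re at_top. cmod (f z - B_inf f) \<le> \<Psi> (Re z)"
    by (rule eventually_mono[OF eventually_filtercomapI[OF eventually_gt_at_top[of 0]]]) (rule B_inf_bound)
  show "((\<lambda>z. \<Psi> (Re z)) \<longlongrightarrow> 0) (filtercomap Re at_top)"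
    by (rule filterlim_compose[OF \<Psi>_tendsto filterlim_filtercomap])
qed


text \<open>On the line \<open>Re z = \<alpha>\<close> one has \<open>\<alpha> - i\<beta> + \<mu> = 2\<alpha> + \<mu> - z\<close>, so the inner integral is a Cauchy integral.\<close>

lemma resolvent_kernel_integral:
  assumes \<mu>: "0 \<le> Re \<mu>" and \<alpha>: "0 < \<alpha>"
  shows "integrable lborel (\<lambda>\<beta>. (1 / (Complex \<alpha> (- \<beta>) + \<mu>))\<^sup>2 * deriv f (Complex \<alpha> \<beta>))"
    "(LINT \<beta>|lborel. (1 / (Complex \<alpha> (- \<beta>) + \<mu>))\<^sup>2 * deriv f (Complex \<alpha> \<beta>))
      = - 2 * pi * deriv (deriv f) (2 * of_real \<alpha> + \<mu>)"
    "\<alpha> * (LINT \<beta>|lborel. cmod ((1 / (Complex \<alpha> (- \<beta>) + \<mu>))\<^sup>2)) \<le> pi"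
    "integrable lborel (\<lambda>\<beta>. cmod ((1 / (Complex \<alpha> (- \<beta>) + \<mu>))\<^sup>2))"
proof -
  define p where "p = 2 * of_real \<alpha> + \<mu>"
  obtain K where K: "\<And>x. x > 0 \<Longrightarrow> x * F x \<le> K" using F_inverse by blast
  have K0: "0 \<le> K" using K[of 1] F_nonneg[of 1] by simp
  have p: "\<alpha> < Re p" using \<mu> \<alpha> by (simp add: p_def)
  \<comment> \<open>\<open>F_inverse\<close> gives the bound on \<open>f'\<close> needed to close
    the contour in the half-plane \<open>Re z \<ge> \<alpha>\<close>.\<close>
  have M: "cmod (deriv f z) \<le> K / \<alpha>" if "\<alpha> \<le> Re z" for z
  proof -
    have "cmod (deriv f z) \<le> F (Re z)" using that \<alpha> by (intro F_bound') auto
    also have "\<dots> \<le> K / Re z" using K[of "Re z"] that \<alpha> by (simp add: field_simps)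
    also have "\<dots> \<le> K / \<alpha>" using that \<alpha> K0 by (intro divide_left_mono) auto
    finally show ?thesis .
  qed
  have eq: "Complex \<alpha> (- \<beta>) + \<mu> = - (Complex \<alpha> \<beta> - p)" for \<beta>
    by (simp add: p_def complex_eq_iff)
  have "(1 / (Complex \<alpha> (- \<beta>) + \<mu>))\<^sup>2 * deriv f (Complex \<alpha> \<beta>)
      = deriv f (Complex \<alpha> \<beta>) / (Complex \<alpha> \<beta> - p)\<^sup>2" for \<beta>
    unfolding eq by (simp add: power_divide power2_commute)
  with Cauchy_line_integral[OF holo_deriv \<alpha> p M]
  show "integrable lborel (\<lambda>\<beta>. (1 / (Complex \<alpha> (- \<beta>) + \<mu>))\<^sup>2 * deriv f (Complex \<alpha> \<beta>))"
    "(LINT \<beta>|lborel. (1 / (Complex \<alpha> (- \<beta>) + \<mu>))\<^sup>2 * deriv f (Complex \<alpha> \<beta>))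
      = - 2 * pi * deriv (deriv f) (2 * of_real \<alpha> + \<mu>)"
    by (simp_all add: p_def)
  have kern: "cmod ((1 / (Complex \<alpha> (- \<beta>) + \<mu>))\<^sup>2) = 1 / ((Re p - \<alpha>)\<^sup>2 + (\<beta> - Im p)\<^sup>2)" for \<beta>
    unfolding eq norm_power norm_divide norm_minus_cancel power_divide cmod_Complex_minus by simp
  have "has_bochner_integral lborel (\<lambda>\<beta>. cmod ((1 / (Complex \<alpha> (- \<beta>) + \<mu>))\<^sup>2)) (pi / (Re p - \<alpha>))"
    unfolding kern using p by (intro Cauchy_kernel_integral) simp
  \<comment> \<open>Here \<open>Re p - \<alpha> = \<alpha> + Re \<mu>\<close>, which is at least
    \<alpha> even if \<mu> is purely imaginary.\<close>
  moreover have "\<alpha> * (pi / (Re p - \<alpha>)) \<le> pi" using \<mu> \<alpha> by (simp add: p_def field_simps)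
  ultimately show "\<alpha> * (LINT \<beta>|lborel. cmod ((1 / (Complex \<alpha> (- \<beta>) + \<mu>))\<^sup>2)) \<le> pi"
    "integrable lborel (\<lambda>\<beta>. cmod ((1 / (Complex \<alpha> (- \<beta>) + \<mu>))\<^sup>2))"
    by (simp_all add: has_bochner_integral_iff)
qed

theorem reproducing_formula:
  assumes \<mu>: "0 \<le> Re \<mu>"
  shows "(LINT \<alpha>:{0<..}|lborel. complex_of_real \<alpha> *
      (LINT \<beta>|lborel. (1 / (Complex \<alpha> (- \<beta>) + \<mu>))\<^sup>2 * deriv f (Complex \<alpha> \<beta>)))
    = of_real (pi / 2) * (B_inf f - B_val f \<mu>)"
proof -
  define p where "p = (\<lambda>\<alpha>. 2 * complex_of_real \<alpha> + \<mu>)"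
  \<comment> \<open>\<open>G\<close> is a primitive of \<open>g\<close>, which packs the integration
    by parts into one derivative. Its limits at 0 and at infinity are \<open>- B_val f \<mu>\<close>
    and \<open>- B_inf f\<close>; the argument \<open>p \<alpha> = 2 \<alpha> + \<mu>\<close> comes
    from the Cauchy integral.\<close>
  define G where "G = (\<lambda>\<alpha>. 2 * complex_of_real \<alpha> * deriv f (p \<alpha>) - f (p \<alpha>))"
  define g where "g = (\<lambda>\<alpha>. 4 * complex_of_real \<alpha> * deriv (deriv f) (p \<alpha>))"
  have Re_p: "Re (p \<alpha>) = 2 * \<alpha> + Re \<mu>" for \<alpha> by (simp add: p_def)
  have p_rhp: "p \<alpha> \<in> rhp" if "\<alpha> > 0" for \<alpha> using that \<mu> by (simp add: rhp_def Re_p)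
  have holo2: "deriv (deriv f) holomorphic_on rhp" by (rule holomorphic_deriv[OF holo_deriv open_rhp])
  have cont_p: "continuous_on S p" for S unfolding p_def by (intro continuous_intros)
  have cont_g: "continuous_on {0<..} g"
    unfolding g_def
    by (intro continuous_intros continuous_on_compose2[OF holomorphic_on_imp_continuous_on[OF holo2] cont_p])
       (auto intro: p_rhp)
  \<comment> \<open>Integrability of \<alpha> times \<open>f''\<close> comes from the integral
    representation of \<open>f''\<close>, whose kernel is bounded by pi; so it survives
    \<open>Re \<mu> = 0\<close>.\<close>
  have g_bound: "cmod (g \<alpha>) \<le> 2 * F \<alpha>" if \<alpha>: "\<alpha> > 0" for \<alpha>
  proof -
    note rk = resolvent_kernel_integral[OF \<mu> \<alpha>]
    have "2 * pi * cmod (deriv (deriv f) (p \<alpha>))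
        = cmod (LINT \<beta>|lborel. (1 / (Complex \<alpha> (- \<beta>) + \<mu>))\<^sup>2 * deriv f (Complex \<alpha> \<beta>))"
      unfolding rk(2) by (simp add: norm_mult p_def)
    also have "\<dots> \<le> (LINT \<beta>|lborel. cmod ((1 / (Complex \<alpha> (- \<beta>) + \<mu>))\<^sup>2 * deriv f (Complex \<alpha> \<beta>)))"
      by simp
    also have "\<dots> \<le> (LINT \<beta>|lborel. cmod ((1 / (Complex \<alpha> (- \<beta>) + \<mu>))\<^sup>2) * F \<alpha>)"
      using integrable_norm[OF rk(1)] rk(4) F_bound[OF \<alpha>]
      by (intro integral_mono integrable_mult_left) (auto simp: norm_mult intro!: mult_left_mono)
    also have "\<dots> = (LINT \<beta>|lborel. cmod ((1 / (Complex \<alpha> (- \<beta>) + \<mu>))\<^sup>2)) * F \<alpha>" by simp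
    finally have "\<alpha> * (2 * pi * cmod (deriv (deriv f) (p \<alpha>)))
        \<le> (\<alpha> * (LINT \<beta>|lborel. cmod ((1 / (Complex \<alpha> (- \<beta>) + \<mu>))\<^sup>2))) * F \<alpha>"
      using \<alpha> by (simp add: mult.assoc)
    also have "\<dots> \<le> pi * F \<alpha>" by (intro mult_right_mono rk(3) F_nonneg)
    finally have "pi * (2 * \<alpha> * cmod (deriv (deriv f) (p \<alpha>))) \<le> pi * F \<alpha>" by (simp add: mult_ac)
    then have "2 * \<alpha> * cmod (deriv (deriv f) (p \<alpha>)) \<le> F \<alpha>" by simp
    then show ?thesis using \<alpha> by (simp add: g_def norm_mult)
  qed
  have g_int: "set_integrable lborel {0<..} g"
    unfolding set_integrable_def
  proof (rule Bochner_Integration.integrable_bound)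
    show "integrable lborel (\<lambda>x. 2 * F x)" using F_integrable by simp
    show "(\<lambda>x. indicator {0<..} x *\<^sub>R g x) \<in> borel_measurable lborel"
      using borel_measurable_continuous_on_indicator[OF _ cont_g] by simp
    show "AE x in lborel. norm (indicator {0<..} x *\<^sub>R g x) \<le> norm (2 * F x)"
      using g_bound F_nonneg by (intro AE_I2) (auto simp: indicator_def)
  qed
  have decay: "cmod (2 * complex_of_real \<alpha> * deriv f (p \<alpha>)) \<le> (2 * \<alpha> + Re \<mu>) * F (2 * \<alpha> + Re \<mu>)"
    if \<alpha>: "\<alpha> > 0" for \<alpha>
  proof -
    have "cmod (deriv f (p \<alpha>)) \<le> F (2 * \<alpha> + Re \<mu>)"
      using F_bound'[of "p \<alpha>"] \<alpha> \<mu> by (simp add: Re_p)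
    then show ?thesis using \<alpha> \<mu> F_nonneg by (auto simp: norm_mult intro!: mult_mono)
  qed
  have "(LBINT x=0..\<infinity>. g x) = - B_inf f - (- B_val f \<mu>)"
  proof (rule interval_integral_FTC_integrable)
    show "(G has_vector_derivative g x) (at x)" if "0 < ereal x" for x
    proof -
      have x: "p x \<in> rhp" using that by (intro p_rhp) simp
      have dp: "(p has_vector_derivative 2) (at x)"
        unfolding p_def by (auto intro!: derivative_eq_intros)
      have d1: "((f \<circ> p) has_vector_derivative 2 * deriv f (p x)) (at x)"
        using holo open_rhp x by (intro field_vector_diff_chain_at[OF dp] holomorphic_derivI) auto
      have d2: "((deriv f \<circ> p) has_vector_derivative 2 * deriv (deriv f) (p x)) (at x)"
        using holo_deriv open_rhp x by (intro field_vector_diff_chain_at[OF dp] holomorphic_derivI) auto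
      have d0: "((\<lambda>x. 2 * complex_of_real x) has_vector_derivative 2) (at x)"
        by (auto intro!: derivative_eq_intros)
      have "((\<lambda>x. 2 * complex_of_real x * (deriv f \<circ> p) x - (f \<circ> p) x) has_vector_derivative
          (2 * complex_of_real x * (2 * deriv (deriv f) (p x)) + 2 * (deriv f \<circ> p) x) - 2 * deriv f (p x)) (at x)"
        by (intro has_vector_derivative_diff has_vector_derivative_mult d0 d1 d2)
      then show ?thesis by (simp add: G_def g_def o_def mult.assoc)
    qed
    show "isCont g x" if "0 < ereal x" for x
      using cont_g that by (simp add: continuous_on_eq_continuous_at)
    show "set_integrable lborel (einterval 0 \<infinity>) g"
      using g_int by (simp add: einterval_eq zero_ereal_def)
    have flim0: "filterlim p (at \<mu> within rhp) (at_right 0)"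
      unfolding filterlim_at
    proof (rule conjI[rotated])
      show "(p \<longlongrightarrow> \<mu>) (at_right 0)" unfolding p_def by (auto intro!: tendsto_eq_intros)
      show "\<forall>\<^sub>F x in at_right 0. p x \<in> rhp \<and> p x \<noteq> \<mu>"
        using eventually_at_right_less[of 0] by eventually_elim (use p_rhp in \<open>auto simp: p_def\<close>)
    qed
    \<comment> \<open>On the imaginary axis \<open>f'\<close> may blow up, and \<open>F_zero\<close>
      controls the product; for \<open>Re \<mu> > 0\<close> continuity of \<open>f'\<close>
      suffices.\<close>
    have "((\<lambda>\<alpha>. 2 * complex_of_real \<alpha> * deriv f (p \<alpha>)) \<longlongrightarrow> 0) (at_right 0)"
    proof (cases "Re \<mu> = 0")
      case True
      show ?thesis
      proof (rule Lim_null_comparison)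
        show "\<forall>\<^sub>F \<alpha> in at_right 0. cmod (2 * complex_of_real \<alpha> * deriv f (p \<alpha>)) \<le> (2 * \<alpha>) * F (2 * \<alpha>)"
          using eventually_at_right_less[of 0] by eventually_elim (use decay True in auto)
        show "((\<lambda>\<alpha>. (2 * \<alpha>) * F (2 * \<alpha>)) \<longlongrightarrow> 0) (at_right 0)"
          by (rule filterlim_compose[OF F_zero]) real_asymp
      qed
    next
      case False
      then have "\<mu> \<in> rhp" using \<mu> by (simp add: rhp_def)
      then have "isCont (deriv f) \<mu>" using continuous_deriv open_rhp by (simp add: continuous_on_eq_continuous_at)
      then have "((\<lambda>\<alpha>. deriv f (p \<alpha>)) \<longlongrightarrow> deriv f \<mu>) (at_right 0)"
        by (rule isCont_tendsto_compose) (auto simp: p_def intro!: tendsto_eq_intros)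
      then show ?thesis by (auto intro!: tendsto_eq_intros)
    qed
    then have "(G \<longlongrightarrow> 0 - B_val f \<mu>) (at_right 0)"
      unfolding G_def by (intro tendsto_diff filterlim_compose[OF B_val_tendsto[OF \<mu>] flim0])
    then show "((G \<circ> real_of_ereal) \<longlongrightarrow> - B_val f \<mu>) (at_right 0)"
      by (simp add: zero_ereal_def ereal_tendsto_simps)
    have flim1: "filterlim (\<lambda>\<alpha>. 2 * \<alpha> + Re \<mu>) at_top at_top" by real_asymp
    then have flim2: "filterlim p (filtercomap Re at_top) at_top"
      by (simp add: filterlim_filtercomap_iff o_def Re_p)
    have "((\<lambda>\<alpha>. 2 * complex_of_real \<alpha> * deriv f (p \<alpha>)) \<longlongrightarrow> 0) at_top"
    proof (rule Lim_null_comparison)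
      show "\<forall>\<^sub>F \<alpha> in at_top. cmod (2 * complex_of_real \<alpha> * deriv f (p \<alpha>))
          \<le> (2 * \<alpha> + Re \<mu>) * F (2 * \<alpha> + Re \<mu>)"
        using eventually_gt_at_top[of 0] by eventually_elim (rule decay)
      show "((\<lambda>\<alpha>. (2 * \<alpha> + Re \<mu>) * F (2 * \<alpha> + Re \<mu>)) \<longlongrightarrow> 0) at_top"
        by (rule filterlim_compose[OF F_infinity flim1])
    qed
    then have "(G \<longlongrightarrow> 0 - B_inf f) at_top"
      unfolding G_def by (intro tendsto_diff filterlim_compose[OF B_inf_tendsto flim2])
    then show "((G \<circ> real_of_ereal) \<longlongrightarrow> - B_inf f) (at_left \<infinity>)"
      by (simp add: ereal_tendsto_simps)
  qed simp
  then have g_val: "(LINT x:{0<..}|lborel. g x) = B_val f \<mu> - B_inf f"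
    by (simp add: zero_ereal_def interval_integral_to_infinity_eq)
  have "(LINT \<alpha>:{0<..}|lborel. complex_of_real \<alpha> *
      (LINT \<beta>|lborel. (1 / (Complex \<alpha> (- \<beta>) + \<mu>))\<^sup>2 * deriv f (Complex \<alpha> \<beta>)))
    = (LINT \<alpha>:{0<..}|lborel. of_real (- pi / 2) * g \<alpha>)"
    by (intro set_lebesgue_integral_cong)
       (auto simp: resolvent_kernel_integral(2)[OF \<mu>] g_def p_def)
  also have "\<dots> = of_real (- pi / 2) * (B_val f \<mu> - B_inf f)"
    by (simp only: set_integral_mult_right g_val)
  also have "\<dots> = of_real (pi / 2) * (B_inf f - B_val f \<mu>)" by (simp add: field_simps)
  finally show ?thesis .
qed

end

text \<open>Cauchy's estimate for \<open>f (z + h) - f z\<close>, which is at most the integral of \<open>sup |f'|\<close> over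
  the strip, bounds \<open>|f' (z + h) - f' z|\<close>; some \<open>h\<close> makes \<open>f' (z + h)\<close> itself small.\<close>

theorem class_B_majorant:
  assumes "class_B f"
  shows "\<exists>F. B_majorant f F"
proof -
  have holo: "f holomorphic_on rhp" using assms by (simp add: class_B_def)
  define S where "S = (\<lambda>x. SUP y. ennreal (cmod (deriv f (Complex x y))))"
  define H where "H = (\<lambda>x. S x * indicator {0<..} x)"
  have H_fin: "(\<integral>\<^sup>+x. H x \<partial>lborel) < \<infinity>" using assms by (simp add: class_B_def H_def S_def)
  have cont: "continuous_on {0<..} (\<lambda>x. ennreal (cmod (deriv f (Complex x y))))" for y
  proof -
    have "continuous_on {0<..} (\<lambda>x. deriv f (Complex x y))"
      by (rule continuous_on_compose2[OF holomorphic_on_imp_continuous_on[OF holomorphic_deriv[OF holo open_rhp]]])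
         (auto intro!: continuous_intros simp: rhp_def)
    then show ?thesis by (intro continuous_on_ennreal continuous_on_norm)
  qed
  \<comment> \<open>The supremum runs over uncountably many heights; it is measurable because
    superlevel sets of suprema of continuous functions are open.\<close>
  have H_meas: "H \<in> borel_measurable borel"
  proof (rule borel_measurableI_greater)
    fix c :: ennreal
    have "{x \<in> space borel. c < H x}
        = (\<Union>y. {0<..} \<inter> (\<lambda>x. ennreal (cmod (deriv f (Complex x y)))) -` {c<..})"
      by (auto simp: H_def S_def less_SUP_iff indicator_def split: if_splits)
    also have "open \<dots>" by (intro open_UN ballI continuous_open_preimage cont) auto
    finally show "{x \<in> space borel. c < H x} \<in> sets borel" by simp
  qed
  then have H_meas' [measurable]: "H \<in> borel_measurable lborel" by simp
  have S_upper: "ennreal (cmod (deriv f (Complex x y))) \<le> S x" for x y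
    unfolding S_def by (rule SUP_upper) simp
  have S_upper_H: "ennreal (cmod (deriv f (Complex x y))) \<le> H x" if "x > 0" for x y
    using S_upper[of x y] that by (simp add: H_def)
  \<comment> \<open>The window \<open>[x/2, 2x]\<close> contains all horizontal moves below: points
    of the disc of radius \<open>x/2\<close> about \<open>Complex x y\<close>, shifted right by at
    most \<open>x/2\<close>.\<close>
  define I where "I = (\<lambda>x. \<integral>\<^sup>+t. H t * indicator {x/2..2*x} t \<partial>lborel)"
  define J where "J = (\<lambda>x. enn2real (I x))"
  have I_le: "I x \<le> (\<integral>\<^sup>+x. H x \<partial>lborel)" for x
    unfolding I_def by (intro nn_integral_mono) (auto simp: indicator_def)
  have I_J: "I x = ennreal (J x)" for x
    using I_le[of x] H_fin unfolding J_def by (intro ennreal_enn2real[symmetric]) (auto intro: order_le_less_trans)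
  have J0: "0 \<le> J x" for x by (simp add: J_def)
  have incr: "cmod (f (Complex b y) - f (Complex a y)) \<le> J x" if ab: "0 < x" "x / 2 \<le> a" "a \<le> b" "b \<le> 2 * x" for a b x y
  proof -
    have a0: "0 < a" using ab by simp
    note ftc = horizontal_FTC[OF holo a0 ab(3), of y]
    have "ennreal (cmod (f (Complex b y) - f (Complex a y)))
        \<le> (\<integral>\<^sup>+t. norm (indicator {a..b} t *\<^sub>R deriv f (Complex t y)) \<partial>lborel)"
      unfolding ftc(2) set_lebesgue_integral_def
      using ftc(1) by (intro integral_norm_bound_ennreal) (simp add: set_integrable_def)
    also have "\<dots> \<le> I x"
      unfolding I_def using ab a0 S_upper_H by (intro nn_integral_mono) (auto simp: indicator_def)
    finally show ?thesis using J0 by (simp add: I_J)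
  qed
  have key: "cmod (deriv f (Complex x y)) \<le> 4 * J x / x" if x: "x > 0" for x y
  proof (rule field_le_epsilon)
    fix e :: real assume e: "e > 0"
    define \<epsilon> where "\<epsilon> = e * x / 2"
    have \<epsilon>: "\<epsilon> > 0" using e x by (simp add: \<epsilon>_def)
    \<comment> \<open>\<open>c\<close> exceeds the mean of \<open>H\<close> over
      \<open>[x, 3x/2]\<close>, so some shift \<open>h\<close> has
      \<open>H (x + h) \<le> c\<close>.\<close>
    define c where "c = 2 / x * (J x + \<epsilon>)"
    have c0: "0 \<le> c" using x J0[of x] \<epsilon> by (simp add: c_def)
    have "\<exists>h\<in>{0..x/2}. H (x + h) \<le> ennreal c"
    proof (rule ccontr)
      assume "\<not> ?thesis"
      then have big: "ennreal c \<le> H (x + h)" if "h \<in> {0..x/2}" for h using that by (meson linear)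
      have big': "ennreal c \<le> H t" if "t \<in> {x..3*x/2}" for t using big[of "t - x"] that by simp
      have "ennreal (J x + \<epsilon>) = ennreal c * ennreal (x / 2)"
      proof -
        have "c * (x / 2) = J x + \<epsilon>" using x by (simp add: c_def field_simps)
        then show ?thesis using x c0 by (metis ennreal_mult divide_nonneg_nonneg less_imp_le zero_le_numeral)
      qed
      also have "\<dots> = ennreal c * emeasure lborel {x..3*x/2}" using x by simp
      also have "\<dots> = (\<integral>\<^sup>+t. ennreal c * indicator {x..3*x/2} t \<partial>lborel)"
        by (simp add: nn_integral_cmult_indicator)
      also have "\<dots> \<le> I x"
        unfolding I_def using big' x by (intro nn_integral_mono) (auto simp: indicator_def)
      finally show False using J0[of x] \<epsilon> by (simp add: I_J)
    qed
    then obtain h where h: "0 \<le> h" "h \<le> x / 2" "H (x + h) \<le> ennreal c" by auto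
    let ?z = "Complex x y"
    define g where "g = (\<lambda>w. f (w + of_real h) - f w)"
    have g_deriv: "(g has_field_derivative deriv f (w + of_real h) - deriv f w) (at w)" if "Re w > 0" for w
    proof -
      have "(f has_field_derivative deriv f w) (at w)"
        "(f has_field_derivative deriv f (w + of_real h)) (at (w + of_real h))"
        using that h holo open_rhp by (auto intro!: holomorphic_derivI simp: rhp_def)
      then show ?thesis unfolding g_def
        by (intro DERIV_diff) (simp_all add: DERIV_shift)
    qed
    have cball_pos: "Re w \<ge> x / 2 \<and> Re w \<le> 3 * x / 2" if "w \<in> cball ?z (x / 2)" for w
      using abs_Re_le_cmod[of "?z - w"] that by (auto simp: dist_norm)
    have g_holo: "g holomorphic_on {z. Re z > 0}"
      using g_deriv by (auto simp: holomorphic_on_def field_differentiable_def intro: has_field_derivative_at_within)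
    have "norm ((deriv ^^ 1) g ?z) \<le> fact 1 * J x / (x / 2) ^ 1"
    proof (rule Cauchy_inequality)
      have sub: "cball ?z (x / 2) \<subseteq> {z. Re z > 0}" using cball_pos x by fastforce
      then show "continuous_on (cball ?z (x / 2)) g"
        using holomorphic_on_imp_continuous_on[OF g_holo] continuous_on_subset by blast
      show "g holomorphic_on ball ?z (x / 2)"
        by (rule holomorphic_on_subset[OF g_holo order_trans[OF ball_subset_cball sub]])
      show "norm (g w) \<le> J x" if "norm (?z - w) = x / 2" for w
      proof -
        have w: "x / 2 \<le> Re w" "Re w \<le> 3 * x / 2" using cball_pos[of w] that by (auto simp: dist_norm)
        have "w + of_real h = Complex (Re w + h) (Im w)" by (simp add: complex_eq_iff)
        then have "g w = f (Complex (Re w + h) (Im w)) - f (Complex (Re w) (Im w))"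
          by (simp add: g_def)
        moreover have "cmod (f (Complex (Re w + h) (Im w)) - f (Complex (Re w) (Im w))) \<le> J x"
          using w h x by (intro incr) auto
        ultimately show ?thesis by simp
      qed
    qed (use x in auto)
    then have "cmod (deriv g ?z) \<le> 2 * J x / x" using x by (simp add: field_simps)
    moreover have "deriv g ?z = deriv f (?z + of_real h) - deriv f ?z"
      using x by (intro DERIV_imp_deriv g_deriv) simp
    moreover have "cmod (deriv f (?z + of_real h)) \<le> c"
    proof -
      have "?z + of_real h = Complex (x + h) y" by (simp add: complex_eq_iff)
      then have "ennreal (cmod (deriv f (?z + of_real h))) \<le> ennreal c"
        using order_trans[OF S_upper_H h(3)] x h by simp
      then show ?thesis using c0 by (simp add: ennreal_le_iff)
    qed
    ultimately have "cmod (deriv f ?z) \<le> 2 * J x / x + c"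
      using norm_triangle_ineq4[of "deriv f (?z + of_real h)" "deriv g ?z"] by simp
    \<comment> \<open>Half of the constant 4 comes from Cauchy's estimate on the disc, half from the
      mean value \<open>c\<close>.\<close>
    also have "\<dots> = 4 * J x / x + e" using x by (simp add: c_def \<epsilon>_def field_simps)
    finally show "cmod (deriv f ?z) \<le> 4 * J x / x + e" .
  qed
  have S_le: "S x \<le> ennreal (4 * J x / x)" if "x > 0" for x
    unfolding S_def using key[OF that] by (intro SUP_least ennreal_leI) auto
  define F where "F = (\<lambda>x. enn2real (H x))"
  have H_F: "H x = ennreal (F x)" for x
  proof (cases "x > 0")
    case True
    then show ?thesis using S_le[OF True] unfolding F_def H_def
      by (intro ennreal_enn2real[symmetric]) (auto intro: order_le_less_trans simp: ennreal_less_top)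
  qed (simp add: F_def H_def)
  have F0: "0 \<le> F x" for x by (simp add: F_def)
  have F_int: "integrable lborel F"
  proof (rule integrableI_nonneg)
    show "F \<in> borel_measurable lborel" unfolding F_def by measurable
    show "(\<integral>\<^sup>+x. ennreal (F x) \<partial>lborel) < \<infinity>" using H_fin unfolding H_F .
  qed (simp add: F0)
  have xF: "x * F x \<le> 4 * J x" if x: "x > 0" for x
  proof -
    have "ennreal (F x) \<le> ennreal (4 * J x / x)" using S_le[OF x] x H_F[of x] by (simp add: H_def)
    then have "F x \<le> 4 * J x / x" using J0 x by (simp add: ennreal_le_iff)
    then show ?thesis using x by (simp add: field_simps)
  qed
  have J_LINT: "J x = (LINT t:{x/2..2*x}|lborel. F t)" for x
  proof -
    have "integrable lborel (\<lambda>t. indicator {x/2..2*x} t *\<^sub>R F t)"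
      using F_int by (intro integrable_mult_indicator) auto
    moreover have "I x = (\<integral>\<^sup>+t. ennreal (indicator {x/2..2*x} t *\<^sub>R F t) \<partial>lborel)"
      unfolding I_def H_F by (intro nn_integral_cong) (auto simp: indicator_def)
    ultimately have "I x = ennreal (LINT t:{x/2..2*x}|lborel. F t)"
      unfolding set_lebesgue_integral_def using F0 by (simp add: nn_integral_eq_integral)
    then show ?thesis unfolding J_def
      using F0 by (simp add: set_lebesgue_integral_def)
  qed
  \<comment> \<open>As the window runs off to 0 or to infinity it leaves every fixed point; this
    gives both limits of \<open>x * F x\<close>.\<close>
  have J_seq: "(\<lambda>n. 4 * J (X n)) \<longlonglongrightarrow> 0"
    if "\<And>n. X n > 0" "\<And>t. t > 0 \<Longrightarrow> \<forall>\<^sub>F n in sequentially. t \<notin> {X n/2..2*X n}" for X :: "nat \<Rightarrow> real"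
    unfolding J_LINT using that
    by (intro tendsto_mult_right_zero tail_integral_zero[OF F0 F_int]) (auto intro: order.strict_trans2[of 0 "X _ / 2"])
  have F_seq: "(\<lambda>n. X n * F (X n)) \<longlonglongrightarrow> 0"
    if "\<And>n. X n > 0" "\<And>t. t > 0 \<Longrightarrow> \<forall>\<^sub>F n in sequentially. t \<notin> {X n/2..2*X n}" for X :: "nat \<Rightarrow> real"
    by (rule Lim_null_comparison[OF _ J_seq[OF that]])
       (use xF that(1) F0 in \<open>auto intro!: always_eventually simp: abs_of_nonneg less_imp_le\<close>)
  have "B_majorant f F"
  proof
    show "cmod (deriv f (Complex x y)) \<le> F x" if "0 < x" for x y
      using S_upper_H[OF that, of y] F0 by (simp add: H_F)
    show "((\<lambda>x. x * F x) \<longlongrightarrow> 0) (at_right 0)"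
      unfolding tendsto_at_iff_sequentially
    proof (intro allI impI)
      fix X :: "nat \<Rightarrow> real" assume X: "\<forall>i. X i \<in> {0<..} - {0}" "X \<longlonglongrightarrow> 0"
      have "(\<lambda>n. X n * F (X n)) \<longlonglongrightarrow> 0"
      proof (rule F_seq)
        fix t :: real assume t: "t > 0"
        then have "\<forall>\<^sub>F n in sequentially. X n < t / 2" by (intro order_tendstoD(2)[OF X(2)]) simp
        then show "\<forall>\<^sub>F n in sequentially. t \<notin> {X n/2..2*X n}" by eventually_elim auto
      qed (use X in auto)
      then show "((\<lambda>x. x * F x) \<circ> X) \<longlonglongrightarrow> 0" by (simp add: o_def)
    qed
    show "((\<lambda>x. x * F x) \<longlongrightarrow> 0) at_top"
    proof (rule tendsto_at_topI_sequentially)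
      fix X :: "nat \<Rightarrow> real" assume X: "filterlim X at_top sequentially"
      have "(\<lambda>n. max 1 (X n) * F (max 1 (X n))) \<longlonglongrightarrow> 0"
      proof (rule F_seq)
        fix t :: real assume t: "t > 0"
        have "\<forall>\<^sub>F n in sequentially. 2 * t < X n" using X by (simp add: filterlim_at_top_dense)
        then show "\<forall>\<^sub>F n in sequentially. t \<notin> {max 1 (X n)/2..2*max 1 (X n)}" by eventually_elim auto
      qed simp
      moreover have "\<forall>\<^sub>F n in sequentially. 1 < X n" using X by (simp add: filterlim_at_top_dense)
      then have "\<forall>\<^sub>F n in sequentially. max 1 (X n) * F (max 1 (X n)) = X n * F (X n)"
        by eventually_elim simp
      ultimately show "(\<lambda>n. X n * F (X n)) \<longlonglongrightarrow> 0" by (blast intro: Lim_transform_eventually)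
    qed
    show "\<exists>K. \<forall>x>0. x * F x \<le> K"
    proof (intro exI[of _ "4 * enn2real (\<integral>\<^sup>+x. H x \<partial>lborel)"] allI impI)
      fix x :: real assume "x > 0"
      have "J x \<le> enn2real (\<integral>\<^sup>+x. H x \<partial>lborel)"
        unfolding J_def using I_le H_fin by (intro enn2real_mono) auto
      then show "x * F x \<le> 4 * enn2real (\<integral>\<^sup>+x. H x \<partial>lborel)" using xF[OF \<open>x > 0\<close>] by simp
    qed
  qed (use holo F0 F_int in auto)
  then show ?thesis by blast
qed

section \<open>Weak double integrals\<close>

lemma measurable_partial_integral:
  fixes h :: "real \<Rightarrow> real \<Rightarrow> complex"
  assumes h: "continuous_on ({0<..} \<times> UNIV) (\<lambda>(a, b). h a b)" and B: "B \<in> sets borel"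
  shows "(\<lambda>a. indicator {0<..} a *\<^sub>R (LINT b|lborel. indicator B b *\<^sub>R h a b)) \<in> borel_measurable lborel"
proof -
  have "open ({0<..} \<times> UNIV :: (real \<times> real) set)" by (intro open_Times) auto
  then have "(\<lambda>p. indicator ({0<..} \<times> UNIV) p *\<^sub>R (case p of (a, b) \<Rightarrow> h a b)) \<in> borel_measurable (borel :: (real \<times> real) measure)"
    by (intro borel_measurable_continuous_on_indicator h) auto
  then have [measurable]: "(\<lambda>p. indicator ({0<..} \<times> UNIV) p *\<^sub>R (case p of (a, b) \<Rightarrow> h a b)) \<in> borel_measurable (lborel \<Otimes>\<^sub>M lborel)"
    by (simp add: lborel_prod)
  have [measurable]: "(\<lambda>p :: real \<times> real. indicat_real B (snd p)) \<in> borel_measurable (lborel \<Otimes>\<^sub>M lborel)"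
    using B by measurable
  have "(\<lambda>p. indicat_real B (snd p) *\<^sub>R (indicator ({0<..} \<times> UNIV) p *\<^sub>R (case p of (a, b) \<Rightarrow> h a b)))
      \<in> borel_measurable (lborel \<Otimes>\<^sub>M lborel)"
    by measurable
  then have "(\<lambda>a. LINT b|lborel. indicat_real B b *\<^sub>R (indicator ({0<..} \<times> UNIV) (a, b) *\<^sub>R h a b)) \<in> borel_measurable lborel"
    by (intro lborel.borel_measurable_lebesgue_integral) (simp add: case_prod_beta')
  also have "(\<lambda>a. LINT b|lborel. indicat_real B b *\<^sub>R (indicator ({0<..} \<times> UNIV) (a, b) *\<^sub>R h a b))
      = (\<lambda>a. indicator {0<..} a *\<^sub>R (LINT b|lborel. indicator B b *\<^sub>R h a b))"
    by (rule ext) (auto simp: indicator_def)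
  finally show ?thesis .
qed

text \<open>The space need not be separable, so Bochner integrals are not available; Henstock--Kurzweil
  integrals of continuous functions over boxes approximate the weak integral instead.\<close>

lemma weak_double_integral:
  fixes G :: "real \<Rightarrow> real \<Rightarrow> 'a::complex_banach" and F :: "real \<Rightarrow> real"
  assumes cont: "continuous_on ({0<..} \<times> UNIV) (\<lambda>(a, b). G a b)"
    and F: "\<And>x. 0 \<le> F x" "integrable lborel F"
    and decay: "\<And>a b. 0 < a \<Longrightarrow> \<exists>C\<ge>0. \<forall>\<alpha>\<in>{a..b}. \<forall>\<beta>. norm (G \<alpha> \<beta>) \<le> C * F \<alpha> * (1 / (1 + \<beta>\<^sup>2))"
    and K: "0 \<le> K"
    and weak_int: "\<And>\<phi> \<alpha>. dual_elem \<phi> \<Longrightarrow> 0 < \<alpha> \<Longrightarrow> integrable lborel (\<lambda>\<beta>. \<phi> (G \<alpha> \<beta>))"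
    and weak: "\<And>\<phi> \<alpha>. dual_elem \<phi> \<Longrightarrow> 0 < \<alpha> \<Longrightarrow> (LINT \<beta>|lborel. cmod (\<phi> (G \<alpha> \<beta>))) \<le> K * onorm \<phi> * F \<alpha>"
  obtains v where "\<And>\<phi>. dual_elem \<phi> \<Longrightarrow> (LINT \<alpha>:{0<..}|lborel. LINT \<beta>|lborel. \<phi> (G \<alpha> \<beta>)) = \<phi> v"
proof (rule ex_representing_vector[of "\<lambda>\<phi>. LINT \<alpha>:{0<..}|lborel. LINT \<beta>|lborel. \<phi> (G \<alpha> \<beta>)"])
  fix \<delta> :: real assume \<delta>: "\<delta> > 0"
  \<comment> \<open>\<open>X n\<close> is the part of the half-line outside the window over which
    the box integral is taken; there only the weak bound with \<open>K\<close> is available.\<close>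
  define X where "X = (\<lambda>n::nat. {0<..} - {inverse (real (Suc n))..real (Suc n)})"
  have "(\<lambda>n. LINT t:X n|lborel. F t) \<longlonglongrightarrow> 0"
  proof (rule tail_integral_zero[OF F])
    fix t :: real assume t: "0 < t"
    obtain N1 where N1: "inverse (real (Suc N1)) < t" using reals_Archimedean[OF t] by auto
    obtain N2 where N2: "t \<le> real N2" using real_arch_simple by blast
    have "t \<notin> X n" if n: "n \<ge> max N1 N2" for n
    proof -
      have "inverse (real (Suc n)) \<le> inverse (real (Suc N1))" using n by (intro le_imp_inverse_le) auto
      then have "inverse (real (Suc n)) \<le> t" using N1 by linarith
      moreover have "t \<le> real (Suc n)" using N2 n by linarith
      ultimately show ?thesis unfolding X_def by auto
    qed
    then show "\<forall>\<^sub>F n in sequentially. t \<notin> X n" by (rule eventually_sequentiallyI)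
  qed (auto simp: X_def)
  then have "(\<lambda>n. K * (LINT t:X n|lborel. F t)) \<longlonglongrightarrow> 0" by (rule tendsto_mult_right_zero)
  from order_tendstoD(2)[OF this, of "\<delta> / 2"] \<delta> obtain n where n: "K * (LINT t:X n|lborel. F t) < \<delta> / 2"
    by (auto simp: eventually_sequentially)
  define a b where "a = inverse (real (Suc n))" and "b = real (Suc n)"
  have ab: "0 < a" "a \<le> b"
    unfolding a_def b_def using le_imp_inverse_le[of 1 "real (Suc n)"] by auto
  obtain C where C: "0 \<le> C" "\<And>\<alpha> \<beta>. \<alpha> \<in> {a..b} \<Longrightarrow> norm (G \<alpha> \<beta>) \<le> C * F \<alpha> * (1 / (1 + \<beta>\<^sup>2))"
    using decay[OF ab(1), of b] by blast
  define h :: "real \<Rightarrow> real" where "h = (\<lambda>\<beta>. 1 / (1 + \<beta>\<^sup>2))"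
  have h: "integrable lborel h" "h x \<ge> 0" for x
    using Cauchy_kernel_integral[of 1 0] by (auto simp: h_def has_bochner_integral_iff)
  define T where "T = (\<lambda>n. LINT x|lborel. indicator (- {- real n..real n}) x *\<^sub>R h x)"
  have T_eq: "T m = (LINT x|lborel. h x) - integral {- real m..real m} h" for m
  proof -
    have "set_integrable lborel {- real m..real m} h"
      unfolding set_integrable_def using h by (intro integrable_mult_indicator) auto
    note this set_borel_integral_eq_integral(2)[OF this]
    moreover have "T m = (LINT x|lborel. h x - indicator {- real m..real m} x *\<^sub>R h x)"
      unfolding T_def by (intro Bochner_Integration.integral_cong) (auto simp: indicator_def)
    ultimately show ?thesis using h
      by (simp add: set_integrable_def set_lebesgue_integral_def)
  qed
  have "(\<lambda>m. C * integral\<^sup>L lborel F * T m) \<longlonglongrightarrow> C * integral\<^sup>L lborel F * ((LINT x|lborel. h x) - (LINT x|lborel. h x))"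
    unfolding T_eq by (intro tendsto_intros tendsto_symmetric_integral h)
  then have "(\<lambda>m. C * integral\<^sup>L lborel F * T m) \<longlonglongrightarrow> 0" by simp
  from order_tendstoD(2)[OF this, of "\<delta> / 2"] \<delta> obtain m where m: "C * integral\<^sup>L lborel F * T m < \<delta> / 2"
    by (auto simp: eventually_sequentially)
  \<comment> \<open>The constant \<open>C\<close> depends on the window, so the height
    \<open>N\<close> of the box is chosen after \<open>n\<close>.\<close>
  define N where "N = real m"
  have T0: "T m \<ge> 0" unfolding T_def using h by (intro integral_nonneg_AE) (auto simp: indicator_def)
  define v where "v = integral (cbox (a, - N) (b, N)) (\<lambda>(\<alpha>, \<beta>). G \<alpha> \<beta>)"
  show "\<exists>v. \<forall>\<phi>. dual_elem \<phi> \<longrightarrow> cmod ((LINT \<alpha>:{0<..}|lborel. LINT \<beta>|lborel. \<phi> (G \<alpha> \<beta>)) - \<phi> v) \<le> \<delta> * onorm \<phi>"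
  proof (intro exI[of _ v] allI impI)
    fix \<phi> :: "'a \<Rightarrow> complex" assume \<phi>: "dual_elem \<phi>"
    note \<phi>D = dual_elemD[OF \<phi>]
    define I J where "I = (\<lambda>\<alpha>. LINT \<beta>|lborel. \<phi> (G \<alpha> \<beta>))"
      and "J = (\<lambda>\<alpha>. LINT \<beta>|lborel. indicator {- N..N} \<beta> *\<^sub>R \<phi> (G \<alpha> \<beta>))"
    have cont\<phi>: "continuous_on ({0<..} \<times> UNIV) (\<lambda>(\<alpha>, \<beta>). \<phi> (G \<alpha> \<beta>))"
      using bounded_linear.continuous_on[OF \<phi>D(1) cont] by (simp add: case_prod_beta')
    have box: "cbox (a, - N) (b, N) \<subseteq> {0<..} \<times> UNIV" using ab by (auto simp: cbox_Pair_eq)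
    have I_int: "integrable lborel (\<lambda>\<beta>. cmod (\<phi> (G \<alpha> \<beta>)))" if "0 < \<alpha>" for \<alpha>
      using weak_int[OF \<phi> that] by simp
    have cut_int: "integrable lborel (\<lambda>\<beta>. indicator B \<beta> *\<^sub>R \<phi> (G \<alpha> \<beta>))" if "0 < \<alpha>" "B \<in> sets borel" for \<alpha> B
      using weak_int[OF \<phi> that(1)] that(2) by (intro integrable_mult_indicator) auto
    have cut_le: "cmod (LINT \<beta>|lborel. indicator B \<beta> *\<^sub>R \<phi> (G \<alpha> \<beta>)) \<le> K * onorm \<phi> * F \<alpha>"
      if "0 < \<alpha>" "B \<in> sets borel" for \<alpha> B
    proof -
      have "cmod (LINT \<beta>|lborel. indicator B \<beta> *\<^sub>R \<phi> (G \<alpha> \<beta>))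
          \<le> (LINT \<beta>|lborel. cmod (indicator B \<beta> *\<^sub>R \<phi> (G \<alpha> \<beta>)))"
        by (rule integral_norm_bound)
      also have "\<dots> \<le> (LINT \<beta>|lborel. cmod (\<phi> (G \<alpha> \<beta>)))"
        using integrable_norm[OF cut_int[OF that]] I_int[OF that(1)] by (intro integral_mono) (auto simp: indicator_def)
      also have "\<dots> \<le> K * onorm \<phi> * F \<alpha>" by (rule weak[OF \<phi> that(1)])
      finally show ?thesis .
    qed
    have meas: "(\<lambda>\<alpha>. indicator {0<..} \<alpha> *\<^sub>R I \<alpha>) \<in> borel_measurable lborel"
      using measurable_partial_integral[OF cont\<phi>, of UNIV] by (simp add: I_def)
    have "(\<lambda>\<alpha>. indicator {0<..} \<alpha> *\<^sub>R J \<alpha>) \<in> borel_measurable lborel"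
      using measurable_partial_integral[OF cont\<phi>, of "{- N..N}"] by (simp add: J_def)
    moreover have "indicat_real {a..b} \<in> borel_measurable lborel" by simp
    ultimately have "(\<lambda>\<alpha>. indicator {a..b} \<alpha> *\<^sub>R (indicator {0<..} \<alpha> *\<^sub>R J \<alpha>)) \<in> borel_measurable lborel"
      by (rule borel_measurable_scaleR[rotated])
    also have "(\<lambda>\<alpha>. indicator {a..b} \<alpha> *\<^sub>R (indicator {0<..} \<alpha> *\<^sub>R J \<alpha>)) = (\<lambda>\<alpha>. indicator {a..b} \<alpha> *\<^sub>R J \<alpha>)"
      using ab by (auto simp: indicator_def fun_eq_iff)
    finally have measJ: "(\<lambda>\<alpha>. indicator {a..b} \<alpha> *\<^sub>R J \<alpha>) \<in> borel_measurable lborel" .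
    have FK: "integrable lborel (\<lambda>\<alpha>. K * onorm \<phi> * F \<alpha>)" using F by simp
    have nn: "0 \<le> K * onorm \<phi> * F \<alpha>" for \<alpha> using K \<phi>D(8) F by simp
    have I_le: "cmod (I \<alpha>) \<le> K * onorm \<phi> * F \<alpha>" if "0 < \<alpha>" for \<alpha>
      using cut_le[OF that, of UNIV] by (simp add: I_def)
    have J_le: "cmod (J \<alpha>) \<le> K * onorm \<phi> * F \<alpha>" if "0 < \<alpha>" for \<alpha>
      using cut_le[OF that, of "{- N..N}"] by (simp add: J_def)
    have int_I: "integrable lborel (\<lambda>\<alpha>. indicator {0<..} \<alpha> *\<^sub>R I \<alpha>)"
      using I_le nn by (intro Bochner_Integration.integrable_bound[OF FK meas] AE_I2) (auto simp: indicator_def)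
    have int_J: "integrable lborel (\<lambda>\<alpha>. indicator {a..b} \<alpha> *\<^sub>R J \<alpha>)"
      using J_le nn ab by (intro Bochner_Integration.integrable_bound[OF FK measJ] AE_I2) (auto simp: indicator_def)
    have "\<phi> v = integral (cbox (a, - N) (b, N)) (\<phi> \<circ> (\<lambda>(\<alpha>, \<beta>). G \<alpha> \<beta>))"
      unfolding v_def
      by (intro integral_linear[symmetric] integrable_continuous continuous_on_subset[OF cont box] \<phi>D(1))
    also have "\<phi> \<circ> (\<lambda>(\<alpha>, \<beta>). G \<alpha> \<beta>) = (\<lambda>(\<alpha>, \<beta>). \<phi> (G \<alpha> \<beta>))" by (simp add: fun_eq_iff)
    also have "integral (cbox (a, - N) (b, N)) (\<lambda>(\<alpha>, \<beta>). \<phi> (G \<alpha> \<beta>))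
        = integral (cbox a b) (\<lambda>\<alpha>. integral (cbox (- N) N) (\<lambda>\<beta>. \<phi> (G \<alpha> \<beta>)))"
      using integral_prod_continuous[OF continuous_on_subset[OF cont\<phi> box]] by simp
    also have "\<dots> = integral (cbox a b) J"
    proof (rule Henstock_Kurzweil_Integration.integral_cong)
      fix \<alpha> assume "\<alpha> \<in> cbox a b"
      then have "0 < \<alpha>" using ab by simp
      then have "set_integrable lborel {- N..N} (\<lambda>\<beta>. \<phi> (G \<alpha> \<beta>))"
        using cut_int unfolding set_integrable_def by simp
      from set_borel_integral_eq_integral(2)[OF this]
      show "integral (cbox (- N) N) (\<lambda>\<beta>. \<phi> (G \<alpha> \<beta>)) = J \<alpha>"
        by (simp add: J_def set_lebesgue_integral_def)
    qed
    also have "\<dots> = (LINT \<alpha>|lborel. indicator {a..b} \<alpha> *\<^sub>R J \<alpha>)"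
      using set_borel_integral_eq_integral(2)[of "{a..b}" J] int_J
      by (simp add: set_integrable_def set_lebesgue_integral_def)
    finally have \<phi>v: "\<phi> v = (LINT \<alpha>|lborel. indicator {a..b} \<alpha> *\<^sub>R J \<alpha>)" .
    \<comment> \<open>Outside the window the whole inner integral is lost, at cost
      \<open>K * F\<close>; inside it only the part with \<open>|\<beta>| > N\<close>, at cost
      \<open>C * T m * F\<close>.\<close>
    define W where "W = (\<lambda>\<alpha>. onorm \<phi> * (K * (indicator (X n) \<alpha> *\<^sub>R F \<alpha>) + C * T m * F \<alpha>))"
    have FX: "integrable lborel (\<lambda>\<alpha>. indicator (X n) \<alpha> *\<^sub>R F \<alpha>)"
      by (rule integrable_mult_indicator) (use F in \<open>auto simp: X_def\<close>)
    have W_int: "integrable lborel W" unfolding W_def using FX F by simp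
    have diff: "cmod (I \<alpha> - J \<alpha>) \<le> onorm \<phi> * (C * T m * F \<alpha>)" if \<alpha>: "\<alpha> \<in> {a..b}" for \<alpha>
    proof -
      have \<alpha>0: "0 < \<alpha>" using \<alpha> ab by simp
      have "I \<alpha> - J \<alpha> = (LINT \<beta>|lborel. \<phi> (G \<alpha> \<beta>) - indicator {- N..N} \<beta> *\<^sub>R \<phi> (G \<alpha> \<beta>))"
        unfolding I_def J_def
        by (intro Bochner_Integration.integral_diff[symmetric] weak_int[OF \<phi> \<alpha>0] cut_int[OF \<alpha>0]) simp
      also have "\<dots> = (LINT \<beta>|lborel. indicator (- {- N..N}) \<beta> *\<^sub>R \<phi> (G \<alpha> \<beta>))"
        by (intro Bochner_Integration.integral_cong) (auto simp: indicator_def)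
      also have "cmod \<dots> \<le> (LINT \<beta>|lborel. cmod (indicator (- {- N..N}) \<beta> *\<^sub>R \<phi> (G \<alpha> \<beta>)))"
        by (rule integral_norm_bound)
      also have "\<dots> \<le> (LINT \<beta>|lborel. (onorm \<phi> * C * F \<alpha>) * (indicator (- {- N..N}) \<beta> *\<^sub>R h \<beta>))"
      proof (rule integral_mono)
        show "integrable lborel (\<lambda>\<beta>. cmod (indicator (- {- N..N}) \<beta> *\<^sub>R \<phi> (G \<alpha> \<beta>)))"
          by (intro integrable_norm cut_int[OF \<alpha>0]) auto
        show "integrable lborel (\<lambda>\<beta>. (onorm \<phi> * C * F \<alpha>) * (indicator (- {- N..N}) \<beta> *\<^sub>R h \<beta>))"
          by (intro integrable_mult_right integrable_mult_indicator h) auto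
        fix \<beta>
        have "cmod (\<phi> (G \<alpha> \<beta>)) \<le> onorm \<phi> * norm (G \<alpha> \<beta>)" by (rule \<phi>D(7))
        also have "\<dots> \<le> onorm \<phi> * (C * F \<alpha> * (1 / (1 + \<beta>\<^sup>2)))" by (intro mult_left_mono C \<alpha> \<phi>D(8))
        finally show "cmod (indicator (- {- N..N}) \<beta> *\<^sub>R \<phi> (G \<alpha> \<beta>))
            \<le> (onorm \<phi> * C * F \<alpha>) * (indicator (- {- N..N}) \<beta> *\<^sub>R h \<beta>)"
          by (auto simp: indicator_def h_def mult_ac)
      qed
      also have "\<dots> = (onorm \<phi> * C * F \<alpha>) * T m" unfolding T_def N_def by simp
      finally show ?thesis by (simp add: mult_ac)
    qed
    have "(LINT \<alpha>:{0<..}|lborel. LINT \<beta>|lborel. \<phi> (G \<alpha> \<beta>)) - \<phi> v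
        = (LINT \<alpha>|lborel. indicator {0<..} \<alpha> *\<^sub>R I \<alpha> - indicator {a..b} \<alpha> *\<^sub>R J \<alpha>)"
      unfolding \<phi>v set_lebesgue_integral_def I_def[symmetric]
      by (rule Bochner_Integration.integral_diff[symmetric, OF int_I int_J])
    also have "cmod \<dots> \<le> (LINT \<alpha>|lborel. cmod (indicator {0<..} \<alpha> *\<^sub>R I \<alpha> - indicator {a..b} \<alpha> *\<^sub>R J \<alpha>))"
      by (rule integral_norm_bound)
    also have "\<dots> \<le> (LINT \<alpha>|lborel. W \<alpha>)"
    proof (rule integral_mono[OF _ W_int])
      show "integrable lborel (\<lambda>\<alpha>. cmod (indicator {0<..} \<alpha> *\<^sub>R I \<alpha> - indicator {a..b} \<alpha> *\<^sub>R J \<alpha>))"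
        using int_I int_J by simp
      fix \<alpha>
      have CT: "0 \<le> onorm \<phi> * (C * T m * F \<alpha>)" using \<phi>D(8) C(1) T0 F by simp
      consider "\<alpha> \<le> 0" | "\<alpha> \<in> {a..b}" | "0 < \<alpha>" "\<alpha> \<notin> {a..b}" by force
      then show "cmod (indicator {0<..} \<alpha> *\<^sub>R I \<alpha> - indicator {a..b} \<alpha> *\<^sub>R J \<alpha>) \<le> W \<alpha>"
      proof cases
        case 1
        then show ?thesis using ab CT by (auto simp: W_def X_def indicator_def)
      next
        case 2
        then have "0 < \<alpha>" using ab by simp
        moreover have "\<alpha> \<notin> X n" using 2 by (simp add: X_def a_def b_def)
        ultimately show ?thesis using 2 diff[OF 2] by (simp add: W_def)
      next
        case 3
        then have "\<alpha> \<in> X n" by (auto simp: X_def a_def b_def)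
        then show ?thesis using 3 I_le[OF 3(1)] CT by (simp add: W_def algebra_simps)
      qed
    qed
    also have "\<dots> = onorm \<phi> * (K * (LINT t:X n|lborel. F t) + C * T m * integral\<^sup>L lborel F)"
      unfolding W_def set_lebesgue_integral_def using FX F by simp
    also have "\<dots> \<le> onorm \<phi> * \<delta>"
      using n m by (intro mult_left_mono \<phi>D(8)) (simp add: mult_ac)
    finally show "cmod ((LINT \<alpha>:{0<..}|lborel. LINT \<beta>|lborel. \<phi> (G \<alpha> \<beta>)) - \<phi> v) \<le> \<delta> * onorm \<phi>"
      by (simp add: mult.commute)
  qed
qed (rule that, blast)

section \<open>Resolvents\<close>

lemma bounded_inverse_unique:
  assumes "bounded_inverse_of D B R" "bounded_inverse_of D B R'"
  shows "R = R'"
  using assms unfolding bounded_inverse_of_def by (intro ext) metis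

locale half_plane_operator =
  fixes D :: "'a::complex_banach set" and A :: "'a \<Rightarrow> 'a"
  assumes dd: "densely_defined D A" and spec: "op_spectrum D A \<subseteq> {z. 0 \<le> Re z}"
begin

lemma lin: "0 \<in> D \<and> (\<forall>x\<in>D. \<forall>y\<in>D. x + y \<in> D \<and> A (x + y) = A x + A y)
     \<and> (\<forall>c. \<forall>x\<in>D. scaleC c x \<in> D \<and> A (scaleC c x) = scaleC c (A x))"
  and dense: "closure D = UNIV"
  using dd[unfolded densely_defined_def lin_op_def] by (rule conjunct1, rule conjunct2)

lemmas A_add = lin[THEN conjunct2, THEN conjunct1, rule_format]
lemmas A_scale = lin[THEN conjunct2, THEN conjunct2, rule_format]

lemma A_diff: "x \<in> D \<Longrightarrow> y \<in> D \<Longrightarrow> x - y \<in> D \<and> A (x - y) = A x - A y"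
proof -
  assume x: "x \<in> D" and y: "y \<in> D"
  have m: "scaleC (- 1) y = - y" "scaleC (- 1) (A y) = - A y" by (simp_all add: scaleC_minus_left)
  have y': "- y \<in> D" "A (- y) = - A y" using A_scale[OF y, of "- 1"] by (simp_all only: m)
  from A_add[OF x y'(1)] y'(2) show ?thesis by (simp only: diff_conv_add_uminus)
qed

lemma shifted_inv:
  assumes "0 < Re w"
  shows "bounded_inverse_of D (\<lambda>x. scaleC w x + A x) (shifted_inv D A w)"
proof -
  have "- w \<notin> op_spectrum D A" using spec assms by auto
  then obtain Q where Q: "bounded_inverse_of D (\<lambda>x. scaleC (- w) x - A x) Q"
    by (auto simp: op_spectrum_def)
  have Qb: "cbounded_op Q" and Q1: "Q y \<in> D" "scaleC (- w) (Q y) - A (Q y) = y"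
    and Q2: "x \<in> D \<Longrightarrow> Q (scaleC (- w) x - A x) = x" for x y
    using Q by (auto simp: bounded_inverse_of_def)
  have inv: "bounded_inverse_of D (\<lambda>x. scaleC w x + A x) (\<lambda>x. - Q x)"
    unfolding bounded_inverse_of_def
  proof (intro conjI allI ballI)
    show "cbounded_op (\<lambda>x. - Q x)"
      using Qb bounded_linear_minus[of Q] by (auto simp: cbounded_op_def scaleC_minus_right)
    show "- Q y \<in> D" for y using A_scale[OF Q1(1), of "- 1" y] by (simp add: scaleC_minus_left)
    show "scaleC w (- Q y) + A (- Q y) = y" for y
      using A_scale[OF Q1(1), of "- 1" y] Q1(2)[of y] by (simp add: scaleC_minus_left scaleC_minus_right)
    show "- Q (scaleC w x + A x) = x" if "x \<in> D" for x
    proof -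
      have "- Q (scaleC w x + A x) = Q (scaleC (- w) x - A x)"
        by (simp add: cbounded_opD(6)[OF Qb, symmetric] scaleC_minus_left)
      then show ?thesis using Q2[OF that] by simp
    qed
  qed
  show ?thesis
    unfolding shifted_inv_def using inv bounded_inverse_unique[OF _ inv]
    by (rule theI[where P = "bounded_inverse_of D (\<lambda>x. scaleC w x + A x)"])
qed

text \<open>The inverse of \<open>w + A\<close>, not of \<open>w - A\<close>, as a bounded operator;
  it is known to have this meaning for \<open>0 < Re w\<close>.\<close>

definition R :: "complex \<Rightarrow> 'a \<Rightarrow>\<^sub>L 'a" where "R w = Blinfun (shifted_inv D A w)"

context
  fixes w :: complex
  assumes w: "0 < Re w"
begin

lemma R_apply: "blinfun_apply (R w) = shifted_inv D A w"
  using shifted_inv[OF w]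
  by (simp add: R_def bounded_inverse_of_def cbounded_op_def bounded_linear_Blinfun_apply)

lemma R_scaleC: "R w (scaleC c x) = scaleC c (R w x)"
  and R_dom: "R w x \<in> D"
  and R_right: "scaleC w (R w x) + A (R w x) = x"
  and R_left: "x \<in> D \<Longrightarrow> R w (scaleC w x + A x) = x"
  using shifted_inv[OF w] by (auto simp: R_apply bounded_inverse_of_def cbounded_op_def)

lemma A_R: "A (R w x) = x - scaleC w (R w x)"
  using R_right[of x] by (simp add: algebra_simps)

lemma R_A: "x \<in> D \<Longrightarrow> R w (A x) = x - scaleC w (R w x)"
  using R_left[of x] by (simp add: blinfun.add_right R_scaleC algebra_simps)

end

lemma shifted_inv2_R: "0 < Re w \<Longrightarrow> shifted_inv2 D A w x = R w (R w x)"
  by (simp add: shifted_inv2_def R_apply)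

lemma resolvent_identity:
  assumes "0 < Re w" "0 < Re v"
  shows "R w x - R v x = scaleC (v - w) (R w (R v x))"
proof -
  have "R w (scaleC w (R v x) + A (R v x)) = R v x" by (intro R_left R_dom assms)
  also have "scaleC w (R v x) + A (R v x) = x - scaleC (v - w) (R v x)"
    by (simp add: A_R[OF assms(2)] scaleC_diff_left)
  finally show ?thesis by (simp add: blinfun.diff_right R_scaleC[OF assms(1)] algebra_simps)
qed

text \<open>The domain is the range of \<open>R 1\<close>, so \<open>T\<close> maps it to itself and
  commutes with \<open>A\<close> there; hence commuting with one resolvent is commuting with
  all.\<close>

lemma R_commutant:
  assumes w: "0 < Re w" and T: "T \<in> commutant (R 1)"
  shows "T (R w x) = R w (T x)"
proof -
  have one: "0 < Re 1" by simp
  define z where "z = R w x"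
  have zD: "z \<in> D" unfolding z_def by (rule R_dom[OF w])
  define y where "y = z + A z"
  have z_eq: "z = R 1 y" using R_left[OF one zD] by (simp add: y_def)
  have Tz: "T z = R 1 (T y)" unfolding z_eq by (rule commutantD(2)[OF T])
  have "T x = T (scaleC w z + A z)" unfolding z_def by (simp add: R_right[OF w])
  also have "scaleC w z + A z = scaleC (w - 1) z + y" by (simp add: y_def scaleC_diff_left)
  also have "T (scaleC (w - 1) z + y) = scaleC (w - 1) (T z) + T y"
    by (simp add: blinfun.add_right commutantD(1)[OF T])
  also have "\<dots> = scaleC w (T z) + A (T z)"
    unfolding Tz A_R[OF one] by (simp add: scaleC_diff_left)
  finally have "R w (T x) = T z" using R_left[OF w, of "T z"] R_dom[OF one] Tz by simp
  then show ?thesis by (simp add: z_def)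
qed

lemma R_in_commutant: "0 < Re w \<Longrightarrow> R w \<in> commutant (R 1)"
proof -
  assume w: "0 < Re w"
  have "R 1 \<in> commutant (R 1)" by (simp add: commutant_def R_scaleC)
  from R_commutant[OF w this] show ?thesis using R_scaleC[OF w] by (simp add: commutant_def)
qed

lemma R_commute: "0 < Re w \<Longrightarrow> 0 < Re v \<Longrightarrow> R w (R v x) = R v (R w x)"
  using R_commutant[of v "R w"] R_in_commutant by blast

lemma norm_R_diff_le:
  assumes "0 < Re w" "0 < Re v"
  shows "norm (R w - R v) \<le> cmod (v - w) * (norm (R w) * norm (R v))"
proof -
  have "R w - R v = scaleC (v - w) (R w \<odot> R v)"
    by (rule blinfun_eqI) (simp add: blinfun_rep resolvent_identity[OF assms])
  then show ?thesis using norm_blinfun_compose[of "R w" "R v"] by (simp add: norm_scaleC mult_left_mono)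
qed

text \<open>The resolvent identity bounds \<open>norm (R w - R v)\<close> by a multiple of
  \<open>norm (R w)\<close>; once the factor is at most 1/2 it can be absorbed, giving
  \<open>norm (R w) \<le> 2 * M\<close> near \<open>v\<close>.\<close>

lemma R_continuous: "continuous_on rhp R"
  unfolding continuous_on_def
proof
  fix v assume v: "v \<in> rhp"
  define M where "M = norm (R v)"
  define r where "r = 1 / (2 * (M + 1))"
  have M: "M \<ge> 0" by (simp add: M_def)
  have r: "r > 0" using M by (simp add: r_def)
  have bound: "norm (R w - R v) \<le> cmod (v - w) * (2 * M * M)" if w: "w \<in> rhp" "dist w v < r" for w
  proof -
    have wv: "0 < Re w" "0 < Re v" using v w by (auto simp: rhp_def)
    have "cmod (v - w) * M \<le> r * (M + 1)"
      using w M r by (intro mult_mono) (auto simp: dist_norm norm_minus_commute)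
    also have "\<dots> = 1 / 2" using M by (simp add: r_def field_simps)
    finally have half: "cmod (v - w) * M \<le> 1 / 2" .
    have "norm (R w) \<le> norm (R w - R v) + M" unfolding M_def using norm_triangle_sub[of "R w" "R v"] by simp
    also have "norm (R w - R v) \<le> (cmod (v - w) * M) * norm (R w)"
      using norm_R_diff_le[OF wv] by (simp add: M_def mult_ac)
    also have "\<dots> \<le> 1 / 2 * norm (R w)" using half by (intro mult_right_mono) auto
    finally have "norm (R w) \<le> 2 * M" by simp
    then have "norm (R w) * norm (R v) \<le> 2 * M * M" by (intro mult_mono) (auto simp: M_def)
    then show ?thesis using norm_R_diff_le[OF wv] by (meson mult_left_mono norm_ge_zero order_trans)
  qed
  show "(R \<longlongrightarrow> R v) (at v within rhp)"
  proof (rule LIM_zero_cancel, rule Lim_null_comparison)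
    show "\<forall>\<^sub>F w in at v within rhp. norm (R w - R v) \<le> cmod (v - w) * (2 * M * M)"
      unfolding eventually_at using r bound by blast
    show "((\<lambda>w. cmod (v - w) * (2 * M * M)) \<longlongrightarrow> 0) (at v within rhp)"
      by (auto intro!: tendsto_eq_intros)
  qed
qed

lemma R_apply_continuous:
  assumes "continuous_on S p" "\<And>t. t \<in> S \<Longrightarrow> 0 < Re (p t)" "continuous_on S g"
  shows "continuous_on S (\<lambda>t. R (p t) (g t))"
proof (rule bounded_bilinear.continuous_on[OF bounded_bilinear_blinfun_apply _ assms(3)])
  show "continuous_on S (\<lambda>t. R (p t))"
    using assms by (intro continuous_on_compose2[OF R_continuous assms(1)]) (auto simp: rhp_def)
qed

text \<open>The hypothesis concerns squares of resolvents; since \<open>R' = - R^2\<close>, they are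
  derivatives along vertical lines up to a factor, which is how bounds on \<open>R\<close> itself
  arise.\<close>

lemma R_vector_derivative:
  assumes \<phi>: "dual_elem \<phi>" and \<alpha>: "0 < \<alpha>"
  shows "((\<lambda>t. \<phi> (R (Complex \<alpha> t) x)) has_vector_derivative - \<i> * \<phi> (R (Complex \<alpha> t) (R (Complex \<alpha> t) x))) (at t within S)"
proof -
  define z where "z = Complex \<alpha> t"
  have z: "0 < Re z" using \<alpha> by (simp add: z_def)
  have "((\<lambda>w. \<phi> (R w x)) has_field_derivative - \<phi> (R z (R z x))) (at z within rhp)"
    unfolding has_field_derivative_iff
  proof (rule Lim_transform_eventually)
    have "continuous_on rhp (\<lambda>w. R w (R z x))"
      by (rule R_apply_continuous) (simp_all add: rhp_def continuous_on_id)
    moreover have "z \<in> rhp" using z by (simp add: rhp_def)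
    ultimately have "((\<lambda>w. R w (R z x)) \<longlongrightarrow> R z (R z x)) (at z within rhp)"
      unfolding continuous_on_def by (rule bspec)
    then show "((\<lambda>w. - \<phi> (R w (R z x))) \<longlongrightarrow> - \<phi> (R z (R z x))) (at z within rhp)"
      by (intro tendsto_minus bounded_linear.tendsto[OF dual_elemD(1)[OF \<phi>]])
    show "\<forall>\<^sub>F w in at z within rhp. - \<phi> (R w (R z x)) = (\<phi> (R w x) - \<phi> (R z x)) / (w - z)"
      unfolding eventually_at
    proof (intro exI[of _ 1] conjI ballI impI)
      fix w assume w: "w \<in> rhp" "w \<noteq> z \<and> dist w z < 1"
      have "\<phi> (R w x) - \<phi> (R z x) = \<phi> (scaleC (z - w) (R w (R z x)))"
        using w z by (simp add: dual_elemD(4)[OF \<phi>, symmetric] resolvent_identity rhp_def)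
      then show "- \<phi> (R w (R z x)) = (\<phi> (R w x) - \<phi> (R z x)) / (w - z)"
        using w by (simp add: dual_elemD[OF \<phi>] field_simps)
    qed simp
  qed
  then have "((\<lambda>w. \<phi> (R w x)) has_field_derivative - \<phi> (R z (R z x))) (at z)"
    using open_rhp z at_within_open[of z rhp] by (simp add: rhp_def)
  then have "(((\<lambda>w. \<phi> (R w x)) \<circ> (\<lambda>t. Complex \<alpha> t)) has_vector_derivative \<i> * (- \<phi> (R z (R z x)))) (at t)"
    unfolding z_def by (rule field_vector_diff_chain_at[rotated]) (auto simp: Complex_eq intro!: derivative_eq_intros)
  then show ?thesis by (simp add: o_def z_def has_vector_derivative_at_within)
qed

end

section \<open>Uniform resolvent estimates\<close>

lemma slice_integrable:
  fixes h :: "real \<Rightarrow> real \<Rightarrow> complex" and F :: "real \<Rightarrow> real"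
  assumes h: "continuous_on ({0<..} \<times> UNIV) (\<lambda>(a, b). h a b)" and F: "\<And>x. 0 \<le> F x" "integrable lborel F"
    and C: "0 \<le> C" and le: "\<And>a. 0 < a \<Longrightarrow> (LINT b|lborel. cmod (h a b)) \<le> C * F a"
  shows "set_integrable lborel {0<..} (\<lambda>a. LINT b|lborel. h a b)"
    "0 < a \<Longrightarrow> cmod (LINT b|lborel. h a b) \<le> C * F a"
proof -
  show bound: "cmod (LINT b|lborel. h a b) \<le> C * F a" if "0 < a" for a
    using le[OF that] integral_norm_bound[of lborel "h a"] by linarith
  have CF: "integrable lborel (\<lambda>a. C * F a)" using F by simp
  have "(\<lambda>a. indicator {0<..} a *\<^sub>R (LINT b|lborel. h a b)) \<in> borel_measurable lborel"
    using measurable_partial_integral[OF h, of UNIV] by simp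
  then show "set_integrable lborel {0<..} (\<lambda>a. LINT b|lborel. h a b)"
    unfolding set_integrable_def using bound F C
    by (intro Bochner_Integration.integrable_bound[OF CF] AE_I2) (auto simp: indicator_def)
qed

text \<open>The calculus uses the resolvent at \<open>\<alpha> - i\<beta>\<close>, the hypothesis at
  \<open>\<alpha> + i\<beta>\<close>.\<close>

lemma reflect_integral:
  fixes g :: "real \<Rightarrow> 'b::{banach, second_countable_topology}"
  shows "integrable lborel g \<Longrightarrow> integrable lborel (\<lambda>b. g (- b))"
    "(LINT b|lborel. g (- b)) = (LINT b|lborel. g b)"
  using lborel_integrable_real_affine[of g "- 1" 0] lborel_integral_real_affine[of "- 1" g 0] by simp_all

text \<open>Complex functionals are given by the predicate \<open>dual_elem\<close>, not by a type,
  so uniform boundedness in the functional is applied on the Banach space of real functionals;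
  \<open>complexify\<close> restores the complex one.\<close>

lemma bounded_linear_complexify:
  "bounded_linear (\<lambda>\<psi> :: 'a::complex_banach \<Rightarrow>\<^sub>L real. complexify (blinfun_apply \<psi>) y)"
proof -
  have "complexify (blinfun_apply \<psi>) y = of_real (\<psi> y) - \<i> * of_real (\<psi> (scaleC \<i> y))" for \<psi> :: "'a \<Rightarrow>\<^sub>L real"
    by (simp add: complexify_def complex_eq_iff)
  moreover have "bounded_linear (\<lambda>\<psi> :: 'a \<Rightarrow>\<^sub>L real. complex_of_real (\<psi> y) - \<i> * of_real (\<psi> (scaleC \<i> y)))"
    by (intro bounded_linear_sub bounded_linear_const_mult bounded_linear_compose[OF bounded_linear_of_real]
        blinfun.bounded_linear_left)
  ultimately show ?thesis by simp
qed

context half_plane_operator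
begin

lemma R2_continuous:
  assumes "dual_elem \<phi>" "0 < \<alpha>"
  shows "continuous_on UNIV (\<lambda>\<beta>. \<phi> (R (Complex \<alpha> \<beta>) (R (Complex \<alpha> \<beta>) x)))"
  using assms(2)
  by (intro bounded_linear.continuous_on[OF dual_elemD(1)[OF assms(1)]] R_apply_continuous continuous_on_const)
     (auto intro!: continuous_intros)

lemma R2_measurable:
  assumes "dual_elem \<phi>" "0 < \<alpha>"
  shows "(\<lambda>\<beta>. \<phi> (R (Complex \<alpha> \<beta>) (R (Complex \<alpha> \<beta>) x))) \<in> borel_measurable lborel"
  using borel_measurable_continuous_onI[OF R2_continuous[OF assms]] by simp

lemma bounded_linear_R2: "bounded_linear (\<lambda>x. R w (R w x))"
  by (intro bounded_linear_compose[OF blinfun.bounded_linear_right] blinfun.bounded_linear_right)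

text \<open>Uniform boundedness, first in the vector and then in the functional.\<close>

lemma uniform_resolvent_bound:
  assumes bnd: "\<And>x \<phi>. dual_elem \<phi> \<Longrightarrow> \<exists>C. \<forall>\<alpha>>0.
      integrable lborel (\<lambda>\<beta>. cmod (\<phi> (shifted_inv2 D A (Complex \<alpha> \<beta>) x))) \<and>
      \<alpha> * (LINT \<beta>|lborel. cmod (\<phi> (shifted_inv2 D A (Complex \<alpha> \<beta>) x))) \<le> C"
  shows "\<exists>\<gamma>\<ge>0. \<forall>\<phi> x. \<forall>\<alpha>>0. dual_elem \<phi> \<longrightarrow>
      integrable lborel (\<lambda>\<beta>. \<phi> (R (Complex \<alpha> \<beta>) (R (Complex \<alpha> \<beta>) x))) \<and>
      \<alpha> * (LINT \<beta>|lborel. cmod (\<phi> (R (Complex \<alpha> \<beta>) (R (Complex \<alpha> \<beta>) x)))) \<le> \<gamma> * onorm \<phi> * norm x"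
proof -
  define q where "q = (\<lambda>\<alpha> \<beta> x. R (Complex \<alpha> \<beta>) (R (Complex \<alpha> \<beta>) x))"
  have q_lin: "bounded_linear (q \<alpha> \<beta>)" for \<alpha> \<beta> unfolding q_def by (rule bounded_linear_R2)
  have q_meas: "(\<lambda>\<beta>. complex_of_real \<alpha> * \<phi> (q \<alpha> \<beta> x)) \<in> borel_measurable lborel"
    if "dual_elem \<phi>" "0 < \<alpha>" for \<alpha> x and \<phi> :: "'a \<Rightarrow> complex"
    using R2_measurable[OF that, of x] unfolding q_def by simp
  have dual\<psi>: "dual_elem (complexify (blinfun_apply \<psi>))" for \<psi> :: "'a \<Rightarrow>\<^sub>L real"
    by (rule complexify_dual[OF blinfun.bounded_linear_right])
  have first: "\<exists>C\<ge>0. \<forall>\<alpha>>0. \<forall>x. (\<integral>\<^sup>+\<beta>. cmod (complex_of_real \<alpha> * \<phi> (q \<alpha> \<beta> x)) \<partial>lborel) \<le> ennreal (C * norm x)"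
    if \<phi>: "dual_elem \<phi>" for \<phi> :: "'a \<Rightarrow> complex"
  proof -
    obtain C where C: "0 \<le> C" "\<And>\<alpha> x. \<alpha> \<in> {0<..} \<Longrightarrow>
        (\<integral>\<^sup>+\<beta>. cmod (complex_of_real \<alpha> * \<phi> (q \<alpha> \<beta> x)) \<partial>lborel) \<le> ennreal (C * norm x)"
    proof (rule uniform_boundedness_L1[of "{0<..}" "\<lambda>\<alpha> \<beta> x. complex_of_real \<alpha> * \<phi> (q \<alpha> \<beta> x)"])
      show "bounded_linear (\<lambda>x. complex_of_real \<alpha> * \<phi> (q \<alpha> \<beta> x))" for \<alpha> \<beta>
        by (intro bounded_linear_const_mult bounded_linear_compose[OF dual_elemD(1)[OF \<phi>] q_lin])
      show "(\<lambda>\<beta>. complex_of_real \<alpha> * \<phi> (q \<alpha> \<beta> x)) \<in> borel_measurable lborel" if "\<alpha> \<in> {0<..}" for \<alpha> x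
        using q_meas[OF \<phi>] that by simp
      fix x
      from bnd[OF \<phi>, of x] obtain C where C: "\<And>\<alpha>. \<alpha> > 0 \<Longrightarrow>
          integrable lborel (\<lambda>\<beta>. cmod (\<phi> (q \<alpha> \<beta> x))) \<and> \<alpha> * (LINT \<beta>|lborel. cmod (\<phi> (q \<alpha> \<beta> x))) \<le> C"
        unfolding q_def by (auto simp: shifted_inv2_R)
      show "\<exists>C. \<forall>\<alpha>\<in>{0<..}. (\<integral>\<^sup>+\<beta>. cmod (complex_of_real \<alpha> * \<phi> (q \<alpha> \<beta> x)) \<partial>lborel) \<le> ennreal C"
      proof (intro exI[of _ C] ballI)
        fix \<alpha> :: real assume "\<alpha> \<in> {0<..}"
        then have \<alpha>: "\<alpha> > 0" by simp
        have "(\<integral>\<^sup>+\<beta>. ennreal (cmod (complex_of_real \<alpha> * \<phi> (q \<alpha> \<beta> x))) \<partial>lborel)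
            = (\<integral>\<^sup>+\<beta>. ennreal (\<alpha> * cmod (\<phi> (q \<alpha> \<beta> x))) \<partial>lborel)"
          using \<alpha> by (simp add: norm_mult)
        also have "\<dots> = ennreal (LINT \<beta>|lborel. \<alpha> * cmod (\<phi> (q \<alpha> \<beta> x)))"
          using C[OF \<alpha>] \<alpha> by (intro nn_integral_eq_integral) auto
        also have "\<dots> \<le> ennreal C" using C[OF \<alpha>] by (intro ennreal_leI) simp
        finally show "(\<integral>\<^sup>+\<beta>. cmod (complex_of_real \<alpha> * \<phi> (q \<alpha> \<beta> x)) \<partial>lborel) \<le> ennreal C" .
      qed
    qed blast
    then show ?thesis by (intro exI[of _ C]) auto
  qed
  \<comment> \<open>The index is now a pair of \<alpha> and a vector of norm at most 1, and the
    variable is the functional.\<close>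
  obtain C where C: "0 \<le> C" "\<And>p (\<psi> :: 'a \<Rightarrow>\<^sub>L real). p \<in> {p. 0 < fst p \<and> norm (snd p) \<le> 1} \<Longrightarrow>
      (\<integral>\<^sup>+\<beta>. cmod (complex_of_real (fst p) * complexify (blinfun_apply \<psi>) (q (fst p) \<beta> (snd p))) \<partial>lborel)
        \<le> ennreal (C * norm \<psi>)"
  proof (rule uniform_boundedness_L1[of "{p. 0 < fst p \<and> norm (snd p) \<le> 1}"
      "\<lambda>p \<beta> \<psi>. complex_of_real (fst p) * complexify (blinfun_apply \<psi>) (q (fst p) \<beta> (snd p))"])
    show "bounded_linear (\<lambda>\<psi> :: 'a \<Rightarrow>\<^sub>L real. complex_of_real (fst p) * complexify (blinfun_apply \<psi>) (q (fst p) \<beta> (snd p)))"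
      for p :: "real \<times> 'a" and \<beta>
      by (intro bounded_linear_const_mult bounded_linear_complexify)
    show "(\<lambda>\<beta>. complex_of_real (fst p) * complexify (blinfun_apply \<psi>) (q (fst p) \<beta> (snd p))) \<in> borel_measurable lborel"
      if "p \<in> {p. 0 < fst p \<and> norm (snd p) \<le> 1}" for p :: "real \<times> 'a" and \<psi> :: "'a \<Rightarrow>\<^sub>L real"
      using q_meas[OF dual\<psi>] that by simp
    fix \<psi> :: "'a \<Rightarrow>\<^sub>L real"
    obtain C where C: "0 \<le> C" "\<And>\<alpha> x. \<alpha> > 0 \<Longrightarrow> (\<integral>\<^sup>+\<beta>. cmod (complex_of_real \<alpha> * complexify (blinfun_apply \<psi>) (q \<alpha> \<beta> x)) \<partial>lborel)
        \<le> ennreal (C * norm x)"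
      using first[OF dual\<psi>] by blast
    show "\<exists>C. \<forall>p\<in>{p. 0 < fst p \<and> norm (snd p) \<le> 1}.
      (\<integral>\<^sup>+\<beta>. cmod (complex_of_real (fst p) * complexify (blinfun_apply \<psi>) (q (fst p) \<beta> (snd p))) \<partial>lborel) \<le> ennreal C"
    proof (intro exI[of _ C] ballI)
      fix p :: "real \<times> 'a" assume p: "p \<in> {p. 0 < fst p \<and> norm (snd p) \<le> 1}"
      have "C * norm (snd p) \<le> C" using p C(1) by (simp add: mult_left_le)
      then show "(\<integral>\<^sup>+\<beta>. cmod (complex_of_real (fst p) * complexify (blinfun_apply \<psi>) (q (fst p) \<beta> (snd p))) \<partial>lborel) \<le> ennreal C"
        using C(2)[of "fst p" "snd p"] p by (auto intro: order_trans ennreal_leI)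
    qed
  qed blast
  show ?thesis
  proof (intro exI[of _ C] conjI C(1) allI impI)
    fix \<phi> :: "'a \<Rightarrow> complex" and x :: 'a and \<alpha> :: real assume \<alpha>: "0 < \<alpha>" and \<phi>: "dual_elem \<phi>"
    note \<phi>D = dual_elemD[OF \<phi>]
    have Re_bl: "bounded_linear (\<lambda>x. Re (\<phi> x))"
      by (rule bounded_linear_compose[OF bounded_linear_Re \<phi>D(1)])
    define \<psi> where "\<psi> = Blinfun (\<lambda>x. Re (\<phi> x))"
    have \<psi>: "blinfun_apply \<psi> = (\<lambda>x. Re (\<phi> x))"
      unfolding \<psi>_def by (rule bounded_linear_Blinfun_apply[OF Re_bl])
    have n\<psi>: "norm \<psi> \<le> onorm \<phi>"
      using \<phi>D(7,8) abs_Re_le_cmod by (intro norm_blinfun_bound) (auto simp: \<psi> intro: order_trans)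
    have unit: "(\<integral>\<^sup>+\<beta>. cmod (complex_of_real \<alpha> * \<phi> (q \<alpha> \<beta> u)) \<partial>lborel) \<le> ennreal (C * onorm \<phi>)" if "norm u \<le> 1" for u
    proof -
      have "(\<integral>\<^sup>+\<beta>. cmod (complex_of_real \<alpha> * \<phi> (q \<alpha> \<beta> u)) \<partial>lborel) \<le> ennreal (C * norm \<psi>)"
        using C(2)[of "(\<alpha>, u)" \<psi>] that \<alpha> complexify_Re[OF \<phi>] by (simp add: \<psi>)
      also have "\<dots> \<le> ennreal (C * onorm \<phi>)" by (intro ennreal_leI mult_left_mono n\<psi> C(1))
      finally show ?thesis .
    qed
    have int_unit: "integrable lborel (\<lambda>\<beta>. complex_of_real \<alpha> * \<phi> (q \<alpha> \<beta> u)) \<and>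
        (LINT \<beta>|lborel. cmod (complex_of_real \<alpha> * \<phi> (q \<alpha> \<beta> u))) \<le> C * onorm \<phi>" if "norm u \<le> 1" for u
    proof
      show int: "integrable lborel (\<lambda>\<beta>. complex_of_real \<alpha> * \<phi> (q \<alpha> \<beta> u))"
        using unit[OF that] by (intro integrableI_bounded q_meas \<phi> \<alpha>) (auto intro: order_le_less_trans)
      have "ennreal (LINT \<beta>|lborel. cmod (complex_of_real \<alpha> * \<phi> (q \<alpha> \<beta> u))) \<le> ennreal (C * onorm \<phi>)"
        using unit[OF that] nn_integral_eq_integral[OF integrable_norm[OF int]] by simp
      then show "(LINT \<beta>|lborel. cmod (complex_of_real \<alpha> * \<phi> (q \<alpha> \<beta> u))) \<le> C * onorm \<phi>"
        using C(1) \<phi>D(8) by (simp add: ennreal_le_iff)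
    qed
    define u where "u = (if x = 0 then 0 else (1 / norm x) *\<^sub>R x)"
    have u: "norm u \<le> 1" by (simp add: u_def)
    have "x = norm x *\<^sub>R u" by (simp add: u_def)
    then have "\<phi> (q \<alpha> \<beta> x) = norm x *\<^sub>R \<phi> (q \<alpha> \<beta> u)" for \<beta>
      using linear_scale[OF bounded_linear.linear[OF bounded_linear_compose[OF \<phi>D(1) q_lin]], of \<alpha> \<beta> "norm x" u] by simp
    then have eq: "\<phi> (q \<alpha> \<beta> x) = of_real (norm x / \<alpha>) * (complex_of_real \<alpha> * \<phi> (q \<alpha> \<beta> u))" for \<beta>
      using \<alpha> by (simp add: scaleR_conv_of_real)
    have "integrable lborel (\<lambda>\<beta>. \<phi> (q \<alpha> \<beta> x))"
      unfolding eq by (rule integrable_mult_right) (use int_unit[OF u] in blast)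
    moreover have "\<alpha> * (LINT \<beta>|lborel. cmod (\<phi> (q \<alpha> \<beta> x)))
        = norm x * (LINT \<beta>|lborel. cmod (complex_of_real \<alpha> * \<phi> (q \<alpha> \<beta> u)))"
      unfolding eq norm_mult[of "of_real (norm x / \<alpha>)"] using \<alpha> by (simp add: norm_divide)
    moreover have "\<dots> \<le> norm x * (C * onorm \<phi>)" using int_unit[OF u] by (intro mult_left_mono) auto
    ultimately show "integrable lborel (\<lambda>\<beta>. \<phi> (R (Complex \<alpha> \<beta>) (R (Complex \<alpha> \<beta>) x)))"
      "\<alpha> * (LINT \<beta>|lborel. cmod (\<phi> (R (Complex \<alpha> \<beta>) (R (Complex \<alpha> \<beta>) x)))) \<le> C * onorm \<phi> * norm x"
      by (simp_all add: q_def mult_ac)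
  qed
qed

text \<open>Density of the domain is used twice: for \<open>x\<close> itself and, after writing
  \<open>d = R 1 (d + A d)\<close>, for \<open>d + A d\<close>. The range in question is the domain
  of the square of \<open>A\<close>.\<close>

lemma range_R1_squared_dense:
  assumes e: "e > 0"
  shows "\<exists>y. norm (x - R 1 (R 1 y)) < e"
proof -
  have one: "0 < Re 1" by simp
  have R1_D: "R 1 (d + A d) = d" if "d \<in> D" for d using R_left[OF one that] by simp
  have approx: "\<exists>d\<in>D. norm (z - d) < r" if "r > 0" for z r
  proof -
    have "z \<in> closure D" using dense by simp
    then have "\<exists>d\<in>D. dist d z < r" unfolding closure_approachable using that by blast
    then show ?thesis by (auto simp: dist_norm norm_minus_commute)
  qed
  obtain d where d: "d \<in> D" "norm (x - d) < e / 2" using approx[of "e / 2"] e by auto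
  define M where "M = norm (R 1) + 1"
  have M: "M > 0" by (simp add: M_def add_nonneg_pos)
  obtain d' where d': "d' \<in> D" "norm (d + A d - d') < e / (2 * M)" using approx[of "e / (2 * M)"] e M by auto
  have "norm (d - R 1 d') = norm (R 1 (d + A d - d'))" by (simp add: blinfun.diff_right R1_D[OF d(1)])
  also have "\<dots> \<le> norm (R 1) * norm (d + A d - d')" by (rule norm_blinfun)
  also have "\<dots> \<le> M * (e / (2 * M))" using d' M by (intro mult_mono) (auto simp: M_def)
  finally have "norm (d - R 1 d') \<le> e / 2" using M by simp
  then have "norm (x - R 1 d') < e"
    using d(2) norm_triangle_ineq[of "x - d" "d - R 1 d'"] by simp
  then show ?thesis using R1_D[OF d'(1)] by metis
qed

end

text \<open>The Gomilko-Shi-Feng condition with one constant for all vectors and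
  functionals.\<close>

locale GSF_operator = half_plane_operator +
  fixes \<gamma> :: real
  assumes \<gamma>_nonneg: "0 \<le> \<gamma>"
    and R2_integrable: "\<And>\<phi> x \<alpha>. 0 < \<alpha> \<Longrightarrow> dual_elem \<phi> \<Longrightarrow>
      integrable lborel (\<lambda>\<beta>. \<phi> (R (Complex \<alpha> \<beta>) (R (Complex \<alpha> \<beta>) x)))"
    and R2_bound: "\<And>\<phi> x \<alpha>. 0 < \<alpha> \<Longrightarrow> dual_elem \<phi> \<Longrightarrow>
      \<alpha> * (LINT \<beta>|lborel. cmod (\<phi> (R (Complex \<alpha> \<beta>) (R (Complex \<alpha> \<beta>) x)))) \<le> \<gamma> * onorm \<phi> * norm x"
begin

text \<open>On the domain \<open>R w x\<close> vanishes as \<open>Im w \<rightarrow> \<infinity>\<close>, hence is the integral of its derivative.\<close>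

lemma norm_R_le:
  assumes w: "0 < Re w"
  shows "norm (R w x) \<le> \<gamma> / Re w * norm x"
proof -
  define \<alpha> b where "\<alpha> = Re w" and "b = Im w"
  have \<alpha>: "0 < \<alpha>" using w by (simp add: \<alpha>_def)
  have w_eq: "w = Complex \<alpha> b" by (simp add: \<alpha>_def b_def)
  have incr: "cmod (\<phi> (R (Complex \<alpha> t) x) - \<phi> (R (Complex \<alpha> b) x)) \<le> \<gamma> * onorm \<phi> * norm x / \<alpha>"
    if \<phi>: "dual_elem \<phi>" and t: "b \<le> t" for \<phi> x t
  proof -
    let ?g = "\<lambda>t. - \<i> * \<phi> (R (Complex \<alpha> t) (R (Complex \<alpha> t) x))"
    have int: "integrable lborel ?g" using R2_integrable[OF \<alpha> \<phi>] by simp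
    then have sint: "set_integrable lborel {b..t} ?g"
      unfolding set_integrable_def by (intro integrable_mult_indicator) auto
    have "(?g has_integral (\<phi> (R (Complex \<alpha> t) x) - \<phi> (R (Complex \<alpha> b) x))) {b..t}"
      by (rule fundamental_theorem_of_calculus[OF t]) (rule R_vector_derivative[OF \<phi> \<alpha>])
    then have "\<phi> (R (Complex \<alpha> t) x) - \<phi> (R (Complex \<alpha> b) x) = integral {b..t} ?g"
      by (rule integral_unique[symmetric])
    also have "\<dots> = (LINT s|lborel. indicator {b..t} s *\<^sub>R ?g s)"
      using set_borel_integral_eq_integral(2)[OF sint] unfolding set_lebesgue_integral_def by (rule sym)
    also have "cmod \<dots> \<le> (LINT s|lborel. cmod (indicator {b..t} s *\<^sub>R ?g s))" by (rule integral_norm_bound)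
    also have "\<dots> \<le> (LINT s|lborel. cmod (?g s))"
      using integrable_norm[OF sint[unfolded set_integrable_def]] integrable_norm[OF int]
      by (intro integral_mono) (auto simp: indicator_def)
    also have "\<dots> \<le> \<gamma> * onorm \<phi> * norm x / \<alpha>"
      using R2_bound[OF \<alpha> \<phi>, of x] \<alpha> by (simp add: norm_mult field_simps)
    finally show ?thesis .
  qed
  have on_D: "norm (R w x) \<le> \<gamma> / \<alpha> * norm x" if x: "x \<in> D" for x
  proof (rule norm_le_dual)
    fix \<phi> :: "'a \<Rightarrow> complex" assume \<phi>: "dual_elem \<phi>" "onorm \<phi> \<le> 1"
    note \<phi>D = dual_elemD[OF \<phi>(1)]
    \<comment> \<open>From \<open>w R(w) x = x - R(w) A x\<close> and the boundedness of
      \<open>R(w) A x\<close> along the line, tested against \<phi>, the value at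
      \<open>R(w) x\<close> is at most \<open>P / t\<close> at height \<open>t\<close>. This is
      where \<open>x \<in> D\<close> enters.\<close>
    define P where "P = cmod (\<phi> x) + (cmod (\<phi> (R (Complex \<alpha> b) (A x))) + \<gamma> * onorm \<phi> * norm (A x) / \<alpha>)"
    have "cmod (\<phi> (R w x)) \<le> \<gamma> * onorm \<phi> * norm x / \<alpha> + P * inverse (real (Suc n))" if n: "b \<le> real n" for n
    proof -
      let ?t = "real (Suc n)"
      have bt: "b \<le> ?t" using n by simp
      have z: "0 < Re (Complex \<alpha> ?t)" using \<alpha> by simp
      have "Complex \<alpha> ?t * \<phi> (R (Complex \<alpha> ?t) x) = \<phi> x - \<phi> (R (Complex \<alpha> ?t) (A x))"
        unfolding R_A[OF z x] \<phi>D(2) \<phi>D(4) by simp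
      then have "cmod (Complex \<alpha> ?t) * cmod (\<phi> (R (Complex \<alpha> ?t) x)) \<le> P"
        unfolding P_def norm_mult[symmetric]
        using norm_triangle_ineq4[of "\<phi> x" "\<phi> (R (Complex \<alpha> ?t) (A x))"] incr[OF \<phi>(1) bt, of "A x"]
          norm_triangle_sub[of "\<phi> (R (Complex \<alpha> ?t) (A x))" "\<phi> (R (Complex \<alpha> b) (A x))"] by simp
      moreover have "?t \<le> cmod (Complex \<alpha> ?t)" using abs_Im_le_cmod[of "Complex \<alpha> ?t"] by simp
      ultimately have "?t * cmod (\<phi> (R (Complex \<alpha> ?t) x)) \<le> P"
        by (meson mult_right_mono norm_ge_zero order_trans)
      then have "cmod (\<phi> (R (Complex \<alpha> ?t) x)) \<le> P * inverse ?t"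
        by (simp add: field_simps)
      then show ?thesis
        using incr[OF \<phi>(1) bt, of x] norm_triangle_sub[of "\<phi> (R (Complex \<alpha> b) x)" "\<phi> (R (Complex \<alpha> ?t) x)"]
        unfolding w_eq by (simp add: norm_minus_commute)
    qed
    then have "\<exists>N. \<forall>n\<ge>N. cmod (\<phi> (R w x)) \<le> \<gamma> * onorm \<phi> * norm x / \<alpha> + P * inverse (real (Suc n))"
      by (meson real_arch_simple of_nat_le_iff order_trans)
    moreover have "(\<lambda>n. \<gamma> * onorm \<phi> * norm x / \<alpha> + P * inverse (real (Suc n))) \<longlonglongrightarrow> \<gamma> * onorm \<phi> * norm x / \<alpha> + P * 0"
      by (intro tendsto_intros LIMSEQ_inverse_real_of_nat)
    ultimately have "cmod (\<phi> (R w x)) \<le> \<gamma> * onorm \<phi> * norm x / \<alpha> + P * 0"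
      by (intro LIMSEQ_le_const)
    also have "\<dots> = onorm \<phi> * (\<gamma> / \<alpha> * norm x)" by simp
    also have "\<dots> \<le> 1 * (\<gamma> / \<alpha> * norm x)" using \<phi>(2) \<gamma>_nonneg \<alpha> by (intro mult_right_mono) auto
    finally show "cmod (\<phi> (R w x)) \<le> \<gamma> / \<alpha> * norm x" by simp
  qed
  have "closed {x. norm (R w x) \<le> \<gamma> / \<alpha> * norm x}"
    by (intro closed_Collect_le continuous_intros)
  then have "closure D \<subseteq> {x. norm (R w x) \<le> \<gamma> / \<alpha> * norm x}"
    using on_D by (intro closure_minimal) auto
  then show ?thesis using dense by (auto simp: \<alpha>_def)
qed

text \<open>Two applications of \<open>w R(w) z = z - R(w) A z\<close> bound
  \<open>w^2 R(w)^2 x\<close> when both \<open>x\<close> and \<open>A x\<close> are in the domain;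
  starting from the range of the squared resolvent guarantees that.\<close>

lemma R2_decay:
  assumes a: "0 < a"
  shows "\<exists>C\<ge>0. \<forall>w. a \<le> Re w \<longrightarrow> norm (R w (R w (R 1 (R 1 y)))) * (cmod w)\<^sup>2 \<le> C"
proof -
  have one: "0 < Re 1" by simp
  define x where "x = R 1 (R 1 y)"
  have xD: "x \<in> D" unfolding x_def by (rule R_dom[OF one])
  have "A x = R 1 (y - R 1 y)" unfolding x_def by (simp add: A_R[OF one] blinfun.diff_right)
  then have AxD: "A x \<in> D" using R_dom[OF one] by simp
  define g where "g = \<gamma> / a"
  have g: "0 \<le> g" using \<gamma>_nonneg a by (simp add: g_def)
  have norm_R: "norm (R w z) \<le> g * norm z" if "a \<le> Re w" for w z
  proof -
    have "norm (R w z) \<le> \<gamma> / Re w * norm z" using that a by (intro norm_R_le) simp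
    also have "\<dots> \<le> g * norm z"
      unfolding g_def using that a \<gamma>_nonneg by (intro mult_right_mono divide_left_mono) auto
    finally show ?thesis .
  qed
  have step: "norm (scaleC w (R w z)) \<le> norm z + g * norm (A z)" if w: "a \<le> Re w" and z: "z \<in> D" for w z
  proof -
    have "scaleC w (R w z) = z - R w (A z)" using R_A[of w z] w a z by simp
    then show ?thesis using norm_triangle_ineq4[of z "R w (A z)"] norm_R[OF w, of "A z"] by simp
  qed
  define C where "C = (norm x + g * norm (A x)) + g * (norm (A x) + g * norm (A (A x)))"
  show ?thesis
  proof (intro exI[of _ C] conjI allI impI)
    show "0 \<le> C" using g by (simp add: C_def)
    fix w assume w: "a \<le> Re w"
    have w0: "0 < Re w" using w a by simp
    have "scaleC (w * w) (R w (R w x)) = scaleC w (R w (scaleC w (R w x)))"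
      by (simp add: R_scaleC[OF w0] scaleC_scaleC)
    also have "scaleC w (R w x) = x - R w (A x)" using R_A[OF w0 xD] by simp
    also have "scaleC w (R w (x - R w (A x))) = scaleC w (R w x) - R w (scaleC w (R w (A x)))"
      by (simp add: blinfun.diff_right R_scaleC[OF w0] scaleC_diff_right)
    finally have "norm (scaleC (w * w) (R w (R w x))) \<le> norm (scaleC w (R w x)) + norm (R w (scaleC w (R w (A x))))"
      using norm_triangle_ineq4 by metis
    also have "\<dots> \<le> C"
      unfolding C_def using step[OF w xD] norm_R[OF w, of "scaleC w (R w (A x))"] mult_left_mono[OF step[OF w AxD] g]
      by (intro add_mono) auto
    finally show "norm (R w (R w (R 1 (R 1 y)))) * (cmod w)\<^sup>2 \<le> C"
      by (simp add: norm_scaleC norm_mult x_def power2_eq_square mult_ac)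
  qed
qed

end

section \<open>The functional calculus\<close>

text \<open>Away from the imaginary axis \<open>\<alpha>^2 + \<beta>^2\<close> may be replaced by
  \<open>1 + \<beta>^2\<close>, at the price of the factor \<open>1 + 1 / a^2\<close>; the resulting
  majorant no longer depends on \<alpha>.\<close>

lemma kernel_decay:
  fixes a \<alpha> \<beta> N C :: real
  assumes a: "0 < a" "a \<le> \<alpha>" and N: "N * (\<alpha>\<^sup>2 + \<beta>\<^sup>2) \<le> C" "0 \<le> N"
  shows "N \<le> C * (1 + 1 / a\<^sup>2) * (1 / (1 + \<beta>\<^sup>2))"
proof -
  have a2: "a\<^sup>2 \<le> \<alpha>\<^sup>2" using a by (intro power_mono) auto
  have "1 + \<beta>\<^sup>2 \<le> (1 + 1 / a\<^sup>2) * (\<alpha>\<^sup>2 + \<beta>\<^sup>2)"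
  proof -
    have "1 \<le> \<alpha>\<^sup>2 / a\<^sup>2" using a2 a by (simp add: divide_simps)
    moreover have "(1 + 1 / a\<^sup>2) * (\<alpha>\<^sup>2 + \<beta>\<^sup>2) = \<alpha>\<^sup>2 / a\<^sup>2 + \<beta>\<^sup>2 + (\<alpha>\<^sup>2 + \<beta>\<^sup>2 / a\<^sup>2)"
      by (simp add: algebra_simps add_divide_distrib)
    ultimately show ?thesis by (smt (verit) zero_le_divide_iff zero_le_power2)
  qed
  then have "N * (1 + \<beta>\<^sup>2) \<le> N * ((1 + 1 / a\<^sup>2) * (\<alpha>\<^sup>2 + \<beta>\<^sup>2))" by (rule mult_left_mono[OF _ N(2)])
  also have "\<dots> = (N * (\<alpha>\<^sup>2 + \<beta>\<^sup>2)) * (1 + 1 / a\<^sup>2)" by (simp add: mult_ac)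
  also have "\<dots> \<le> C * (1 + 1 / a\<^sup>2)" by (intro mult_right_mono N(1)) (simp add: add_nonneg_nonneg)
  finally have le: "N * (1 + \<beta>\<^sup>2) \<le> C * (1 + 1 / a\<^sup>2)" .
  have "0 < 1 + \<beta>\<^sup>2" by (simp add: add_pos_nonneg)
  with le show ?thesis by (simp add: field_simps)
qed

locale B_calculus = GSF_operator D A \<gamma> + B_majorant f F
  for D :: "'a::complex_banach set" and A \<gamma> f F
begin

definition G :: "'a \<Rightarrow> real \<Rightarrow> real \<Rightarrow> 'a" where
  "G x \<alpha> \<beta> = scaleC (of_real \<alpha> * deriv f (Complex \<alpha> \<beta>)) (R (Complex \<alpha> (- \<beta>)) (R (Complex \<alpha> (- \<beta>)) x))"

text \<open>\<open>\<Lambda> x\<close> is a functional on functionals, an element of the bidual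
  until it is shown to be evaluation at a vector.\<close>

definition \<Lambda> :: "'a \<Rightarrow> ('a \<Rightarrow> complex) \<Rightarrow> complex" where
  "\<Lambda> x \<phi> = (LINT \<alpha>:{0<..}|lborel. LINT \<beta>|lborel. \<phi> (G x \<alpha> \<beta>))"

lemma coeff_continuous: "continuous_on ({0<..} \<times> UNIV) (\<lambda>(\<alpha>, \<beta>). complex_of_real \<alpha> * deriv f (Complex \<alpha> \<beta>))"
proof -
  have "continuous_on ({0<..} \<times> UNIV) (\<lambda>p. deriv f (Complex (fst p) (snd p)))"
    by (rule continuous_on_compose2[OF continuous_deriv]) (auto intro!: continuous_intros simp: rhp_def)
  then show ?thesis by (auto simp: case_prod_beta' intro!: continuous_intros)
qed

lemma R_kernel_continuous: "continuous_on ({0<..} \<times> UNIV) (\<lambda>p. R (Complex (fst p) (- snd p)))"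
  by (rule continuous_on_compose2[OF R_continuous]) (auto intro!: continuous_intros simp: rhp_def)

lemma G_continuous: "continuous_on ({0<..} \<times> UNIV) (\<lambda>(\<alpha>, \<beta>). G x \<alpha> \<beta>)"
proof -
  note ap = bounded_bilinear.continuous_on[OF bounded_bilinear_blinfun_apply R_kernel_continuous]
  have "continuous_on ({0<..} \<times> UNIV) (\<lambda>p. R (Complex (fst p) (- snd p)) (R (Complex (fst p) (- snd p)) x))"
    by (intro ap continuous_on_const)
  from continuous_on_scaleC[OF coeff_continuous[unfolded case_prod_beta'] this]
  show ?thesis by (simp add: G_def case_prod_beta')
qed

lemma dual_G_continuous:
  assumes "dual_elem \<phi>"
  shows "continuous_on ({0<..} \<times> UNIV) (\<lambda>(\<alpha>, \<beta>). \<phi> (G x \<alpha> \<beta>))"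
  using bounded_linear.continuous_on[OF dual_elemD(1)[OF assms] G_continuous[of x]] by (simp add: case_prod_beta')

lemma dual_G: "dual_elem \<phi> \<Longrightarrow> \<phi> (G x \<alpha> \<beta>)
    = of_real \<alpha> * (\<phi> (R (Complex \<alpha> (- \<beta>)) (R (Complex \<alpha> (- \<beta>)) x)) * deriv f (Complex \<alpha> \<beta>))"
  by (simp add: G_def dual_elemD mult_ac)

lemma reflected_R2:
  assumes "dual_elem \<phi>" "0 < \<alpha>"
  shows "integrable lborel (\<lambda>\<beta>. \<phi> (R (Complex \<alpha> (- \<beta>)) (R (Complex \<alpha> (- \<beta>)) x)))"
    "\<alpha> * (LINT \<beta>|lborel. cmod (\<phi> (R (Complex \<alpha> (- \<beta>)) (R (Complex \<alpha> (- \<beta>)) x)))) \<le> \<gamma> * onorm \<phi> * norm x"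
  using reflect_integral(1)[OF R2_integrable[OF assms(2,1), of x]] R2_bound[OF assms(2,1), of x]
    reflect_integral(2)[of "\<lambda>\<beta>. cmod (\<phi> (R (Complex \<alpha> \<beta>) (R (Complex \<alpha> \<beta>) x)))"] by simp_all

lemma dual_G_bound:
  assumes \<phi>: "dual_elem \<phi>" and \<alpha>: "0 < \<alpha>"
  shows "integrable lborel (\<lambda>\<beta>. \<phi> (G x \<alpha> \<beta>))"
    "(LINT \<beta>|lborel. cmod (\<phi> (G x \<alpha> \<beta>))) \<le> \<gamma> * norm x * onorm \<phi> * F \<alpha>"
proof -
  let ?q = "\<lambda>\<beta>. \<phi> (R (Complex \<alpha> (- \<beta>)) (R (Complex \<alpha> (- \<beta>)) x))"
  have le: "cmod (\<phi> (G x \<alpha> \<beta>)) \<le> \<alpha> * F \<alpha> * cmod (?q \<beta>)" for \<beta>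
  proof -
    have "cmod (?q \<beta>) * cmod (deriv f (Complex \<alpha> \<beta>)) \<le> cmod (?q \<beta>) * F \<alpha>"
      by (intro mult_left_mono F_bound \<alpha>) auto
    from mult_left_mono[OF this, of \<alpha>] \<alpha> show ?thesis by (simp add: dual_G[OF \<phi>] norm_mult mult_ac)
  qed
  have q_int: "integrable lborel (\<lambda>\<beta>. \<alpha> * F \<alpha> * cmod (?q \<beta>))"
    using reflected_R2(1)[OF \<phi> \<alpha>, of x] by simp
  have "(\<lambda>\<beta>. \<phi> (G x \<alpha> \<beta>)) \<in> borel_measurable borel"
  proof (rule borel_measurable_continuous_onI)
    have "continuous_on UNIV (\<lambda>\<beta>. (\<lambda>(\<alpha>, \<beta>). \<phi> (G x \<alpha> \<beta>)) (\<alpha>, \<beta>))"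
      using \<alpha> by (intro continuous_on_compose2[OF dual_G_continuous[OF \<phi>, of x]] continuous_intros) auto
    then show "continuous_on UNIV (\<lambda>\<beta>. \<phi> (G x \<alpha> \<beta>))" by simp
  qed
  then show int: "integrable lborel (\<lambda>\<beta>. \<phi> (G x \<alpha> \<beta>))"
    using le F_nonneg \<alpha> by (intro Bochner_Integration.integrable_bound[OF q_int] AE_I2) (auto simp: abs_mult)
  have "(LINT \<beta>|lborel. cmod (\<phi> (G x \<alpha> \<beta>))) \<le> (LINT \<beta>|lborel. \<alpha> * F \<alpha> * cmod (?q \<beta>))"
    by (intro integral_mono integrable_norm int q_int le)
  also have "\<dots> = F \<alpha> * (\<alpha> * (LINT \<beta>|lborel. cmod (?q \<beta>)))" by simp
  also have "\<dots> \<le> F \<alpha> * (\<gamma> * onorm \<phi> * norm x)" by (intro mult_left_mono reflected_R2(2)[OF \<phi> \<alpha>] F_nonneg)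
  finally show "(LINT \<beta>|lborel. cmod (\<phi> (G x \<alpha> \<beta>))) \<le> \<gamma> * norm x * onorm \<phi> * F \<alpha>" by (simp add: mult_ac)
qed

lemma inner_integrable:
  assumes \<phi>: "dual_elem \<phi>"
  shows "set_integrable lborel {0<..} (\<lambda>\<alpha>. LINT \<beta>|lborel. \<phi> (G x \<alpha> \<beta>))"
    "0 < \<alpha> \<Longrightarrow> cmod (LINT \<beta>|lborel. \<phi> (G x \<alpha> \<beta>)) \<le> \<gamma> * norm x * onorm \<phi> * F \<alpha>"
proof -
  have "0 \<le> \<gamma> * norm x * onorm \<phi>" using \<gamma>_nonneg dual_elemD(8)[OF \<phi>] by simp
  note sl = slice_integrable[OF dual_G_continuous[OF \<phi>, of x] F_nonneg F_integrable this dual_G_bound(2)[OF \<phi>]]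
  show "set_integrable lborel {0<..} (\<lambda>\<alpha>. LINT \<beta>|lborel. \<phi> (G x \<alpha> \<beta>))" by (rule sl(1))
  show "0 < \<alpha> \<Longrightarrow> cmod (LINT \<beta>|lborel. \<phi> (G x \<alpha> \<beta>)) \<le> \<gamma> * norm x * onorm \<phi> * F \<alpha>" by (rule sl(2))
qed

lemma \<Lambda>_alt:
  assumes \<phi>: "dual_elem \<phi>"
  shows "\<Lambda> x \<phi> = (LINT \<alpha>:{0<..}|lborel. complex_of_real \<alpha> *
    (LINT \<beta>|lborel. \<phi> (R (Complex \<alpha> (- \<beta>)) (R (Complex \<alpha> (- \<beta>)) x)) * deriv f (Complex \<alpha> \<beta>)))"
  unfolding \<Lambda>_def by (intro set_lebesgue_integral_cong) (auto simp: dual_G[OF \<phi>])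

lemma G_linear: "G (x - y) \<alpha> \<beta> = G x \<alpha> \<beta> - G y \<alpha> \<beta>" "G (x + y) \<alpha> \<beta> = G x \<alpha> \<beta> + G y \<alpha> \<beta>"
  by (simp_all add: G_def blinfun.diff_right blinfun.add_right scaleC_diff_right scaleC_add_right)

lemma \<Lambda>_diff:
  assumes \<phi>: "dual_elem \<phi>"
  shows "\<Lambda> (x - y) \<phi> = \<Lambda> x \<phi> - \<Lambda> y \<phi>"
proof -
  have "\<Lambda> (x - y) \<phi> = (LINT \<alpha>:{0<..}|lborel. (LINT \<beta>|lborel. \<phi> (G x \<alpha> \<beta>)) - (LINT \<beta>|lborel. \<phi> (G y \<alpha> \<beta>)))"
    unfolding \<Lambda>_def
    by (intro set_lebesgue_integral_cong)
       (auto simp: G_linear dual_elemD[OF \<phi>] Bochner_Integration.integral_diff dual_G_bound(1)[OF \<phi>])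
  then show ?thesis unfolding \<Lambda>_def by (simp add: set_integral_diff(2) inner_integrable[OF \<phi>])
qed

lemma \<Lambda>_add:
  assumes \<phi>: "dual_elem \<phi>"
  shows "\<Lambda> (x + y) \<phi> = \<Lambda> x \<phi> + \<Lambda> y \<phi>"
  using \<Lambda>_diff[OF \<phi>, of "x + y" y] by simp

lemma \<Lambda>_scale:
  assumes \<phi>: "dual_elem \<phi>"
  shows "\<Lambda> (scaleC c x) \<phi> = c * \<Lambda> x \<phi>"
proof -
  have "\<Lambda> (scaleC c x) \<phi> = (LINT \<alpha>:{0<..}|lborel. c * (LINT \<beta>|lborel. \<phi> (G x \<alpha> \<beta>)))"
    unfolding \<Lambda>_def
    by (intro set_lebesgue_integral_cong)
       (auto simp: G_def R_scaleC dual_elemD[OF \<phi>] mult_ac simp flip: integral_mult_right_zero)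
  then show ?thesis by (simp add: \<Lambda>_def)
qed

lemma \<Lambda>_bound:
  assumes \<phi>: "dual_elem \<phi>"
  shows "cmod (\<Lambda> x \<phi>) \<le> \<gamma> * norm x * onorm \<phi> * integral\<^sup>L lborel F"
proof -
  have "cmod (\<Lambda> x \<phi>) \<le> (LINT \<alpha>:{0<..}|lborel. cmod (LINT \<beta>|lborel. \<phi> (G x \<alpha> \<beta>)))"
    unfolding \<Lambda>_def using inner_integrable(1)[OF \<phi>] set_integral_norm_bound by blast
  also have "\<dots> \<le> (LINT \<alpha>|lborel. \<gamma> * norm x * onorm \<phi> * F \<alpha>)"
    unfolding set_lebesgue_integral_def
  proof (rule integral_mono)
    show "integrable lborel (\<lambda>\<alpha>. indicator {0<..} \<alpha> *\<^sub>R cmod (LINT \<beta>|lborel. \<phi> (G x \<alpha> \<beta>)))"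
      using set_integrable_norm[OF inner_integrable(1)[OF \<phi>]] by (simp add: set_integrable_def)
    show "indicator {0<..} \<alpha> *\<^sub>R cmod (LINT \<beta>|lborel. \<phi> (G x \<alpha> \<beta>)) \<le> \<gamma> * norm x * onorm \<phi> * F \<alpha>" for \<alpha>
      using inner_integrable(2)[OF \<phi>, of \<alpha> x] F_nonneg[of \<alpha>] \<gamma>_nonneg dual_elemD(8)[OF \<phi>]
      by (auto simp: indicator_def)
  qed (use F_integrable in simp)
  finally show ?thesis by simp
qed

text \<open>On this range the integrand decays like \<open>1 / (1 + \<beta>^2)\<close> in norm, so
  the truncated integrals converge uniformly over functionals of bounded norm.\<close>

lemma \<Lambda>_representable_R1_squared:
  shows "\<exists>v. \<forall>\<phi>. dual_elem \<phi> \<longrightarrow> \<Lambda> (R 1 (R 1 y)) \<phi> = \<phi> v"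
proof -
  define x where "x = R 1 (R 1 y)"
  obtain v where "\<And>\<phi>. dual_elem \<phi> \<Longrightarrow> (LINT \<alpha>:{0<..}|lborel. LINT \<beta>|lborel. \<phi> (G x \<alpha> \<beta>)) = \<phi> v"
  proof (rule weak_double_integral[OF G_continuous[of x] F_nonneg F_integrable])
    fix a b :: real assume a: "0 < a"
    obtain C where C: "0 \<le> C" "\<And>w. a \<le> Re w \<Longrightarrow> norm (R w (R w x)) * (cmod w)\<^sup>2 \<le> C"
      using R2_decay[OF a, of y] unfolding x_def by blast
    show "\<exists>C\<ge>0. \<forall>\<alpha>\<in>{a..b}. \<forall>\<beta>. norm (G x \<alpha> \<beta>) \<le> C * F \<alpha> * (1 / (1 + \<beta>\<^sup>2))"
    proof (intro exI[of _ "\<bar>b\<bar> * (C * (1 + 1 / a\<^sup>2))"] conjI ballI allI)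
      show "0 \<le> \<bar>b\<bar> * (C * (1 + 1 / a\<^sup>2))" using C by (simp add: add_nonneg_nonneg)
      fix \<alpha> \<beta> assume \<alpha>: "\<alpha> \<in> {a..b}"
      let ?N = "norm (R (Complex \<alpha> (- \<beta>)) (R (Complex \<alpha> (- \<beta>)) x))"
      have "?N * (\<alpha>\<^sup>2 + \<beta>\<^sup>2) \<le> C" using C(2)[of "Complex \<alpha> (- \<beta>)"] \<alpha> by (simp add: cmod_power2)
      then have N: "?N \<le> C * (1 + 1 / a\<^sup>2) * (1 / (1 + \<beta>\<^sup>2))" using \<alpha> a by (intro kernel_decay) auto
      have "norm (G x \<alpha> \<beta>) = \<alpha> * cmod (deriv f (Complex \<alpha> \<beta>)) * ?N"
        using \<alpha> a by (simp add: G_def norm_scaleC norm_mult)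
      also have "\<dots> \<le> \<bar>b\<bar> * F \<alpha> * (C * (1 + 1 / a\<^sup>2) * (1 / (1 + \<beta>\<^sup>2)))"
        using \<alpha> a F_nonneg[of \<alpha>] by (intro mult_mono N F_bound) auto
      finally show "norm (G x \<alpha> \<beta>) \<le> \<bar>b\<bar> * (C * (1 + 1 / a\<^sup>2)) * F \<alpha> * (1 / (1 + \<beta>\<^sup>2))"
        by (simp add: mult_ac)
    qed
  next
    show "0 \<le> \<gamma> * norm x" using \<gamma>_nonneg by simp
  qed (use dual_G_bound in auto)
  then show ?thesis unfolding x_def \<Lambda>_def by blast
qed

text \<open>\<open>\<Lambda>_bound\<close> makes \<open>\<Lambda>\<close> continuous in
  \<open>x\<close>, uniformly over functionals of bounded norm, so representability passes from a
  dense set to its closure.\<close>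

lemma \<Lambda>_representable: "\<exists>v. \<forall>\<phi>. dual_elem \<phi> \<longrightarrow> \<Lambda> x \<phi> = \<phi> v"
proof -
  obtain v where "\<And>\<phi>. dual_elem \<phi> \<Longrightarrow> \<Lambda> x \<phi> = \<phi> v"
  proof (rule ex_representing_vector[of "\<Lambda> x"])
    fix \<delta> :: real assume \<delta>: "\<delta> > 0"
    define K where "K = \<gamma> * integral\<^sup>L lborel F"
    have K: "0 \<le> K" unfolding K_def using \<gamma>_nonneg F_nonneg by (simp add: integral_nonneg_AE)
    obtain y where y: "norm (x - R 1 (R 1 y)) < \<delta> / (K + 1)"
      using range_R1_squared_dense[of "\<delta> / (K + 1)" x] \<delta> K by auto
    obtain v where v: "\<And>\<phi>. dual_elem \<phi> \<Longrightarrow> \<Lambda> (R 1 (R 1 y)) \<phi> = \<phi> v"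
      using \<Lambda>_representable_R1_squared by blast
    have "cmod (\<Lambda> x \<phi> - \<phi> v) \<le> \<delta> * onorm \<phi>" if \<phi>: "dual_elem \<phi>" for \<phi>
    proof -
      have "cmod (\<Lambda> x \<phi> - \<phi> v) \<le> K * norm (x - R 1 (R 1 y)) * onorm \<phi>"
        using \<Lambda>_bound[OF \<phi>, of "x - R 1 (R 1 y)"] by (simp add: \<Lambda>_diff[OF \<phi>] v[OF \<phi>] K_def mult_ac)
      also have "\<dots> \<le> (K + 1) * (\<delta> / (K + 1)) * onorm \<phi>"
        using K y dual_elemD(8)[OF \<phi>] by (intro mult_right_mono mult_mono) auto
      finally show ?thesis using K by simp
    qed
    then show "\<exists>v. \<forall>\<phi>. dual_elem \<phi> \<longrightarrow> cmod (\<Lambda> x \<phi> - \<phi> v) \<le> \<delta> * onorm \<phi>" by blast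
  qed blast
  then show ?thesis by blast
qed

text \<open>Justifies the definite description in \<open>B_calc\<close>: a representing operator
  exists, and functionals separate points, so it is unique.\<close>

theorem B_calc_weak:
  shows "cbounded_op (B_calc D A f)"
    "dual_elem \<phi> \<Longrightarrow> \<phi> (B_calc D A f x) = B_inf f * \<phi> x - of_real (2 / pi) * \<Lambda> x \<phi>"
proof -
  obtain V where V: "\<And>x \<phi>. dual_elem \<phi> \<Longrightarrow> \<Lambda> x \<phi> = \<phi> (V x)" using \<Lambda>_representable by metis
  define K where "K = \<gamma> * integral\<^sup>L lborel F"
  have K: "0 \<le> K" unfolding K_def using \<gamma>_nonneg F_nonneg by (simp add: integral_nonneg_AE)
  have V_add: "V (x + y) = V x + V y" for x y
    by (rule dual_elem_separates) (simp add: V[symmetric] \<Lambda>_add dual_elemD(3))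
  have V_scale: "V (scaleC c x) = scaleC c (V x)" for c x
    by (rule dual_elem_separates) (simp add: V[symmetric] \<Lambda>_scale dual_elemD(2))
  have V_norm: "norm (V x) \<le> norm x * K" for x
  proof (rule norm_le_dual)
    fix \<phi> :: "'a \<Rightarrow> complex" assume \<phi>: "dual_elem \<phi>" "onorm \<phi> \<le> 1"
    have "cmod (\<phi> (V x)) \<le> onorm \<phi> * (norm x * K)"
      using \<Lambda>_bound[OF \<phi>(1), of x] by (simp add: V[OF \<phi>(1), symmetric] K_def mult_ac)
    also have "\<dots> \<le> 1 * (norm x * K)" using \<phi>(2) K by (intro mult_right_mono) auto
    finally show "cmod (\<phi> (V x)) \<le> norm x * K" by simp
  qed
  have V_bl: "bounded_linear V"
    using V_add V_scale[of "of_real _"] V_norm by (intro bounded_linear_intro) (auto simp: scaleC_of_real)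
  define T where "T = (\<lambda>x. scaleC (B_inf f) x - scaleC (of_real (2 / pi)) (V x))"
  have T: "cbounded_op T"
    unfolding cbounded_op_def
  proof (intro conjI allI)
    show "bounded_linear T"
      unfolding T_def by (intro bounded_linear_sub bounded_linear_scaleC bounded_linear_compose[OF bounded_linear_scaleC V_bl])
    show "T (scaleC c x) = scaleC c (T x)" for c x
      by (simp add: T_def V_scale scaleC_scaleC scaleC_diff_right mult.commute)
  qed
  let ?P = "\<lambda>T. cbounded_op T \<and> (\<forall>x \<phi>. dual_elem \<phi> \<longrightarrow>
      \<phi> (T x) = B_inf f * \<phi> x - complex_of_real (2 / pi) *
        (LINT \<alpha>:{0<..}|lborel. complex_of_real \<alpha> *
           (LINT \<beta>|lborel. \<phi> (shifted_inv2 D A (Complex \<alpha> (- \<beta>)) x) * deriv f (Complex \<alpha> \<beta>))))"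
  have \<Lambda>_eq: "(LINT \<alpha>:{0<..}|lborel. complex_of_real \<alpha> *
      (LINT \<beta>|lborel. \<phi> (shifted_inv2 D A (Complex \<alpha> (- \<beta>)) x) * deriv f (Complex \<alpha> \<beta>))) = \<Lambda> x \<phi>"
    if "dual_elem \<phi>" for \<phi> x
    unfolding \<Lambda>_alt[OF that] by (intro set_lebesgue_integral_cong) (auto simp: shifted_inv2_R)
  have PT: "?P T"
    using T by (simp add: \<Lambda>_eq) (simp add: T_def dual_elemD V)
  have "B_calc D A f = T"
    unfolding B_calc_def
  proof (rule the_equality[where P = ?P, OF PT])
    fix T' assume T': "?P T'"
    show "T' = T"
    proof
      fix x
      show "T' x = T x" using PT T' by (intro dual_elem_separates) simp
    qed
  qed
  then show "cbounded_op (B_calc D A f)"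
    "dual_elem \<phi> \<Longrightarrow> \<phi> (B_calc D A f x) = B_inf f * \<phi> x - of_real (2 / pi) * \<Lambda> x \<phi>"
    using T by (simp_all add: T_def dual_elemD V)
qed

text \<open>Common core of (1) and (2): for an eigenvector and for an eigenfunctional alike, the
  operator integral reduces to the scalar one.\<close>

lemma weak_spectral_value:
  assumes \<phi>: "dual_elem \<phi>" and \<mu>: "0 \<le> Re \<mu>"
    and R: "\<And>w. 0 < Re w \<Longrightarrow> \<phi> (R w (R w x)) = (1 / (w + \<mu>))\<^sup>2 * \<phi> x"
  shows "\<phi> (B_calc D A f x) = B_val f \<mu> * \<phi> x"
proof -
  have "\<Lambda> x \<phi> = (LINT \<alpha>:{0<..}|lborel. (complex_of_real \<alpha> *
      (LINT \<beta>|lborel. (1 / (Complex \<alpha> (- \<beta>) + \<mu>))\<^sup>2 * deriv f (Complex \<alpha> \<beta>))) * \<phi> x)"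
    unfolding \<Lambda>_alt[OF \<phi>]
  proof (intro set_lebesgue_integral_cong allI impI)
    fix \<alpha> :: real assume "\<alpha> \<in> {0<..}"
    then have "(LINT \<beta>|lborel. \<phi> (R (Complex \<alpha> (- \<beta>)) (R (Complex \<alpha> (- \<beta>)) x)) * deriv f (Complex \<alpha> \<beta>))
        = (LINT \<beta>|lborel. ((1 / (Complex \<alpha> (- \<beta>) + \<mu>))\<^sup>2 * deriv f (Complex \<alpha> \<beta>)) * \<phi> x)"
      by (intro Bochner_Integration.integral_cong) (auto simp: R mult_ac)
    then show "complex_of_real \<alpha> * (LINT \<beta>|lborel. \<phi> (R (Complex \<alpha> (- \<beta>)) (R (Complex \<alpha> (- \<beta>)) x)) * deriv f (Complex \<alpha> \<beta>))
        = (complex_of_real \<alpha> * (LINT \<beta>|lborel. (1 / (Complex \<alpha> (- \<beta>) + \<mu>))\<^sup>2 * deriv f (Complex \<alpha> \<beta>))) * \<phi> x"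
      by simp
  qed simp
  also have "\<dots> = of_real (pi / 2) * (B_inf f - B_val f \<mu>) * \<phi> x"
    by (simp only: set_integral_mult_left reproducing_formula[OF \<mu>])
  finally have "\<Lambda> x \<phi> = of_real (pi / 2) * (B_inf f - B_val f \<mu>) * \<phi> x" .
  then show ?thesis unfolding B_calc_weak(2)[OF \<phi>] by (simp add: field_simps)
qed

lemma eigenvector:
  assumes x: "x \<in> D" "A x = scaleC \<mu> x"
  shows "B_calc D A f x = scaleC (B_val f \<mu>) x"
proof (cases "x = 0")
  case True
  then show ?thesis using cbounded_opD(5)[OF B_calc_weak(1)] by simp
next
  case False
  \<comment> \<open>Membership in the spectrum gives \<open>0 \<le> Re \<mu>\<close>, under which
    the reproducing formula is available.\<close>
  have "\<mu> \<in> op_spectrum D A"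
  proof (rule ccontr)
    assume "\<mu> \<notin> op_spectrum D A"
    then obtain Q where Q: "bounded_inverse_of D (\<lambda>x. scaleC \<mu> x - A x) Q" by (auto simp: op_spectrum_def)
    then have "Q (scaleC \<mu> x - A x) = x" "cbounded_op Q" using x by (auto simp: bounded_inverse_of_def)
    then show False using False x cbounded_opD(5)[of Q] by simp
  qed
  then have \<mu>: "0 \<le> Re \<mu>" using spec by auto
  show ?thesis
  proof (rule dual_elem_separates)
    fix \<phi> :: "'a \<Rightarrow> complex" assume \<phi>: "dual_elem \<phi>"
    have "\<phi> (B_calc D A f x) = B_val f \<mu> * \<phi> x"
    proof (rule weak_spectral_value[OF \<phi> \<mu>])
      fix w :: complex assume w: "0 < Re w"
      have "Re (w + \<mu>) > 0" using w \<mu> by simp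
      then have nz: "w + \<mu> \<noteq> 0" by (metis less_irrefl zero_complex.sel(1))
      have "scaleC (w + \<mu>) (R w x) = x"
        using R_left[OF w x(1)] by (simp add: x scaleC_add_left[symmetric] R_scaleC[OF w])
      from arg_cong[OF this, of "scaleC (1 / (w + \<mu>))"]
      have "R w x = scaleC (1 / (w + \<mu>)) x" using nz by (simp add: scaleC_scaleC)
      then show "\<phi> (R w (R w x)) = (1 / (w + \<mu>))\<^sup>2 * \<phi> x"
        by (simp add: R_scaleC[OF w] dual_elemD[OF \<phi>] power2_eq_square)
    qed
    then show "\<phi> (B_calc D A f x) = \<phi> (scaleC (B_val f \<mu>) x)" by (simp add: dual_elemD[OF \<phi>])
  qed
qed

lemma adjoint_eigenvector:
  assumes "adjoint_rel D A \<phi> (\<lambda>x. \<mu> * \<phi> x)"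
  shows "\<phi> (B_calc D A f x) = B_val f \<mu> * \<phi> x"
proof (cases "\<forall>x. \<phi> x = 0")
  case False
  have \<phi>: "dual_elem \<phi>" and \<phi>A: "\<And>x. x \<in> D \<Longrightarrow> \<phi> (A x) = \<mu> * \<phi> x"
    using assms by (auto simp: adjoint_rel_def)
  \<comment> \<open>A functional vanishing on the range of \<open>\<mu> - A\<close> must be 0 if
    that range is everything.\<close>
  have "\<mu> \<in> op_spectrum D A"
  proof (rule ccontr)
    assume "\<mu> \<notin> op_spectrum D A"
    then obtain Q where Q: "bounded_inverse_of D (\<lambda>x. scaleC \<mu> x - A x) Q" by (auto simp: op_spectrum_def)
    have "\<phi> y = 0" for y
    proof -
      have "Q y \<in> D" "scaleC \<mu> (Q y) - A (Q y) = y" using Q by (auto simp: bounded_inverse_of_def)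
      then show ?thesis using \<phi>A[of "Q y"] dual_elemD(2,4)[OF \<phi>] by (metis diff_self)
    qed
    then show False using False by simp
  qed
  then have \<mu>: "0 \<le> Re \<mu>" using spec by auto
  show ?thesis
  proof (rule weak_spectral_value[OF \<phi> \<mu>])
    fix w :: complex assume w: "0 < Re w"
    have "Re (w + \<mu>) > 0" using w \<mu> by simp
    then have nz: "w + \<mu> \<noteq> 0" by (metis less_irrefl zero_complex.sel(1))
    have "\<phi> (R w y) = \<phi> y / (w + \<mu>)" for y
    proof -
      have "\<phi> y = \<phi> (scaleC w (R w y) + A (R w y))" by (simp only: R_right[OF w])
      also have "\<dots> = (w + \<mu>) * \<phi> (R w y)"
        by (simp add: dual_elemD[OF \<phi>] \<phi>A[OF R_dom[OF w]] algebra_simps)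
      finally show ?thesis using nz by (simp add: field_simps)
    qed
    then show "\<phi> (R w (R w x)) = (1 / (w + \<mu>))\<^sup>2 * \<phi> x"
      by (simp add: power2_eq_square)
  qed
qed simp

end

section \<open>Spectral mapping\<close>

context B_calculus
begin

text \<open>With \<open>r = (w + \<mu>)\<^sup>-\<^sup>1\<close> and \<open>y = \<mu> x - A x\<close> one has \<open>R w (R w x) = r\<^sup>2 x + r\<^sup>2 R w y + r R w (R w y)\<close>;
  the last two terms are only controlled away from the imaginary axis.\<close>

lemma approximate_eigenvector_estimate:
  assumes \<mu>: "0 \<le> Re \<mu>" and \<epsilon>: "0 < \<epsilon>" and x: "x \<in> D"
  shows "norm (B_calc D A f x - scaleC (B_val f \<mu>) x) \<le> 2 / pi * ((\<gamma> + pi) * norm x * \<Omega> \<epsilon>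
    + (pi + 1) * \<gamma> / \<epsilon> * integral\<^sup>L lborel F * norm (scaleC \<mu> x - A x))"
proof (rule norm_le_dual)
  fix \<phi> :: "'a \<Rightarrow> complex" assume \<phi>: "dual_elem \<phi>" "onorm \<phi> \<le> 1"
  note \<phi>D = dual_elemD[OF \<phi>(1)]
  have \<phi>_le: "cmod (\<phi> z) \<le> norm z" for z
    using \<phi>D(7)[of z] mult_right_mono[OF \<phi>(2), of "norm z"] by simp
  define y where "y = scaleC \<mu> x - A x"
  define k where "k = (\<lambda>\<alpha> \<beta>. (1 / (Complex \<alpha> (- \<beta>) + \<mu>))\<^sup>2)"
  \<comment> \<open>This is the integrand of \<open>\<Lambda>\<close> with the squared resolvent
    replaced by its scalar value at \<mu>.\<close>
  define h where "h = (\<lambda>\<alpha> \<beta>. complex_of_real \<alpha> * deriv f (Complex \<alpha> \<beta>) * k \<alpha> \<beta> * \<phi> x)"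
  define I I' where "I = (\<lambda>\<alpha>. LINT \<beta>|lborel. \<phi> (G x \<alpha> \<beta>))" and "I' = (\<lambda>\<alpha>. LINT \<beta>|lborel. h \<alpha> \<beta>)"
  have k_int: "integrable lborel (\<lambda>\<beta>. cmod (k \<alpha> \<beta>))" and k_le: "\<alpha> * (LINT \<beta>|lborel. cmod (k \<alpha> \<beta>)) \<le> pi"
    if "0 < \<alpha>" for \<alpha>
    using resolvent_kernel_integral(3,4)[OF \<mu> that] by (simp_all add: k_def)
  have nz: "Complex \<alpha> (- \<beta>) + \<mu> \<noteq> 0" if "0 < \<alpha>" for \<alpha> \<beta>
    using that \<mu> by (auto simp: complex_eq_iff)
  have h_eq: "h \<alpha> \<beta> = (1 / (Complex \<alpha> (- \<beta>) + \<mu>))\<^sup>2 * deriv f (Complex \<alpha> \<beta>) * (of_real \<alpha> * \<phi> x)" for \<alpha> \<beta>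
    by (simp add: h_def k_def)
  have h_int: "integrable lborel (h \<alpha>)" if "0 < \<alpha>" for \<alpha>
    unfolding h_eq by (intro integrable_mult_left resolvent_kernel_integral(1)[OF \<mu> that])
  have h_cont: "continuous_on ({0<..} \<times> UNIV) (\<lambda>(\<alpha>, \<beta>). h \<alpha> \<beta>)"
  proof -
    have "continuous_on ({0<..} \<times> UNIV) (\<lambda>p. (1 / (Complex (fst p) (- snd p) + \<mu>))\<^sup>2)"
      using nz by (intro continuous_intros) auto
    then show ?thesis using coeff_continuous
      by (auto simp: h_def k_def case_prod_beta' intro!: continuous_on_mult continuous_on_const)
  qed
  have h_le: "(LINT \<beta>|lborel. cmod (h \<alpha> \<beta>)) \<le> pi * norm x * F \<alpha>" if \<alpha>: "0 < \<alpha>" for \<alpha>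
  proof -
    have "(LINT \<beta>|lborel. cmod (h \<alpha> \<beta>)) \<le> (LINT \<beta>|lborel. (\<alpha> * F \<alpha> * norm x) * cmod (k \<alpha> \<beta>))"
    proof (rule integral_mono)
      show "integrable lborel (\<lambda>\<beta>. cmod (h \<alpha> \<beta>))" by (rule integrable_norm[OF h_int[OF \<alpha>]])
      show "integrable lborel (\<lambda>\<beta>. (\<alpha> * F \<alpha> * norm x) * cmod (k \<alpha> \<beta>))"
        by (rule integrable_mult_right[OF k_int[OF \<alpha>]])
      fix \<beta>
      have "cmod (deriv f (Complex \<alpha> \<beta>)) * cmod (\<phi> x) \<le> F \<alpha> * norm x"
        using F_bound[OF \<alpha>] \<phi>_le F_nonneg by (intro mult_mono) auto
      from mult_left_mono[OF this, of "\<alpha> * cmod (k \<alpha> \<beta>)"] \<alpha>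
      show "cmod (h \<alpha> \<beta>) \<le> (\<alpha> * F \<alpha> * norm x) * cmod (k \<alpha> \<beta>)"
        by (simp add: h_def norm_mult mult_ac)
    qed
    also have "\<dots> = (\<alpha> * (LINT \<beta>|lborel. cmod (k \<alpha> \<beta>))) * (F \<alpha> * norm x)" by simp
    also have "\<dots> \<le> pi * (F \<alpha> * norm x)" using F_nonneg by (intro mult_right_mono k_le \<alpha>) auto
    finally show ?thesis by (simp add: mult_ac)
  qed
  note I'_slice = slice_integrable[OF h_cont F_nonneg F_integrable _ h_le]
  have I'_int: "set_integrable lborel {0<..} I'" unfolding I'_def by (rule I'_slice(1)) auto
  have I_int: "set_integrable lborel {0<..} I" unfolding I_def by (rule inner_integrable(1)[OF \<phi>(1)])
  have I'_bound: "cmod (I' \<alpha>) \<le> pi * norm x * F \<alpha>" if "0 < \<alpha>" for \<alpha>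
    unfolding I'_def using that by (intro I'_slice(2)) auto
  have I_bound: "cmod (I \<alpha>) \<le> \<gamma> * norm x * F \<alpha>" if "0 < \<alpha>" for \<alpha>
  proof -
    have "cmod (I \<alpha>) \<le> onorm \<phi> * (\<gamma> * norm x * F \<alpha>)"
      unfolding I_def using inner_integrable(2)[OF \<phi>(1) that, of x] by (simp add: mult_ac)
    also have "\<dots> \<le> 1 * (\<gamma> * norm x * F \<alpha>)" using \<phi>(2) \<gamma>_nonneg F_nonneg by (intro mult_right_mono) auto
    finally show ?thesis by simp
  qed
  have I'_val: "(LINT \<alpha>:{0<..}|lborel. I' \<alpha>) = of_real (pi / 2) * (B_inf f - B_val f \<mu>) * \<phi> x"
  proof -
    have "(LINT \<alpha>:{0<..}|lborel. I' \<alpha>) = (LINT \<alpha>:{0<..}|lborel. (complex_of_real \<alpha> *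
        (LINT \<beta>|lborel. (1 / (Complex \<alpha> (- \<beta>) + \<mu>))\<^sup>2 * deriv f (Complex \<alpha> \<beta>))) * \<phi> x)"
      unfolding I'_def h_eq by (intro set_lebesgue_integral_cong) auto
    then show ?thesis by (simp only: set_integral_mult_left reproducing_formula[OF \<mu>])
  qed
  \<comment> \<open>Both remainders carry \<open>y\<close>. The one with the kernel \<open>k\<close>
    contributes pi through the scalar kernel bound, and the other contributes 1 through the bound
    for squared resolvents, since \<open>|r| \<le> 1 / \<epsilon>\<close>; hence
    \<open>pi + 1\<close>.\<close>
  have far: "cmod (I \<alpha> - I' \<alpha>) \<le> (pi + 1) * \<gamma> / \<epsilon> * norm y * F \<alpha>" if \<alpha>: "\<epsilon> < \<alpha>" for \<alpha>
  proof -
    have \<alpha>0: "0 < \<alpha>" using \<alpha> \<epsilon> by simp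
    define q where "q = (\<lambda>\<beta>. \<phi> (R (Complex \<alpha> (- \<beta>)) (R (Complex \<alpha> (- \<beta>)) y)))"
    note q_int = reflected_R2(1)[OF \<phi>(1) \<alpha>0, of y, folded q_def]
    have q_le: "\<alpha> * (LINT \<beta>|lborel. cmod (q \<beta>)) \<le> \<gamma> * norm y"
    proof -
      have "\<alpha> * (LINT \<beta>|lborel. cmod (q \<beta>)) \<le> onorm \<phi> * (\<gamma> * norm y)"
        using reflected_R2(2)[OF \<phi>(1) \<alpha>0, of y] by (simp add: q_def mult_ac)
      also have "\<dots> \<le> 1 * (\<gamma> * norm y)" using \<phi>(2) \<gamma>_nonneg by (intro mult_right_mono) auto
      finally show ?thesis by simp
    qed
    have pointwise: "cmod (\<phi> (G x \<alpha> \<beta>) - h \<alpha> \<beta>)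
        \<le> (\<alpha> * F \<alpha> * (\<gamma> / \<epsilon> * norm y)) * cmod (k \<alpha> \<beta>) + (\<alpha> * F \<alpha> / \<epsilon>) * cmod (q \<beta>)" for \<beta>
    proof -
      define w where "w = Complex \<alpha> (- \<beta>)"
      define r where "r = 1 / (w + \<mu>)"
      have w: "0 < Re w" using \<alpha>0 by (simp add: w_def)
      have rw: "r * (w + \<mu>) = 1" using nz[OF \<alpha>0, of \<beta>] by (simp add: r_def w_def)
      have Rx: "R w x = scaleC r (x + R w y)"
      proof -
        have "x + R w y = scaleC (w + \<mu>) (R w x)"
          unfolding y_def by (simp add: blinfun.diff_right R_scaleC[OF w] R_A[OF w x] scaleC_add_left)
        then show ?thesis using rw by (simp add: scaleC_scaleC)
      qed
      have "R w (R w x) = scaleC r (R w x + R w (R w y))"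
        by (subst Rx) (simp add: R_scaleC[OF w] blinfun.add_right)
      also have "\<dots> = scaleC (r\<^sup>2) x + (scaleC (r\<^sup>2) (R w y) + scaleC r (R w (R w y)))"
        by (subst Rx) (simp add: scaleC_add_right scaleC_scaleC power2_eq_square add.assoc)
      finally have "\<phi> (R w (R w x)) = r\<^sup>2 * \<phi> x + (r\<^sup>2 * \<phi> (R w y) + r * q \<beta>)"
        by (simp add: \<phi>D q_def w_def)
      then have "\<phi> (G x \<alpha> \<beta>) - h \<alpha> \<beta>
          = of_real \<alpha> * deriv f (Complex \<alpha> \<beta>) * (k \<alpha> \<beta> * \<phi> (R w y) + r * q \<beta>)"
        unfolding dual_G[OF \<phi>(1)] h_def k_def r_def w_def by (simp add: algebra_simps)
      also have "cmod \<dots> \<le> (\<alpha> * F \<alpha>) * (cmod (k \<alpha> \<beta>) * (\<gamma> / \<epsilon> * norm y) + 1 / \<epsilon> * cmod (q \<beta>))"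
        unfolding norm_mult
      proof (rule mult_mono)
        show "cmod (complex_of_real \<alpha>) * cmod (deriv f (Complex \<alpha> \<beta>)) \<le> \<alpha> * F \<alpha>"
          using \<alpha>0 F_bound[OF \<alpha>0] by (simp add: mult_left_mono)
        have "cmod (\<phi> (R w y)) \<le> norm (R w y)" by (rule \<phi>_le)
        also have "\<dots> \<le> \<gamma> / \<alpha> * norm y" using norm_R_le[OF w, of y] by (simp add: w_def)
        also have "\<dots> \<le> \<gamma> / \<epsilon> * norm y"
          using \<alpha> \<epsilon> \<gamma>_nonneg by (intro mult_right_mono divide_left_mono) auto
        finally have 1: "cmod (k \<alpha> \<beta> * \<phi> (R w y)) \<le> cmod (k \<alpha> \<beta>) * (\<gamma> / \<epsilon> * norm y)"
          unfolding norm_mult by (rule mult_left_mono) simp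
        have "\<epsilon> \<le> Re (w + \<mu>)" using \<alpha> \<mu> by (simp add: w_def)
        also have "\<dots> \<le> cmod (w + \<mu>)" by (rule complex_Re_le_cmod)
        finally have "cmod r \<le> 1 / \<epsilon>" using \<epsilon> by (simp add: r_def norm_divide frac_le)
        then have 2: "cmod (r * q \<beta>) \<le> 1 / \<epsilon> * cmod (q \<beta>)"
          unfolding norm_mult by (rule mult_right_mono) simp
        show "cmod (k \<alpha> \<beta> * \<phi> (R w y) + r * q \<beta>) \<le> cmod (k \<alpha> \<beta>) * (\<gamma> / \<epsilon> * norm y) + 1 / \<epsilon> * cmod (q \<beta>)"
          using norm_triangle_ineq[of "k \<alpha> \<beta> * \<phi> (R w y)" "r * q \<beta>"] 1 2 by linarith
      qed (use \<alpha>0 F_nonneg in auto)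
      finally show ?thesis by (simp add: algebra_simps)
    qed
    have "I \<alpha> - I' \<alpha> = (LINT \<beta>|lborel. \<phi> (G x \<alpha> \<beta>) - h \<alpha> \<beta>)"
      unfolding I_def I'_def
      by (rule Bochner_Integration.integral_diff[symmetric, OF dual_G_bound(1)[OF \<phi>(1) \<alpha>0] h_int[OF \<alpha>0]])
    also have "cmod \<dots> \<le> (LINT \<beta>|lborel. cmod (\<phi> (G x \<alpha> \<beta>) - h \<alpha> \<beta>))" by (rule integral_norm_bound)
    also have "\<dots> \<le> (LINT \<beta>|lborel. (\<alpha> * F \<alpha> * (\<gamma> / \<epsilon> * norm y)) * cmod (k \<alpha> \<beta>) + (\<alpha> * F \<alpha> / \<epsilon>) * cmod (q \<beta>))"
    proof (rule integral_mono)
      show "integrable lborel (\<lambda>\<beta>. cmod (\<phi> (G x \<alpha> \<beta>) - h \<alpha> \<beta>))"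
        by (rule integrable_norm[OF Bochner_Integration.integrable_diff[OF dual_G_bound(1)[OF \<phi>(1) \<alpha>0] h_int[OF \<alpha>0]]])
      show "integrable lborel (\<lambda>\<beta>. (\<alpha> * F \<alpha> * (\<gamma> / \<epsilon> * norm y)) * cmod (k \<alpha> \<beta>) + (\<alpha> * F \<alpha> / \<epsilon>) * cmod (q \<beta>))"
        by (rule Bochner_Integration.integrable_add[OF integrable_mult_right[OF k_int[OF \<alpha>0]]
              integrable_mult_right[OF integrable_norm[OF q_int]]])
    qed (rule pointwise)
    also have "\<dots> = (F \<alpha> * (\<gamma> / \<epsilon> * norm y)) * (\<alpha> * (LINT \<beta>|lborel. cmod (k \<alpha> \<beta>)))
        + (F \<alpha> / \<epsilon>) * (\<alpha> * (LINT \<beta>|lborel. cmod (q \<beta>)))"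
      using k_int[OF \<alpha>0] q_int by (simp add: mult_ac)
    also have "\<dots> \<le> (F \<alpha> * (\<gamma> / \<epsilon> * norm y)) * pi + (F \<alpha> / \<epsilon>) * (\<gamma> * norm y)"
      using F_nonneg \<gamma>_nonneg \<epsilon> by (intro add_mono mult_left_mono k_le \<alpha>0 q_le) auto
    also have "\<dots> = (pi + 1) * \<gamma> / \<epsilon> * norm y * F \<alpha>"
      by (simp add: algebra_simps add_divide_distrib)
    finally show ?thesis .
  qed
  \<comment> \<open>For \<alpha> up to \<epsilon> the two integrals are bounded separately, and the
    smallness comes from \<open>\<Omega> \<epsilon>\<close> rather than from
    \<open>y\<close>.\<close>
  define W where "W = (\<lambda>\<alpha>. (\<gamma> + pi) * norm x * (indicator {0<..\<epsilon>} \<alpha> *\<^sub>R F \<alpha>)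
      + (pi + 1) * \<gamma> / \<epsilon> * norm y * F \<alpha>)"
  have F\<epsilon>: "integrable lborel (\<lambda>\<alpha>. indicator {0<..\<epsilon>} \<alpha> *\<^sub>R F \<alpha>)"
    using F_set_integrable[of "{0<..\<epsilon>}"] by (simp add: set_integrable_def)
  have W_int: "integrable lborel W" unfolding W_def using F\<epsilon> F_integrable by simp
  have diff_int: "set_integrable lborel {0<..} (\<lambda>\<alpha>. I \<alpha> - I' \<alpha>)" by (rule set_integral_diff(1)[OF I_int I'_int])
  have "cmod (LINT \<alpha>:{0<..}|lborel. I \<alpha> - I' \<alpha>) \<le> (LINT \<alpha>:{0<..}|lborel. cmod (I \<alpha> - I' \<alpha>))"
    using diff_int set_integral_norm_bound by blast
  also have "\<dots> \<le> (LINT \<alpha>|lborel. W \<alpha>)"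
    unfolding set_lebesgue_integral_def
  proof (rule integral_mono[OF _ W_int])
    show "integrable lborel (\<lambda>\<alpha>. indicator {0<..} \<alpha> *\<^sub>R cmod (I \<alpha> - I' \<alpha>))"
      using set_integrable_norm[OF diff_int] by (simp add: set_integrable_def)
    fix \<alpha>
    have P: "0 \<le> (pi + 1) * \<gamma> / \<epsilon> * norm y * F \<alpha>" using \<gamma>_nonneg \<epsilon> F_nonneg by simp
    consider "\<alpha> \<le> 0" | "0 < \<alpha>" "\<alpha> \<le> \<epsilon>" | "\<epsilon> < \<alpha>" by linarith
    then show "indicator {0<..} \<alpha> *\<^sub>R cmod (I \<alpha> - I' \<alpha>) \<le> W \<alpha>"
    proof cases
      case 1
      then show ?thesis using P by (simp add: W_def)
    next
      case 2
      have "cmod (I \<alpha> - I' \<alpha>) \<le> (\<gamma> + pi) * norm x * F \<alpha>"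
        using norm_triangle_ineq4[of "I \<alpha>" "I' \<alpha>"] I_bound[OF 2(1)] I'_bound[OF 2(1)]
        by (simp add: algebra_simps)
      then show ?thesis using P 2 by (simp add: W_def)
    next
      case 3
      then show ?thesis using far[OF 3] \<epsilon> by (simp add: W_def)
    qed
  qed
  also have "\<dots> = (\<gamma> + pi) * norm x * \<Omega> \<epsilon> + (pi + 1) * \<gamma> / \<epsilon> * norm y * integral\<^sup>L lborel F"
    unfolding W_def \<Omega>_def set_lebesgue_integral_def using F\<epsilon> F_integrable by simp
  finally have main: "cmod (LINT \<alpha>:{0<..}|lborel. I \<alpha> - I' \<alpha>)
      \<le> (\<gamma> + pi) * norm x * \<Omega> \<epsilon> + (pi + 1) * \<gamma> / \<epsilon> * norm y * integral\<^sup>L lborel F" .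
  have "\<phi> (B_calc D A f x - scaleC (B_val f \<mu>) x)
      = - of_real (2 / pi) * (LINT \<alpha>:{0<..}|lborel. I \<alpha> - I' \<alpha>)"
    unfolding set_integral_diff(2)[OF I_int I'_int] I'_val
    by (simp add: \<phi>D B_calc_weak(2)[OF \<phi>(1)] \<Lambda>_def I_def field_simps)
  then have "cmod (\<phi> (B_calc D A f x - scaleC (B_val f \<mu>) x))
      = 2 / pi * cmod (LINT \<alpha>:{0<..}|lborel. I \<alpha> - I' \<alpha>)"
    by (simp add: norm_mult norm_divide)
  also have "\<dots> \<le> 2 / pi * ((\<gamma> + pi) * norm x * \<Omega> \<epsilon> + (pi + 1) * \<gamma> / \<epsilon> * norm y * integral\<^sup>L lborel F)"
    by (intro mult_left_mono main) simp
  finally show "cmod (\<phi> (B_calc D A f x - scaleC (B_val f \<mu>) x)) \<le> 2 / pi * ((\<gamma> + pi) * norm x * \<Omega> \<epsilon>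
    + (pi + 1) * \<gamma> / \<epsilon> * integral\<^sup>L lborel F * norm (scaleC \<mu> x - A x))"
    by (simp add: y_def mult_ac)
qed

text \<open>A closed operator that is bounded below has closed range, so dense range means onto.
  Closedness of \<open>A\<close> is read off from the bounded operator \<open>R 1\<close>.\<close>

lemma bounded_below_and_dense_range:
  assumes c: "0 < c" and below: "\<And>x. x \<in> D \<Longrightarrow> c * norm x \<le> norm (scaleC \<mu> x - A x)"
    and dense: "closure ((\<lambda>x. scaleC \<mu> x - A x) ` D) = UNIV"
  shows "\<mu> \<notin> op_spectrum D A"
proof -
  let ?B = "\<lambda>x. scaleC \<mu> x - A x"
  have one: "0 < Re 1" by simp
  have B_diff: "?B (x - y) = ?B x - ?B y" if "x \<in> D" "y \<in> D" for x y
    using A_diff[OF that] by (simp add: scaleC_diff_right)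
  have inj: "x = y" if "x \<in> D" "y \<in> D" "?B x = ?B y" for x y
  proof -
    have "c * norm (x - y) \<le> norm (?B (x - y))" using A_diff[OF that(1,2)] by (intro below) simp
    also have "\<dots> = 0" using B_diff[OF that(1,2)] that(3) by simp
    finally show ?thesis using c by (simp add: mult_le_0_iff)
  qed
  have surj: "\<exists>x\<in>D. ?B x = y" for y
  proof -
    have "y \<in> closure (?B ` D)" using dense by simp
    then have "\<exists>u. (\<forall>n. u n \<in> ?B ` D) \<and> u \<longlonglongrightarrow> y" unfolding closure_sequential .
    then obtain u where u: "\<forall>n. u n \<in> ?B ` D" "u \<longlonglongrightarrow> y" by (elim exE conjE)
    have "\<forall>n. \<exists>x. x \<in> D \<and> u n = ?B x"
    proof
      fix n
      have "u n \<in> ?B ` D" using u(1) by (rule HOL.spec)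
      then show "\<exists>x. x \<in> D \<and> u n = ?B x" by (rule imageE) (intro exI conjI)
    qed
    then have "\<exists>s. \<forall>n. s n \<in> D \<and> u n = ?B (s n)" by (rule choice)
    then obtain s where s': "\<forall>n. s n \<in> D \<and> u n = ?B (s n)" by (elim exE)
    have s: "s n \<in> D" "u n = ?B (s n)" for n using s'[rule_format, of n] by (rule conjunct1, rule conjunct2)
    have "Cauchy s"
    proof (rule metric_CauchyI)
      fix e :: real assume e: "e > 0"
      have "Cauchy u" using u(2) by (rule LIMSEQ_imp_Cauchy)
      then obtain N where N: "\<And>m n. m \<ge> N \<Longrightarrow> n \<ge> N \<Longrightarrow> dist (u m) (u n) < c * e"
        using metric_CauchyD[of u "c * e"] c e by (metis mult_pos_pos)
      have "dist (s m) (s n) < e" if "m \<ge> N" "n \<ge> N" for m n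
      proof -
        have "c * norm (s m - s n) \<le> norm (?B (s m - s n))" using A_diff[OF s(1) s(1)] by (intro below) simp
        also have "\<dots> = dist (u m) (u n)" using B_diff[OF s(1) s(1)] by (simp add: s(2) dist_norm)
        also have "\<dots> < c * e" by (rule N[OF that])
        finally show ?thesis using c by (simp add: dist_norm)
      qed
      then show "\<exists>M. \<forall>m\<ge>M. \<forall>n\<ge>M. dist (s m) (s n) < e" by blast
    qed
    then obtain x where x: "s \<longlonglongrightarrow> x" by (auto simp: Cauchy_convergent_iff convergent_def)
    \<comment> \<open>The relation \<open>u = \<mu> s - A s\<close> is rewritten so that only
      bounded operators occur; the limit can then be taken and lands in the domain.\<close>
    have "s n = R 1 (scaleC (1 + \<mu>) (s n) - u n)" for n
      using R_left[OF one s(1)[of n]] by (simp add: s(2) scaleC_add_left)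
    moreover have "(\<lambda>n. R 1 (scaleC (1 + \<mu>) (s n) - u n)) \<longlonglongrightarrow> R 1 (scaleC (1 + \<mu>) x - y)"
      by (intro tendsto_intros tendsto_scaleC x u(2))
    ultimately have "s \<longlonglongrightarrow> R 1 (scaleC (1 + \<mu>) x - y)" by simp
    then have x_eq: "x = R 1 (scaleC (1 + \<mu>) x - y)" by (rule LIMSEQ_unique[OF x])
    then have xD: "x \<in> D" using R_dom[OF one] by metis
    have "scaleC 1 x + A x = scaleC (1 + \<mu>) x - y"
      using R_right[OF one, of "scaleC (1 + \<mu>) x - y"] x_eq by simp
    then have "?B x = y" by (simp add: scaleC_add_left algebra_simps)
    with xD show ?thesis by blast
  qed
  define Q where "Q = (\<lambda>y. SOME x. x \<in> D \<and> ?B x = y)"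
  have Q_ex: "Q y \<in> D \<and> ?B (Q y) = y" for y
    unfolding Q_def by (rule someI_ex) (use surj[of y] in blast)
  have Q: "Q y \<in> D" "?B (Q y) = y" for y
    using Q_ex[of y] by (rule conjunct1, rule conjunct2)
  have Q_left: "Q (?B x) = x" if "x \<in> D" for x by (rule inj[OF Q(1) that Q(2)])
  have Q_add: "Q (x + y) = Q x + Q y" for x y
  proof (rule inj)
    show "Q x + Q y \<in> D" using A_add[OF Q(1) Q(1)] by blast
    have "?B (Q x + Q y) = ?B (Q x) + ?B (Q y)"
      using A_add[OF Q(1) Q(1), of x y] by (simp add: scaleC_add_right)
    then show "?B (Q (x + y)) = ?B (Q x + Q y)" by (simp only: Q(2))
  qed (rule Q)
  have Q_scale: "Q (scaleC a x) = scaleC a (Q x)" for a x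
  proof (rule inj)
    show "scaleC a (Q x) \<in> D" using A_scale[OF Q(1)] by blast
    have "?B (scaleC a (Q x)) = scaleC a (?B (Q x))"
      using A_scale[OF Q(1), of a x] by (simp add: scaleC_diff_right scaleC_scaleC mult.commute)
    then show "?B (Q (scaleC a x)) = ?B (scaleC a (Q x))" by (simp only: Q(2))
  qed (rule Q)
  have Q_norm: "norm (Q x) \<le> norm x * (1 / c)" for x
  proof -
    have "c * norm (Q x) \<le> norm x" using below[OF Q(1)[of x]] by (simp only: Q(2))
    then show ?thesis using c by (simp add: field_simps)
  qed
  have "bounded_linear Q"
    using Q_add Q_scale[of "of_real _"] Q_norm by (intro bounded_linear_intro[where K = "1 / c"]) (auto simp: scaleC_of_real)
  then have "bounded_inverse_of D ?B Q"
    using Q Q_left Q_scale by (simp add: bounded_inverse_of_def cbounded_op_def)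
  then show ?thesis by (auto simp: op_spectrum_def)
qed

theorem spectral_inclusion:
  assumes \<mu>: "\<mu> \<in> op_spectrum D A"
  shows "B_val f \<mu> \<in> op_spectrum UNIV (B_calc D A f)"
proof (rule ccontr)
  let ?T = "B_calc D A f" and ?m = "B_val f \<mu>"
  let ?B = "\<lambda>x. scaleC \<mu> x - A x"
  have \<mu>0: "0 \<le> Re \<mu>" using \<mu> spec by auto
  assume "?m \<notin> op_spectrum UNIV ?T"
  then obtain S where S: "cbounded_op S" "\<And>y. scaleC ?m (S y) - ?T (S y) = y" "\<And>x. S (scaleC ?m x - ?T x) = x"
    by (auto simp: op_spectrum_def bounded_inverse_of_def)
  \<comment> \<open>Otherwise a nonzero functional kills the range of \<open>\<mu> - A\<close>; by
    (2) it kills the range of \<open>f(\<mu>) - f(A)\<close>, which is assumed to be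
    everything.\<close>
  have "closure (?B ` D) = UNIV"
  proof (rule ccontr)
    assume "closure (?B ` D) \<noteq> UNIV"
    then obtain z where z: "z \<notin> closure (?B ` D)" by blast
    obtain \<phi> where \<phi>: "dual_elem \<phi>" "\<phi> z \<noteq> 0" "\<And>x. x \<in> ?B ` D \<Longrightarrow> \<phi> x = 0"
    proof (rule separating_functional[OF _ _ _ z])
      show "x + y \<in> ?B ` D" if xy: "x \<in> ?B ` D" "y \<in> ?B ` D" for x y
      proof -
        obtain a b where "a \<in> D" "x = ?B a" "b \<in> D" "y = ?B b" using xy by blast
        then have "a + b \<in> D" "x + y = ?B (a + b)" using A_add[of a b] by (auto simp: scaleC_add_right)
        then show ?thesis by blast
      qed
      show "scaleC c x \<in> ?B ` D" if x: "x \<in> ?B ` D" for c x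
      proof -
        obtain a where "a \<in> D" "x = ?B a" using x by blast
        then have "scaleC c a \<in> D" "scaleC c x = ?B (scaleC c a)"
          using A_scale[of a c] by (auto simp: scaleC_diff_right scaleC_scaleC mult.commute)
        then show ?thesis by blast
      qed
      have D0: "0 \<in> D" using lin by (rule conjunct1)
      have "0 = ?B 0" using A_scale[OF D0, of 0] by simp
      then show "0 \<in> ?B ` D" using D0 by (rule image_eqI)
    qed blast
    have "adjoint_rel D A \<phi> (\<lambda>x. \<mu> * \<phi> x)"
      unfolding adjoint_rel_def
    proof (intro conjI ballI \<phi>(1))
      show "dual_elem (\<lambda>x. \<mu> * \<phi> x)"
        using \<phi>(1) bounded_linear_const_mult[OF dual_elemD(1)[OF \<phi>(1)]] by (auto simp: dual_elem_def)
      show "\<phi> (A x) = \<mu> * \<phi> x" if "x \<in> D" for x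
        using \<phi>(3)[OF imageI[OF that]] by (simp add: dual_elemD[OF \<phi>(1)])
    qed
    from adjoint_eigenvector[OF this] have "\<phi> (scaleC ?m (S z) - ?T (S z)) = 0"
      by (simp add: dual_elemD[OF \<phi>(1)])
    then show False using \<phi>(2) by (simp add: S(2))
  qed
  moreover have "\<exists>c>0. \<forall>x\<in>D. c * norm x \<le> norm (?B x)"
  proof -
    define K where "K = onorm S + 1"
    have K0: "0 < K" using onorm_pos_le[of S] S(1) by (simp add: K_def cbounded_op_def add_nonneg_pos)
    have K: "norm x \<le> K * norm (?T x - scaleC ?m x)" for x
    proof -
      have "norm x = norm (S (scaleC ?m x - ?T x))" by (simp only: S(3))
      also have "\<dots> \<le> onorm S * norm (scaleC ?m x - ?T x)"
        using S(1) by (intro onorm) (simp add: cbounded_op_def)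
      also have "\<dots> \<le> K * norm (scaleC ?m x - ?T x)" by (intro mult_right_mono) (auto simp: K_def)
      finally show ?thesis by (simp add: norm_minus_commute)
    qed
    \<comment> \<open>\<open>a\<close> is the coefficient of
      \<open>\<Omega> \<epsilon> * norm x\<close> in the estimate. Once
      \<open>a * \<Omega> \<epsilon> < 1 / 2\<close> this term is absorbed on the left, and with
      \<epsilon> fixed the other one bounds \<open>norm x\<close> by a multiple of
      \<open>norm (\<mu> x - A x)\<close>.\<close>
    define a where "a = K * (2 / pi) * (\<gamma> + pi)"
    have a0: "0 < a" using K0 \<gamma>_nonneg by (simp add: a_def add_nonneg_pos)
    have "\<forall>\<^sub>F \<epsilon> in at_right 0. \<Omega> \<epsilon> < 1 / (2 * a) \<and> 0 < \<epsilon>"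
      using order_tendstoD(2)[OF \<Omega>_tendsto, of "1 / (2 * a)"] a0
      by (auto intro: eventually_conj eventually_at_right_less)
    then obtain \<epsilon> where \<epsilon>: "\<Omega> \<epsilon> < 1 / (2 * a)" "0 < \<epsilon>"
      using eventually_happens'[OF trivial_limit_at_right_real] by blast
    define b where "b = K * (2 / pi) * ((pi + 1) * \<gamma> / \<epsilon> * integral\<^sup>L lborel F)"
    have b0: "0 \<le> b" unfolding b_def using K0 \<gamma>_nonneg \<epsilon> F_nonneg by (simp add: integral_nonneg_AE)
    have "1 / (2 * (b + 1)) * norm x \<le> norm (?B x)" if x: "x \<in> D" for x
    proof -
      have "norm x \<le> K * norm (?T x - scaleC ?m x)" by (rule K)
      also have "\<dots> \<le> K * (2 / pi * ((\<gamma> + pi) * norm x * \<Omega> \<epsilon>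
          + (pi + 1) * \<gamma> / \<epsilon> * integral\<^sup>L lborel F * norm (?B x)))"
        using K0 by (intro mult_left_mono approximate_eigenvector_estimate \<mu>0 \<epsilon>(2) x) simp
      also have "\<dots> = (a * \<Omega> \<epsilon>) * norm x + b * norm (?B x)"
        by (simp only: a_def b_def algebra_simps)
      also have "\<dots> \<le> 1 / 2 * norm x + (b + 1) * norm (?B x)"
        using \<epsilon>(1) a0 by (intro add_mono mult_right_mono) (auto simp: field_simps)
      finally have "norm x \<le> 2 * ((b + 1) * norm (?B x))" by linarith
      then show ?thesis using b0 by (simp add: field_simps)
    qed
    then show ?thesis using b0 by (intro exI[of _ "1 / (2 * (b + 1))"]) auto
  qed
  ultimately show False using bounded_below_and_dense_range \<mu> by blast
qed

end

section \<open>The reverse inclusion for sectorial operators\<close>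

context half_plane_operator
begin

lemma sectorial_resolvent_bound:
  assumes "sect_half_pi_minus D A"
  shows "\<exists>C\<ge>0. \<forall>w. 0 < Re w \<longrightarrow> cmod w * norm (R w) \<le> C"
proof -
  obtain \<theta> where \<theta>: "0 \<le> \<theta>" "\<theta> < pi / 2" "sectorial \<theta> D A"
    using assms by (auto simp: sect_half_pi_minus_def)
  \<comment> \<open>Any angle strictly between \<theta> and \<open>pi / 2\<close> serves: the sector
    of half-angle \<open>pi - \<theta>'\<close> then contains the open right half-plane.\<close>
  define \<theta>' where "\<theta>' = (\<theta> + pi / 2) / 2"
  have \<theta>': "\<theta> < \<theta>'" "\<theta>' < pi / 2" using \<theta> by (simp_all add: \<theta>'_def)
  then have "\<theta>' \<le> pi" using pi_gt_zero by linarith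
  then obtain C where C: "\<And>z. z \<in> sector (pi - \<theta>') \<Longrightarrow> onorm (\<lambda>x. scaleC z (shifted_inv D A z x)) \<le> C"
    using \<theta>(3) \<theta>'(1) unfolding sectorial_def by blast
  have le: "cmod w * norm (R w) \<le> C" if w: "0 < Re w" for w
  proof -
    have "\<bar>Arg w\<bar> < pi / 2" using w Arg_Re_pos[of w] by auto
    then have "w \<in> sector (pi - \<theta>')" using w \<theta>' by (auto simp: sector_def)
    from C[OF this] have on: "onorm (blinfun_apply (scaleC w (R w))) \<le> C"
      by (simp add: scaleC_blinfun.rep_eq R_apply[OF w])
    have "cmod w * norm (R w) = norm (scaleC w (R w))" by (simp add: norm_scaleC)
    also have "\<dots> = onorm (blinfun_apply (scaleC w (R w)))" by (rule norm_blinfun.rep_eq)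
    finally show ?thesis using on by simp
  qed
  have "norm (R 1) \<le> C" using le[of 1] by simp
  then have "0 \<le> C" by (rule order_trans[OF norm_ge_zero])
  with le show ?thesis by blast
qed

end

context B_calculus
begin

text \<open>Resolvents commute with \<open>T\<close>, and testing with the functional
  \<open>\<phi> \<circ> T\<close> moves \<open>T\<close> through the weak formula.\<close>

lemma B_calc_commute:
  assumes T: "T \<in> commutant (R 1)"
  shows "T (B_calc D A f x) = B_calc D A f (T x)"
proof (rule dual_elem_separates)
  fix \<phi> :: "'a \<Rightarrow> complex" assume \<phi>: "dual_elem \<phi>"
  have "cbounded_op (blinfun_apply T)"
    using commutantD(1)[OF T] by (simp add: cbounded_op_def blinfun.bounded_linear_right)
  then have \<phi>T: "dual_elem (\<lambda>x. \<phi> (T x))" by (rule dual_elem_comp[OF \<phi>])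
  have "T (G x \<alpha> \<beta>) = G (T x) \<alpha> \<beta>" if "0 < \<alpha>" for \<alpha> \<beta>
    using that by (simp add: G_def commutantD(1)[OF T] R_commutant[OF _ T])
  then have "\<Lambda> x (\<lambda>x. \<phi> (T x)) = \<Lambda> (T x) \<phi>"
    unfolding \<Lambda>_def by (intro set_lebesgue_integral_cong) auto
  then show "\<phi> (T (B_calc D A f x)) = \<phi> (B_calc D A f (T x))"
    using B_calc_weak(2)[OF \<phi>T, of x] B_calc_weak(2)[OF \<phi>, of "T x"] by simp
qed

text \<open>A sectorial bound makes the integral defining the calculus converge in operator norm.\<close>

lemma operator_norm_integral:
  assumes C: "0 \<le> C" "\<And>w. 0 < Re w \<Longrightarrow> cmod w * norm (R w) \<le> C"
  obtains V :: "'a \<Rightarrow>\<^sub>L 'a" where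
    "\<And>l. dual_elem l \<Longrightarrow> (LINT \<alpha>:{0<..}|lborel. LINT \<beta>|lborel.
       l (scaleC (of_real \<alpha> * deriv f (Complex \<alpha> \<beta>)) (R (Complex \<alpha> (- \<beta>)) \<odot> R (Complex \<alpha> (- \<beta>))))) = l V"
    "\<And>x \<phi>. dual_elem \<phi> \<Longrightarrow> \<phi> (V x) = \<Lambda> x \<phi>"
proof -
  define H where "H = (\<lambda>\<alpha> \<beta>. scaleC (of_real \<alpha> * deriv f (Complex \<alpha> \<beta>)) (R (Complex \<alpha> (- \<beta>)) \<odot> R (Complex \<alpha> (- \<beta>))))"
  have H_cont: "continuous_on ({0<..} \<times> UNIV) (\<lambda>(\<alpha>, \<beta>). H \<alpha> \<beta>)"
  proof -
    have "continuous_on ({0<..} \<times> UNIV) (\<lambda>p. R (Complex (fst p) (- snd p)) \<odot> R (Complex (fst p) (- snd p)))"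
      by (intro bounded_bilinear.continuous_on[OF bounded_bilinear_blinfun_compose] R_kernel_continuous)
    from continuous_on_scaleC[OF coeff_continuous[unfolded case_prod_beta'] this]
    show ?thesis by (simp add: H_def case_prod_beta')
  qed
  have RR: "norm (R (Complex \<alpha> (- \<beta>)) \<odot> R (Complex \<alpha> (- \<beta>))) * (\<alpha>\<^sup>2 + \<beta>\<^sup>2) \<le> C * C" if "0 < \<alpha>" for \<alpha> \<beta>
  proof -
    define w where "w = Complex \<alpha> (- \<beta>)"
    have w: "0 < Re w" "\<alpha>\<^sup>2 + \<beta>\<^sup>2 = cmod w * cmod w"
      using that cmod_power2[of w] by (simp_all add: w_def power2_eq_square)
    have "norm (R w \<odot> R w) * (cmod w * cmod w) \<le> (norm (R w) * norm (R w)) * (cmod w * cmod w)"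
      by (intro mult_right_mono norm_blinfun_compose) simp
    also have "\<dots> = (cmod w * norm (R w)) * (cmod w * norm (R w))" by (simp add: mult_ac)
    also have "\<dots> \<le> C * C" using C w by (intro mult_mono) auto
    finally show ?thesis by (simp add: w(2) w_def)
  qed
  have H_norm: "norm (H \<alpha> \<beta>) \<le> \<alpha> * F \<alpha> * norm (R (Complex \<alpha> (- \<beta>)) \<odot> R (Complex \<alpha> (- \<beta>)))" if \<alpha>: "0 < \<alpha>" for \<alpha> \<beta>
    using \<alpha> F_bound[OF \<alpha>, of \<beta>] by (simp add: H_def norm_scaleC norm_mult mult_left_mono mult_right_mono)
  have H_le: "norm (H \<alpha> \<beta>) \<le> \<alpha> * F \<alpha> * (C * C) * (1 / (\<alpha>\<^sup>2 + (\<beta> - 0)\<^sup>2))" if \<alpha>: "0 < \<alpha>" for \<alpha> \<beta>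
  proof -
    have "0 < \<alpha>\<^sup>2 + \<beta>\<^sup>2" using \<alpha> by (simp add: add_pos_nonneg)
    then have "norm (R (Complex \<alpha> (- \<beta>)) \<odot> R (Complex \<alpha> (- \<beta>))) \<le> C * C * (1 / (\<alpha>\<^sup>2 + (\<beta> - 0)\<^sup>2))"
      using RR[OF \<alpha>, of \<beta>] by (simp add: field_simps)
    from mult_left_mono[OF this, of "\<alpha> * F \<alpha>"] H_norm[OF \<alpha>, of \<beta>] \<alpha> F_nonneg[of \<alpha>]
    show ?thesis by (simp add: mult.assoc)
  qed
  have l_H: "integrable lborel (\<lambda>\<beta>. l (H \<alpha> \<beta>)) \<and> (LINT \<beta>|lborel. cmod (l (H \<alpha> \<beta>))) \<le> (C * C * pi) * onorm l * F \<alpha>"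
    if l: "dual_elem l" and \<alpha>: "0 < \<alpha>" for \<alpha> and l :: "('a \<Rightarrow>\<^sub>L 'a) \<Rightarrow> complex"
  proof
    let ?b = "\<lambda>\<beta>. onorm l * (\<alpha> * F \<alpha> * (C * C)) * (1 / (\<alpha>\<^sup>2 + (\<beta> - 0)\<^sup>2))"
    have ker: "integrable lborel (\<lambda>\<beta>. 1 / (\<alpha>\<^sup>2 + (\<beta> - 0)\<^sup>2))" "(LINT \<beta>|lborel. 1 / (\<alpha>\<^sup>2 + (\<beta> - 0)\<^sup>2)) = pi / \<alpha>"
      using Cauchy_kernel_integral[OF \<alpha>, of 0] by (simp_all add: has_bochner_integral_iff)
    have b_int: "integrable lborel ?b" by (rule integrable_mult_right[OF ker(1)])
    have le: "cmod (l (H \<alpha> \<beta>)) \<le> ?b \<beta>" for \<beta>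
      using dual_elemD(7)[OF l, of "H \<alpha> \<beta>"] mult_left_mono[OF H_le[OF \<alpha>, of \<beta>] dual_elemD(8)[OF l]]
      by (simp add: mult.assoc)
    have "continuous_on UNIV (\<lambda>\<beta>. (\<lambda>(\<alpha>, \<beta>). H \<alpha> \<beta>) (\<alpha>, \<beta>))"
      using \<alpha> by (intro continuous_on_compose2[OF H_cont] continuous_intros) auto
    then have "continuous_on UNIV (\<lambda>\<beta>. l (H \<alpha> \<beta>))"
      using bounded_linear.continuous_on[OF dual_elemD(1)[OF l]] by simp
    then have "(\<lambda>\<beta>. l (H \<alpha> \<beta>)) \<in> borel_measurable lborel"
      using borel_measurable_continuous_onI by simp
    moreover have "cmod (l (H \<alpha> \<beta>)) \<le> norm (?b \<beta>)" for \<beta>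
      unfolding real_norm_def by (rule order_trans[OF le abs_ge_self])
    ultimately show int: "integrable lborel (\<lambda>\<beta>. l (H \<alpha> \<beta>))"
      by (intro Bochner_Integration.integrable_bound[OF b_int] AE_I2)
    have "(LINT \<beta>|lborel. cmod (l (H \<alpha> \<beta>))) \<le> (LINT \<beta>|lborel. ?b \<beta>)"
      by (rule integral_mono[OF integrable_norm[OF int] b_int le])
    also have "\<dots> = onorm l * (\<alpha> * F \<alpha> * (C * C)) * (pi / \<alpha>)" by (simp only: integral_mult_right_zero ker(2))
    also have "\<dots> = (C * C * pi) * onorm l * F \<alpha>" using \<alpha> by simp
    finally show "(LINT \<beta>|lborel. cmod (l (H \<alpha> \<beta>))) \<le> (C * C * pi) * onorm l * F \<alpha>" .
  qed
  obtain V where V: "\<And>l. dual_elem l \<Longrightarrow> (LINT \<alpha>:{0<..}|lborel. LINT \<beta>|lborel. l (H \<alpha> \<beta>)) = l V"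
  proof (rule weak_double_integral[OF H_cont F_nonneg F_integrable])
    fix a b :: real assume a: "0 < a"
    show "\<exists>C\<ge>0. \<forall>\<alpha>\<in>{a..b}. \<forall>\<beta>. norm (H \<alpha> \<beta>) \<le> C * F \<alpha> * (1 / (1 + \<beta>\<^sup>2))"
    proof (intro exI[of _ "\<bar>b\<bar> * (C * C * (1 + 1 / a\<^sup>2))"] conjI ballI allI)
      show "0 \<le> \<bar>b\<bar> * (C * C * (1 + 1 / a\<^sup>2))" using C by (simp add: add_nonneg_nonneg)
      fix \<alpha> \<beta> assume \<alpha>: "\<alpha> \<in> {a..b}"
      let ?N = "norm (R (Complex \<alpha> (- \<beta>)) \<odot> R (Complex \<alpha> (- \<beta>)))"
      have N: "?N \<le> C * C * (1 + 1 / a\<^sup>2) * (1 / (1 + \<beta>\<^sup>2))"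
        using \<alpha> a RR[of \<alpha> \<beta>] by (intro kernel_decay[of a \<alpha>]) auto
      have "norm (H \<alpha> \<beta>) \<le> \<alpha> * F \<alpha> * ?N" using \<alpha> a by (intro H_norm) auto
      also have "\<dots> \<le> \<bar>b\<bar> * F \<alpha> * (C * C * (1 + 1 / a\<^sup>2) * (1 / (1 + \<beta>\<^sup>2)))"
        using \<alpha> a F_nonneg[of \<alpha>] by (intro mult_mono N) auto
      finally show "norm (H \<alpha> \<beta>) \<le> \<bar>b\<bar> * (C * C * (1 + 1 / a\<^sup>2)) * F \<alpha> * (1 / (1 + \<beta>\<^sup>2))"
        by (simp add: mult_ac)
    qed
  next
    show "0 \<le> C * C * pi" using C by simp
  qed (use l_H in blast)+
  show ?thesis
  proof (rule that[of V])
    show "(LINT \<alpha>:{0<..}|lborel. LINT \<beta>|lborel.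
       l (scaleC (of_real \<alpha> * deriv f (Complex \<alpha> \<beta>)) (R (Complex \<alpha> (- \<beta>)) \<odot> R (Complex \<alpha> (- \<beta>))))) = l V"
      if "dual_elem l" for l using V[OF that] by (simp add: H_def)
    \<comment> \<open>Evaluation at \<open>x\<close> followed by \<phi> is one of the functionals on
      operators that \<open>V\<close> represents.\<close>
    show "\<phi> (V x) = \<Lambda> x \<phi>" if \<phi>: "dual_elem \<phi>" for x \<phi>
    proof -
      have "dual_elem (\<lambda>T :: 'a \<Rightarrow>\<^sub>L 'a. \<phi> (T x))"
        using bounded_linear_compose[OF dual_elemD(1)[OF \<phi>] blinfun.bounded_linear_left]
        by (simp add: dual_elem_def scaleC_blinfun.rep_eq dual_elemD(2)[OF \<phi>])
      from V[OF this] show ?thesis by (simp add: \<Lambda>_def G_def H_def scaleC_blinfun.rep_eq)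
    qed
  qed
qed

theorem spectral_mapping_reverse:
  assumes sect: "sect_half_pi_minus D A"
    and \<nu>: "\<nu> \<in> op_spectrum UNIV (B_calc D A f)" "\<nu> \<noteq> B_inf f"
  shows "\<nu> \<in> B_val f ` op_spectrum D A"
proof -
  let ?T = "B_calc D A f" and ?a = "R 1"
  have one: "0 < Re 1" by simp
  obtain C where C: "0 \<le> C" "\<And>w. 0 < Re w \<Longrightarrow> cmod w * norm (R w) \<le> C"
    using sectorial_resolvent_bound[OF sect] by blast
  obtain V :: "'a \<Rightarrow>\<^sub>L 'a" where V: "\<And>l. dual_elem l \<Longrightarrow> (LINT \<alpha>:{0<..}|lborel. LINT \<beta>|lborel.
       l (scaleC (of_real \<alpha> * deriv f (Complex \<alpha> \<beta>)) (R (Complex \<alpha> (- \<beta>)) \<odot> R (Complex \<alpha> (- \<beta>))))) = l V"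
    and V\<Lambda>: "\<And>x \<phi>. dual_elem \<phi> \<Longrightarrow> \<phi> (V x) = \<Lambda> x \<phi>"
    using operator_norm_integral[OF C] by blast
  \<comment> \<open>\<open>b\<close> is \<open>f(A) - \<nu>\<close>, written through
    \<open>V\<close>, whose values under functionals on operators are known integrals.\<close>
  define b where "b = scaleC (B_inf f - \<nu>) id_blinfun - scaleC (of_real (2 / pi)) V"
  have b_apply: "b x = ?T x - scaleC \<nu> x" for x
  proof (rule dual_elem_separates)
    fix \<phi> :: "'a \<Rightarrow> complex" assume \<phi>: "dual_elem \<phi>"
    show "\<phi> (b x) = \<phi> (?T x - scaleC \<nu> x)"
      by (simp add: b_def blinfun_rep dual_elemD[OF \<phi>] V\<Lambda>[OF \<phi>] B_calc_weak(2)[OF \<phi>] algebra_simps)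
  qed
  note T_op = cbounded_opD[OF B_calc_weak(1)]
  have a: "?a \<in> commutant ?a" by (rule R_in_commutant[OF one])
  have central: "S (b x) = b (S x)" if "S \<in> commutant ?a" for S x
    unfolding b_apply by (simp add: blinfun.diff_right B_calc_commute[OF that] commutantD(1)[OF that])
  have b: "b \<in> commutant ?a"
    unfolding commutant_def
    by (simp add: central[OF a, symmetric]) (simp add: b_apply T_op(2) scaleC_diff_right scaleC_scaleC mult.commute)
  \<comment> \<open>\<open>b\<close> is central, so a right inverse in the commutant is two-sided
    and would be, up to sign, a resolvent of \<open>f(A)\<close> at \<nu>.\<close>
  have ninv: "b \<odot> S \<noteq> id_blinfun" if S: "S \<in> commutant ?a" for S
  proof
    assume eq: "b \<odot> S = id_blinfun"
    have bS: "b (S x) = x" for x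
      using arg_cong[OF eq, of "\<lambda>T. blinfun_apply T x"] by simp
    have "bounded_inverse_of UNIV (\<lambda>x. scaleC \<nu> x - ?T x) (\<lambda>x. - S x)"
      unfolding bounded_inverse_of_def
    proof (intro conjI allI ballI)
      show "cbounded_op (\<lambda>x. - S x)"
        using commutantD(1)[OF S] bounded_linear_minus[OF blinfun.bounded_linear_right[of S]]
        by (simp add: cbounded_op_def scaleC_minus_right)
      show "scaleC \<nu> (- S y) - ?T (- S y) = y" for y
        using bS[of y] by (simp add: b_apply scaleC_minus_right T_op(6))
      show "- S (scaleC \<nu> x - ?T x) = x" for x
        using bS[of x] central[OF S, of x] b_apply[of x] by (metis blinfun.minus_right minus_diff_eq)
    qed simp
    then show False using \<nu>(1) by (auto simp: op_spectrum_def)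
  qed
  obtain r l where l: "dual_elem l" "l id_blinfun \<noteq> 0" "\<And>S. S \<in> commutant ?a \<Longrightarrow> l (b \<odot> S) = 0"
    "\<And>S. S \<in> commutant ?a \<Longrightarrow> l (?a \<odot> S - scaleC r S) = 0"
    using Gelfand_Mazur_commutant[OF a b central ninv] by metis
  note lD = dual_elemD[OF l(1)]
  have la: "l (?a \<odot> S) = r * l S" if "S \<in> commutant ?a" for S using l(4)[OF that] by (simp add: lD)
  have "l b = 0" using l(3)[OF id_in_commutant] by (simp add: blinfun_compose_id)
  then have lV: "(B_inf f - \<nu>) * l id_blinfun = of_real (2 / pi) * l V" by (simp add: b_def lD)
  \<comment> \<open>The resolvent identity transfers the relation \<open>l (a S) = r * l S\<close>
    from \<open>a = R 1\<close> to \<open>R w\<close>: with \<open>r = 1 / (1 + \<mu>)\<close> the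
    factor becomes \<open>1 / (w + \<mu>)\<close>.\<close>
  have lR: "l (R w \<odot> S) * (1 - r * (1 - w)) = r * l S" if w: "0 < Re w" and S: "S \<in> commutant ?a" for w S
  proof -
    have RS: "R w \<odot> S \<in> commutant ?a" by (rule commutant_closed(1)[OF R_in_commutant[OF w] S])
    have "R w \<odot> S = ?a \<odot> (S + scaleC (1 - w) (R w \<odot> S))"
    proof (rule blinfun_eqI)
      fix x
      have "R w (S x) - R 1 (S x) = scaleC (1 - w) (R w (R 1 (S x)))" by (rule resolvent_identity[OF w one])
      then show "(R w \<odot> S) x = (?a \<odot> (S + scaleC (1 - w) (R w \<odot> S))) x"
        by (simp add: blinfun_rep blinfun.add_right R_scaleC[OF one] R_commute[OF w one] algebra_simps)
    qed
    then have "l (R w \<odot> S) = l (?a \<odot> (S + scaleC (1 - w) (R w \<odot> S)))" by (rule arg_cong)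
    also have "\<dots> = r * (l S + (1 - w) * l (R w \<odot> S))"
      using la[OF commutant_closed(2)[OF S commutant_scaleC[OF a RS]]] by (simp add: lD)
    finally show ?thesis by (simp add: algebra_simps)
  qed
  show ?thesis
  proof (cases "r = 0")
    case True
    \<comment> \<open>All squared resolvents are killed by \<open>l\<close>, hence
      \<open>l V = 0\<close>, and only the constant term \<open>f(\<infinity>)\<close> of
      \<open>f(A)\<close> is left.\<close>
    then have "l (scaleC c (R w \<odot> R w)) = 0" if "0 < Re w" for w c
      using lR[OF that R_in_commutant[OF that]] by (simp add: lD)
    then have "(LINT \<alpha>:{0<..}|lborel. LINT \<beta>|lborel.
       l (scaleC (of_real \<alpha> * deriv f (Complex \<alpha> \<beta>)) (R (Complex \<alpha> (- \<beta>)) \<odot> R (Complex \<alpha> (- \<beta>)))))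
       = (LINT \<alpha>:{0::real<..}|lborel. (0 :: complex))"
      by (intro set_lebesgue_integral_cong) auto
    then have "l V = 0" using V[OF l(1)] by (simp add: set_lebesgue_integral_def)
    then show ?thesis using lV l(2) \<nu>(2) by simp
  next
    case False
    \<comment> \<open>\<open>r\<close> is the value that \<open>(1 + A)^-1\<close> takes at \<mu>,
      that is, \<open>r = 1 / (1 + \<mu>)\<close>.\<close>
    define \<mu> where "\<mu> = 1 / r - 1"
    have r\<mu>: "r * (\<mu> + 1) = 1" using False by (simp add: \<mu>_def)
    have \<mu>_spec: "\<mu> \<in> op_spectrum D A"
    proof (rule ccontr)
      assume "\<mu> \<notin> op_spectrum D A"
      then obtain Q where Q: "bounded_inverse_of D (\<lambda>x. scaleC \<mu> x - A x) Q" by (auto simp: op_spectrum_def)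
      have Qc: "cbounded_op Q" and Q1: "\<And>y. Q y \<in> D" "\<And>y. scaleC \<mu> (Q y) - A (Q y) = y"
        and Q2: "\<And>x. x \<in> D \<Longrightarrow> Q (scaleC \<mu> x - A x) = x"
        using Q by (auto simp: bounded_inverse_of_def)
      note QD = cbounded_opD[OF Qc]
      define q where "q = Blinfun Q"
      have q: "blinfun_apply q = Q" unfolding q_def by (rule bounded_linear_Blinfun_apply[OF QD(1)])
      have shift: "scaleC \<mu> (R 1 z) - A (R 1 z) = R 1 (scaleC \<mu> z - A z)" if "z \<in> D" for z
        by (simp add: A_R[OF one] blinfun.diff_right R_scaleC[OF one] R_A[OF one that])
      have comm: "Q (R 1 x) = R 1 (Q x)" for x
        using Q2[OF R_dom[OF one], of "Q x"] by (simp add: shift[OF Q1(1)] Q1(2))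
      have qC: "q \<in> commutant ?a" by (simp add: commutant_def q QD(2) comm)
      \<comment> \<open>If \<open>\<mu> - A\<close> had the inverse \<open>q\<close>, then
        \<open>r\<close> times \<open>R 1\<close> would be a multiple of \<open>R 1 - r\<close>
        within the commutant, which \<open>l\<close> kills; but
        \<open>l (R 1) = r * l id_blinfun\<close> is not 0.\<close>
      have "?a \<odot> q - scaleC r q = scaleC r ?a"
      proof (rule blinfun_eqI)
        fix x
        have "scaleC r (scaleC \<mu> (R 1 x) - A (R 1 x)) = scaleC (r * (\<mu> + 1)) (R 1 x) - scaleC r x"
          by (simp add: A_R[OF one] scaleC_diff_right scaleC_add_left scaleC_add_right
              distrib_left scaleC_scaleC algebra_simps)
        then have "scaleC r (scaleC \<mu> (R 1 x) - A (R 1 x)) = R 1 x - scaleC r x" by (simp only: r\<mu> scaleC_one)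
        then have "Q (R 1 x - scaleC r x) = scaleC r (R 1 x)"
          using Q2[OF R_dom[OF one], of x] QD(2)[of r "scaleC \<mu> (R 1 x) - A (R 1 x)"] by simp
        then show "(?a \<odot> q - scaleC r q) x = (scaleC r ?a) x"
          by (simp add: blinfun_rep q QD comm)
      qed
      then have "r * l ?a = 0" using l(4)[OF qC] by (simp add: lD)
      then have "l ?a = 0" using False by simp
      moreover have "l ?a = r * l id_blinfun" using la[OF id_in_commutant] by (simp add: blinfun_compose_id)
      ultimately show False using False l(2) by simp
    qed
    then have \<mu>0: "0 \<le> Re \<mu>" using spec by auto
    have lR': "l (R w \<odot> S) = 1 / (w + \<mu>) * l S" if w: "0 < Re w" and S: "S \<in> commutant ?a" for w S
    proof -
      have "Re (w + \<mu>) > 0" using w \<mu>0 by simp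
      then have nz: "w + \<mu> \<noteq> 0" by (metis less_irrefl zero_complex.sel(1))
      have "1 - r * (1 - w) = r * (w + \<mu>)" using r\<mu> by (simp add: algebra_simps)
      then have "r * (l (R w \<odot> S) * (w + \<mu>)) = r * l S" using lR[OF w S] by (simp add: mult_ac)
      then have "l (R w \<odot> S) * (w + \<mu>) = l S" using False by (simp only: mult_cancel_left) simp
      then show ?thesis using nz by (simp add: nonzero_eq_divide_eq)
    qed
    have "l V = (LINT \<alpha>:{0<..}|lborel. (complex_of_real \<alpha> *
        (LINT \<beta>|lborel. (1 / (Complex \<alpha> (- \<beta>) + \<mu>))\<^sup>2 * deriv f (Complex \<alpha> \<beta>))) * l id_blinfun)"
      unfolding V[OF l(1), symmetric]
    proof (intro set_lebesgue_integral_cong allI impI)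
      fix \<alpha> :: real assume "\<alpha> \<in> {0<..}"
      then have w: "0 < Re (Complex \<alpha> (- \<beta>))" for \<beta> by simp
      have "l (R w \<odot> R w) = (1 / (w + \<mu>))\<^sup>2 * l id_blinfun" if w: "0 < Re w" for w
        using lR'[OF w R_in_commutant[OF w]] lR'[OF w id_in_commutant]
        by (simp add: blinfun_compose_id power2_eq_square)
      then have eq: "l (scaleC (of_real \<alpha> * deriv f (Complex \<alpha> \<beta>)) (R (Complex \<alpha> (- \<beta>)) \<odot> R (Complex \<alpha> (- \<beta>))))
          = ((1 / (Complex \<alpha> (- \<beta>) + \<mu>))\<^sup>2 * deriv f (Complex \<alpha> \<beta>)) * (of_real \<alpha> * l id_blinfun)" for \<beta>
        using w by (simp add: lD mult_ac)
      have "(LINT \<beta>|lborel. l (scaleC (of_real \<alpha> * deriv f (Complex \<alpha> \<beta>)) (R (Complex \<alpha> (- \<beta>)) \<odot> R (Complex \<alpha> (- \<beta>)))))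
          = (LINT \<beta>|lborel. (1 / (Complex \<alpha> (- \<beta>) + \<mu>))\<^sup>2 * deriv f (Complex \<alpha> \<beta>)) * (of_real \<alpha> * l id_blinfun)"
        unfolding eq by (rule integral_mult_left_zero)
      then show "(LINT \<beta>|lborel. l (scaleC (of_real \<alpha> * deriv f (Complex \<alpha> \<beta>)) (R (Complex \<alpha> (- \<beta>)) \<odot> R (Complex \<alpha> (- \<beta>)))))
          = complex_of_real \<alpha> * (LINT \<beta>|lborel. (1 / (Complex \<alpha> (- \<beta>) + \<mu>))\<^sup>2 * deriv f (Complex \<alpha> \<beta>)) * l id_blinfun"
        by (simp only: mult_ac)
    qed simp
    also have "\<dots> = of_real (pi / 2) * (B_inf f - B_val f \<mu>) * l id_blinfun"
      by (simp only: set_integral_mult_left reproducing_formula[OF \<mu>0])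
    finally have lV': "l V = of_real (pi / 2) * (B_inf f - B_val f \<mu>) * l id_blinfun" .
    have c1: "complex_of_real (2 / pi) * of_real (pi / 2) = 1" by simp
    have "(B_inf f - \<nu>) * l id_blinfun = (B_inf f - B_val f \<mu>) * l id_blinfun"
      unfolding lV lV' mult.assoc[symmetric] c1 by simp
    then have "\<nu> = B_val f \<mu>" using l(2) by simp
    with \<mu>_spec show ?thesis by blast
  qed
qed

end

section \<open>The four assertions together\<close>

theorem theorem4p17:
  fixes D :: "'a::complex_banach set" and A :: "'a \<Rightarrow> 'a"
    and f :: "complex \<Rightarrow> complex" and \<mu> :: complex
  assumes dd: "densely_defined D A"
    and spec: "op_spectrum D A \<subseteq> {z. 0 \<le> Re z}"
    and bnd: "\<And>x \<phi>. dual_elem \<phi> \<Longrightarrow> \<exists>C. \<forall>\<alpha>>0.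
               integrable lborel (\<lambda>\<beta>. cmod (\<phi> (shifted_inv2 D A (Complex \<alpha> \<beta>) x))) \<and>
               \<alpha> * (LINT \<beta>|lborel. cmod (\<phi> (shifted_inv2 D A (Complex \<alpha> \<beta>) x))) \<le> C"
    and fB: "class_B f"
  shows "(\<forall>x. x \<in> D \<and> A x = scaleC \<mu> x \<longrightarrow> B_calc D A f x = scaleC (B_val f \<mu>) x)
    \<and> (\<forall>\<phi>. adjoint_rel D A \<phi> (\<lambda>x. \<mu> * \<phi> x) \<longrightarrow>
          (\<forall>x. \<phi> (B_calc D A f x) = B_val f \<mu> * \<phi> x))
    \<and> (\<mu> \<in> op_spectrum D A \<longrightarrow> B_val f \<mu> \<in> op_spectrum UNIV (B_calc D A f))
    \<and> (sect_half_pi_minus D A \<longrightarrow>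
        op_spectrum UNIV (B_calc D A f) \<union> {B_inf f} = B_val f ` op_spectrum D A \<union> {B_inf f})"
proof -
  have hp: "half_plane_operator D A" using dd spec by unfold_locales
  let ?R = "half_plane_operator.R D A"
  have "\<exists>\<gamma>\<ge>0. \<forall>\<phi> x. \<forall>\<alpha>>0. dual_elem \<phi> \<longrightarrow>
      integrable lborel (\<lambda>\<beta>. \<phi> (?R (Complex \<alpha> \<beta>) (?R (Complex \<alpha> \<beta>) x))) \<and>
      \<alpha> * (LINT \<beta>|lborel. cmod (\<phi> (?R (Complex \<alpha> \<beta>) (?R (Complex \<alpha> \<beta>) x)))) \<le> \<gamma> * onorm \<phi> * norm x"
    by (rule half_plane_operator.uniform_resolvent_bound[OF hp]) (rule bnd)
  then obtain \<gamma> where \<gamma>: "0 \<le> \<gamma>" "\<forall>\<phi> x. \<forall>\<alpha>>0. dual_elem \<phi> \<longrightarrow>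
      integrable lborel (\<lambda>\<beta>. \<phi> (?R (Complex \<alpha> \<beta>) (?R (Complex \<alpha> \<beta>) x))) \<and>
      \<alpha> * (LINT \<beta>|lborel. cmod (\<phi> (?R (Complex \<alpha> \<beta>) (?R (Complex \<alpha> \<beta>) x)))) \<le> \<gamma> * onorm \<phi> * norm x"
    by (elim exE conjE)
  note bound = \<gamma>(2)[rule_format]
  obtain F where F: "B_majorant f F" using class_B_majorant[OF fB] by blast
  have "GSF_operator D A \<gamma>"
    by (rule GSF_operator.intro[OF hp], rule GSF_operator_axioms.intro)
       (rule \<gamma>(1), rule bound[THEN conjunct1], assumption+, rule bound[THEN conjunct2], assumption+)
  then interpret B_calculus D A \<gamma> f F using F by (rule B_calculus.intro)
  \<comment> \<open>One inclusion is (3); the other omits only the value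
    \<open>f(\<infinity>)\<close>, which is adjoined on both sides.\<close>
  have "op_spectrum UNIV (B_calc D A f) \<union> {B_inf f} = B_val f ` op_spectrum D A \<union> {B_inf f}"
    if "sect_half_pi_minus D A"
    using spectral_mapping_reverse[OF that] spectral_inclusion by auto
  then show ?thesis
    using eigenvector adjoint_eigenvector spectral_inclusion by blast
qed

end
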